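(* Let $n\ge 1$, $N\ge 0$ be integers. For $k\in[0,N]_{\mathbb Z}$ let $\mathcal S_k:\mathbb R\to\mathbb R^{2n\times 2n}$ be $C_p^1$ (continuous with piecewise continuous derivative) with $\mathcal S_k(\lambda)$ symplectic and $\Psi(\mathcal S_k(\lambda))\ge 0$ for all $\lambda\in\mathbb R$. Let $Z_k^{[N+1]}(\lambda)$ be the symplectic fundamental matrix of $y_{k+1}(\lambda)=\mathcal S_k(\lambda)y_k(\lambda)$ with $Z_{N+1}^{[N+1]}(\lambda)=I$, $\lambda\in\mathbb R$, let $Y^{[0]}_k(\lambda)$ be the principal solution at $0$, and let $\sigma$ be the set of finite eigenvalues of the Dirichlet problem $y_{k+1}(\lambda)=\mathcal S_k(\lambda)y_k(\lambda)$, $x_0(\lambda)=0=x_{N+1}(\lambda)$. Then for all $a<b$ in $\mathbb R$: $$l_d\big((Z^{[N+1]}(a))^{-1}Y^{[0]}(b),0,N+1\big)+\sum_{a<\nu\le b}n_{Z^{[N+1]}(a)}(\nu)=\#\{\nu\in\sigma\mid a<\nu\le b\},$$ $$-\,l_d\big((Z^{[N+1]}(b))^{-1}Y^{[0]}(a),0,N+1\big)+\sum_{a<\nu\le b}n_{Z^{[N+1]}(b)}(\nu)=\#\{\nu\in\sigma\mid a<\nu\le b\}.$$ If, additionally, there is $\lambda_0\in\mathbb R$ such that $\operatorname{rank}\mathcal B_k(\lambda)=\operatorname{rank}\mathcal B_k(\lambda^-)$ for all $\lambda\le\lambda_0$ and $k\in[0,N]_{\mathbb Z}$, where $\mathcal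 B_k(\lambda)$ is the upper right $n\times n$ block of $\mathcal S_k(\lambda)$, then for any $a<\lambda_1=\min\sigma$ the left-hand sides of both formulas equal the number $\#\{\nu\in\sigma\mid\nu\le b\}$ of finite eigenvalues less than or equal to $b$.
   Context: Notation: $[M,N]_{\mathbb Z}=[M,N]\cap\mathbb Z$; $\mathcal J=\begin{pmatrix}0&I\\-I&0\end{pmatrix}$; $S\in\mathbb R^{2n\times2n}$ is symplectic if $S^T\mathcal JS=\mathcal J$; $\binom{0}{I}$ is the $2n\times n$ matrix with $n\times n$ blocks $0,I$; $A^\dagger$ is the Moore-Penrose inverse; $\operatorname{ind}A$ is the number of negative eigenvalues of a symmetric matrix $A$; $A\ge0$ means symmetric nonnegative definite; $\operatorname{rank}A(\lambda^-)$ is the left-hand limit of $\operatorname{rank}A(\cdot)$ at $\lambda$. For a symplectic $C^1_p$ function $S(\lambda)$ put $\Psi(S(\lambda))=\mathcal J^T\dot S(\lambda)S^{-1}(\lambda)$ (a symmetric matrix), $\dot{}=d/d\lambda$. A solution has the form $y_k=\binom{x_k}{u_k}$ with $x_k,u_k\in\mathbb R^n$. The principal solution at $l\in\{0,N+1\}$ is the $2n\times n$ matrix solution $Y^{[l]}_k(\lambda)=\binom{X^{[l]}_k(\lambda)}{U^{[l]}_k(\lambda)}$ with $Y^{[l]}_l(\lambda)=\binom0I$. A number $\lambda_0$ is a finite eigenvalue of the Dirichlet problem if $\theta(\lambda_0):=\operatorname{rank}X^{[0]}_{N+1}(\lambda_0^-)-\operatorname{rank}X^{[0]}_{N+1}(\lambda_0)\ge1$;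 $\theta(\lambda_0)$ is its multiplicity, and $\#\{\nu\in\sigma\mid\dots\}$ counts finite eigenvalues with multiplicity $\theta$. (Under the hypotheses all left-hand rank limits used here exist.) Forward focal points. For a discrete symplectic system $y_{k+1}=W_ky_k$, $k\in[0,N]_{\mathbb Z}$, with $W_k=\begin{pmatrix}A_k&B_k\\C_k&D_k\end{pmatrix}$, a conjoined basis is a $2n\times n$ matrix solution $Y_k=\binom{X_k}{U_k}$ with $\operatorname{rank}Y_k=n$, $X_k^TU_k=U_k^TX_k$. Its multiplicity of forward focal points in $(k,k+1]$ is $m_d(Y_k)=\operatorname{rank}M_k+\operatorname{ind}P_k$, where $M_k=(I-X_{k+1}X_{k+1}^\dagger)B_k$, $T_k=I-M_k^\dagger M_k$, $P_k=T_kX_kX_{k+1}^\dagger B_kT_k$ (symmetric), and $l_d(Y,0,N+1)=\sum_{k=0}^Nm_d(Y_k)$. Transformed system. For symplectic matrices $R_k$, $k\in[0,N+1]_{\mathbb Z}$, independent of $\lambda$, put $\tilde{\mathcal S}_k(\lambda)=R_{k+1}^{-1}\mathcal S_k(\lambda)R_k$, with upper right $n\times n$ block $\tilde{\mathcal B}_k(\lambda)$, and $\tilde\vartheta_k(\lambda)=\operatorname{rank}\tilde{\mathcal B}_k(\lambda^-)-\operatorname{rank}\tilde{\mathcal B}_k(\lambda)$, $n_R(\lambda)=\sum_{k=0}^N\tilde\vartheta_k(\lambda)$. In $n_{Z^{[N+1]}(\beta)}$ one takes $R_k=Z_k^{[N+1]}(\beta)$. The expression $l_d(R^{-1}Y(\lambda),0,N+1)$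 denotes the number of forward focal points of $R_k^{-1}Y_k(\lambda)$ as a conjoined basis of the system $\tilde y_{k+1}=\tilde{\mathcal S}_k(\lambda)\tilde y_k$. *)

theory Defs
  imports "HOL-Analysis.Analysis"
begin

text \<open>Matrices of size \<open>2n \<times> 2n\<close> and \<open>2n \<times> n\<close> are indexed by the disjoint sum \<open>'n + 'n\<close>,
  where \<open>n = CARD('n)\<close>: \<open>Inl\<close> selects the first and \<open>Inr\<close> the second block.
  The spectral parameter is written \<open>t\<close>.\<close>

definition block_matrix ::
  "real^'n^'n \<Rightarrow> real^'n^'n \<Rightarrow> real^'n^'n \<Rightarrow> real^'n^'n \<Rightarrow> real^('n::finite + 'n)^('n + 'n)" where
  "block_matrix A B C D =
     (\<chi> i j. case i of
        Inl p \<Rightarrow> (case j of Inl q \<Rightarrow> A $ p $ q | Inr q \<Rightarrow> B $ p $ q)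
      | Inr p \<Rightarrow> (case j of Inl q \<Rightarrow> C $ p $ q | Inr q \<Rightarrow> D $ p $ q))"

definition block_column :: "real^'n^'n \<Rightarrow> real^'n^'n \<Rightarrow> real^'n^('n::finite + 'n)" where
  "block_column X U = (\<chi> i j. case i of Inl p \<Rightarrow> X $ p $ j | Inr p \<Rightarrow> U $ p $ j)"

definition upper_right :: "real^('n::finite + 'n)^('n + 'n) \<Rightarrow> real^'n^'n" where
  "upper_right W = (\<chi> i j. W $ Inl i $ Inr j)"

definition upper_block :: "real^'n^('n::finite + 'n) \<Rightarrow> real^'n^'n" where
  "upper_block Y = (\<chi> i j. Y $ Inl i $ j)"

definition JJ :: "real^('n::finite + 'n)^('n + 'n)" where
  "JJ = block_matrix 0 (mat 1) (- mat 1) 0"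

definition symplectic :: "real^('n::finite + 'n)^('n + 'n) \<Rightarrow> bool" where
  "symplectic W \<longleftrightarrow> transpose W ** JJ ** W = JJ"

definition nonneg_definite :: "real^'m^'m \<Rightarrow> bool" where
  "nonneg_definite A \<longleftrightarrow> transpose A = A \<and> (\<forall>x. 0 \<le> x \<bullet> (A *v x))"

text \<open>The number of negative eigenvalues, counted with multiplicity. Used for symmetric
  matrices only, for which geometric and algebraic multiplicities agree.\<close>

definition neg_index :: "real^'m^'m \<Rightarrow> nat" where
  "neg_index A =
     (\<Sum>\<mu> | \<mu> < 0 \<and> (\<exists>v. v \<noteq> 0 \<and> A *v v = \<mu> *\<^sub>R v). dim {v. A *v v = \<mu> *\<^sub>R v})"

text \<open>The Moore-Penrose inverse: the unique solution of the four Penrose equations.\<close>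

definition pinv :: "real^'a^'b \<Rightarrow> real^'b^'a" where
  "pinv A = (THE G. A ** G ** A = A \<and> G ** A ** G = G \<and>
                    transpose (A ** G) = A ** G \<and> transpose (G ** A) = G ** A)"

definition rank_left :: "(real \<Rightarrow> real^'a^'b) \<Rightarrow> real \<Rightarrow> nat" where
  "rank_left A t = Lim (at_left t) (\<lambda>\<mu>. rank (A \<mu>))"

text \<open>\<open>C\<^sup>1\<^sub>p\<close> on the real line: only finitely many exceptional points in each compact interval, and
  the derivative has finite one-sided limits there. (The library's
  \<^const>\<open>piecewise_C1_differentiable_on\<close> allows only finitely many exceptional points in total and
  does not require one-sided limits.)\<close>

definition C1p :: "(real \<Rightarrow> 'v::real_normed_vector) \<Rightarrow> bool" where
  "C1p f \<longleftrightarrow> continuous_on UNIV f \<and>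
     (\<exists>E f'. (\<forall>r s. finite (E \<inter> {r..s})) \<and>
             (\<forall>t. t \<notin> E \<longrightarrow> (f has_vector_derivative f' t) (at t)) \<and>
             continuous_on (- E) f' \<and>
             (\<forall>t\<in>E. (\<exists>L. (f' \<longlongrightarrow> L) (at_left t)) \<and> (\<exists>L. (f' \<longlongrightarrow> L) (at_right t))))"

text \<open>\<open>\<Psi>(S(t)) = J\<^sup>T S'(t) S(t)\<^sup>-\<^sup>1\<close>, where the derivative is taken along the filter \<open>F\<close>. For a
  \<open>C\<^sup>1\<^sub>p\<close> function both one-sided derivatives exist everywhere; where the two-sided derivative
  exists, both choices of \<open>F\<close> below give the same matrix.\<close>

definition Psi :: "(real \<Rightarrow> real^('n::finite + 'n)^('n + 'n)) \<Rightarrow> real \<Rightarrow> real filter \<Rightarrow> real^('n + 'n)^('n + 'n)" where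
  "Psi S t F = transpose JJ ** vector_derivative S F ** matrix_inv (S t)"

definition Psi_nonneg :: "(real \<Rightarrow> real^('n::finite + 'n)^('n + 'n)) \<Rightarrow> real \<Rightarrow> bool" where
  "Psi_nonneg S t \<longleftrightarrow>
     nonneg_definite (Psi S t (at_left t)) \<and> nonneg_definite (Psi S t (at_right t))"

text \<open>Matrix solutions, with any number of columns, of \<open>y\<^sub>k\<^sub>+\<^sub>1 = W\<^sub>k y\<^sub>k\<close> for \<open>0 \<le> k \<le> N\<close>.\<close>

definition matrix_solution ::
  "nat \<Rightarrow> (nat \<Rightarrow> real^('n::finite + 'n)^('n + 'n)) \<Rightarrow> (nat \<Rightarrow> real^'c^('n + 'n)) \<Rightarrow> bool" where
  "matrix_solution N W Y \<longleftrightarrow> (\<forall>k\<le>N. Y (Suc k) = W k ** Y k)"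

subsection \<open>Forward focal points\<close>

definition focal_M ::
  "(nat \<Rightarrow> real^('n::finite + 'n)^('n + 'n)) \<Rightarrow> (nat \<Rightarrow> real^'n^('n + 'n)) \<Rightarrow> nat \<Rightarrow> real^'n^'n" where
  "focal_M W Y k =
     (mat 1 - upper_block (Y (Suc k)) ** pinv (upper_block (Y (Suc k)))) ** upper_right (W k)"

definition focal_T ::
  "(nat \<Rightarrow> real^('n::finite + 'n)^('n + 'n)) \<Rightarrow> (nat \<Rightarrow> real^'n^('n + 'n)) \<Rightarrow> nat \<Rightarrow> real^'n^'n" where
  "focal_T W Y k = mat 1 - pinv (focal_M W Y k) ** focal_M W Y k"

definition focal_P ::
  "(nat \<Rightarrow> real^('n::finite + 'n)^('n + 'n)) \<Rightarrow> (nat \<Rightarrow> real^'n^('n + 'n)) \<Rightarrow> nat \<Rightarrow> real^'n^'n" where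
  "focal_P W Y k =
     focal_T W Y k ** upper_block (Y k) ** pinv (upper_block (Y (Suc k))) **
     upper_right (W k) ** focal_T W Y k"

definition m_d ::
  "(nat \<Rightarrow> real^('n::finite + 'n)^('n + 'n)) \<Rightarrow> (nat \<Rightarrow> real^'n^('n + 'n)) \<Rightarrow> nat \<Rightarrow> nat" where
  "m_d W Y k = rank (focal_M W Y k) + neg_index (focal_P W Y k)"

text \<open>\<open>l_d W Y r s\<close> counts the forward focal points in \<open>(r, s]\<close> of the conjoined basis \<open>Y\<close> of the
  system with coefficients \<open>W\<close>.\<close>

definition l_d ::
  "(nat \<Rightarrow> real^('n::finite + 'n)^('n + 'n)) \<Rightarrow> (nat \<Rightarrow> real^'n^('n + 'n)) \<Rightarrow> nat \<Rightarrow> nat \<Rightarrow> nat" where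
  "l_d W Y r s = (\<Sum>k=r..<s. m_d W Y k)"

subsection \<open>The transformed system\<close>

definition transformed ::
  "(nat \<Rightarrow> real^('n::finite + 'n)^('n + 'n)) \<Rightarrow> (nat \<Rightarrow> real \<Rightarrow> real^('n + 'n)^('n + 'n)) \<Rightarrow>
   nat \<Rightarrow> real \<Rightarrow> real^('n + 'n)^('n + 'n)" where
  "transformed R S k t = matrix_inv (R (Suc k)) ** S k t ** R k"

text \<open>\<open>l_d(R\<^sup>-\<^sup>1 Y(t), 0, N+1)\<close>, taken with respect to the transformed system.\<close>

definition l_d_transformed ::
  "nat \<Rightarrow> (nat \<Rightarrow> real \<Rightarrow> real^('n::finite + 'n)^('n + 'n)) \<Rightarrow> (nat \<Rightarrow> real^('n + 'n)^('n + 'n)) \<Rightarrow>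
   (nat \<Rightarrow> real \<Rightarrow> real^'n^('n + 'n)) \<Rightarrow> real \<Rightarrow> nat" where
  "l_d_transformed N S R Y t =
     l_d (\<lambda>k. transformed R S k t) (\<lambda>k. matrix_inv (R k) ** Y k t) 0 (Suc N)"

definition vartheta ::
  "(nat \<Rightarrow> real^('n::finite + 'n)^('n + 'n)) \<Rightarrow> (nat \<Rightarrow> real \<Rightarrow> real^('n + 'n)^('n + 'n)) \<Rightarrow>
   nat \<Rightarrow> real \<Rightarrow> int" where
  "vartheta R S k t =
     int (rank_left (\<lambda>\<mu>. upper_right (transformed R S k \<mu>)) t) -
     int (rank (upper_right (transformed R S k t)))"

definition n_R ::
  "nat \<Rightarrow> (nat \<Rightarrow> real \<Rightarrow> real^('n::finite + 'n)^('n + 'n)) \<Rightarrow> (nat \<Rightarrow> real^('n + 'n)^('n + 'n)) \<Rightarrow>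
   real \<Rightarrow> int" where
  "n_R N S R t = (\<Sum>k=0..N. vartheta R S k t)"

text \<open>The sum of \<open>n_R(\<nu>)\<close> over \<open>a < \<nu> \<le> b\<close> is a sum over an uncountable index set in which only
  finitely many terms are nonzero; finiteness of \<open>n_R_support\<close> has to be asserted separately, since
  a sum over an infinite set is 0 by convention.\<close>

definition n_R_support ::
  "nat \<Rightarrow> (nat \<Rightarrow> real \<Rightarrow> real^('n::finite + 'n)^('n + 'n)) \<Rightarrow> (nat \<Rightarrow> real^('n + 'n)^('n + 'n)) \<Rightarrow>
   real \<Rightarrow> real \<Rightarrow> real set" where
  "n_R_support N S R a b = {\<nu>. a < \<nu> \<and> \<nu> \<le> b \<and> n_R N S R \<nu> \<noteq> 0}"

definition n_R_sum ::
  "nat \<Rightarrow> (nat \<Rightarrow> real \<Rightarrow> real^('n::finite + 'n)^('n + 'n)) \<Rightarrow> (nat \<Rightarrow> real^('n + 'n)^('n + 'n)) \<Rightarrow>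
   real \<Rightarrow> real \<Rightarrow> int" where
  "n_R_sum N S R a b = (\<Sum>\<nu>\<in>n_R_support N S R a b. n_R N S R \<nu>)"

subsection \<open>Finite eigenvalues\<close>

text \<open>Here \<open>Y\<close> is the principal solution at 0 of the symplectic system under consideration.\<close>

definition fe_mult :: "nat \<Rightarrow> (nat \<Rightarrow> real \<Rightarrow> real^'n^('n::finite + 'n)) \<Rightarrow> real \<Rightarrow> int" where
  "fe_mult N Y t =
     int (rank_left (\<lambda>\<mu>. upper_block (Y (Suc N) \<mu>)) t) - int (rank (upper_block (Y (Suc N) t)))"

definition finite_eigenvalues :: "nat \<Rightarrow> (nat \<Rightarrow> real \<Rightarrow> real^'n^('n::finite + 'n)) \<Rightarrow> real set" where
  "finite_eigenvalues N Y = {t. 1 \<le> fe_mult N Y t}"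

text \<open>The number of finite eigenvalues in \<open>I\<close>, counted with multiplicity; meaningful only if there
  are finitely many of them.\<close>

definition fe_count :: "nat \<Rightarrow> (nat \<Rightarrow> real \<Rightarrow> real^'n^('n::finite + 'n)) \<Rightarrow> real set \<Rightarrow> int" where
  "fe_count N Y I = (\<Sum>\<nu>\<in>finite_eigenvalues N Y \<inter> I. fe_mult N Y \<nu>)"

end

theory Submission
  imports Defs
begin

text \<open>The columns of a conjoined basis span a Lagrangian subspace of \<open>\<real>\<^sup>2\<^sup>n\<close>, and both sides of the two
  formulas count how such subspaces meet the fixed Lagrangian subspace \<open>x = 0\<close> while the spectral
  parameter \<open>t\<close> runs from \<open>a\<close> to \<open>b\<close>.

  Consider a single step of the transformed system: \<open>W(t)\<close> is the coefficient, \<open>P(t)\<close> is a symplectic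
  matrix whose last \<open>n\<close> columns are the solution at \<open>k\<close>, and \<open>W(t) P(t)\<close> plays the same role at \<open>k + 1\<close>.
  Write \<open>X\<close>, \<open>X\<^sub>1\<close>, \<open>B\<close> for the upper right blocks of \<open>P\<close>, \<open>W P\<close>, \<open>W\<close> and \<open>U\<^sub>1\<close>, \<open>D\<close> for the lower right
  blocks of \<open>W P\<close>, \<open>W\<close>. Near a given \<open>t\<^sub>0\<close> a shear \<open>(x, u) \<mapsto> (x, u - \<tau> x)\<close>, which leaves \<open>X\<close>, \<open>X\<^sub>1\<close> and \<open>B\<close>
  alone, makes \<open>U\<^sub>1\<close> and \<open>D\<close> invertible. Then \<open>Q\<^sub>1 = X\<^sub>1 U\<^sub>1\<^sup>-\<^sup>1\<close> and \<open>Q\<^sub>2 = B D\<^sup>-\<^sup>1\<close> are symmetric, and the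
  multiplicity of focal points is the triple index \<open>ind Q\<^sub>2 + ind (Q\<^sub>1 - Q\<^sub>2) - ind Q\<^sub>1\<close>
  (\<open>focal_multiplicity_eq_triple_index\<close>). Because \<open>\<Psi> \<ge> 0\<close>, the three matrices \<open>Q\<^sub>1\<close>, \<open>Q\<^sub>2\<close> and
  \<open>Q\<^sub>3 = D\<^sup>T (Q\<^sub>1 - Q\<^sub>2) D\<close> are nondecreasing in \<open>t\<close>; their ranks are those of \<open>X\<^sub>1\<close>, \<open>B\<close> and \<open>X\<close>.

  For a continuous nondecreasing symmetric \<open>Q\<close> the number of positive eigenvalues is constant on some
  interval \<open>(t\<^sub>0 - \<epsilon>, t\<^sub>0]\<close> and the number of negative ones on some \<open>[t\<^sub>0, t\<^sub>0 + \<epsilon>)\<close>. Hence \<open>rank Q\<close> and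
  \<open>ind Q\<close> drop by the same amount at \<open>t\<^sub>0\<close> (\<open>nondecreasing_symmetric_rank_jump\<close>). Applied to the three
  matrices this gives \<open>step_multiplicity_jump\<close>: the multiplicity of focal points is continuous from the
  right in \<open>t\<close>, and its jump at \<open>t\<^sub>0\<close> is the rank drop of \<open>X\<^sub>1\<close> minus the rank drops of \<open>X\<close> and \<open>B\<close>.

  The sum over \<open>k\<close> telescopes. At \<open>k = 0\<close> there is no rank drop, because the transformed initial value
  does not depend on \<open>t\<close>, and at \<open>k = N + 1\<close> the rank drops are the multiplicities of the finite
  eigenvalues, provided that \<open>R\<^sub>N\<^sub>+\<^sub>1 = I\<close>. Adding up the jumps in \<open>(a, b]\<close> yields
  \<open>transformed_index_change\<close>: \<open>l\<^sub>d(b) - l\<^sub>d(a) = #{\<nu> \<in> \<sigma> | a < \<nu> \<le> b} - \<Sum> n\<^sub>R(\<nu>)\<close>, where \<open>l\<^sub>d(t)\<close>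
  counts the focal points of \<open>R\<^sup>-\<^sup>1 Y(t)\<close> and the sum extends over \<open>a < \<nu> \<le> b\<close>. For \<open>R = Z(a)\<close> all
  transformed coefficients at \<open>t = a\<close> are the identity, so \<open>l\<^sub>d(a) = 0\<close>, which is the first formula;
  \<open>R = Z(b)\<close> gives \<open>l\<^sub>d(b) = 0\<close> and the second.

  For the last part take \<open>R = I\<close>. If the ranks of the blocks \<open>B\<^sub>k\<close> do not drop at any \<open>t \<le> t\<^sub>0\<close>, the
  same identity bounds the number of finite eigenvalues in \<open>(s, t\<^sub>0]\<close> by \<open>l\<^sub>d(t\<^sub>0)\<close>, whatever \<open>s\<close> is. So
  \<open>\<sigma>\<close> is bounded below, and it has a least element as soon as it is nonempty.\<close>

section \<open>The spectral theorem and the negative index\<close>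

lemma symmetric_inner:
  fixes A :: "real^'n^'n"
  assumes "transpose A = A"
  shows "x \<bullet> (A *v y) = (A *v x) \<bullet> y"
  using assms by (metis dot_lmul_matrix vector_transpose_matrix)

lemma transpose_inner:
  fixes A :: "real^'n^'m"
  shows "(transpose A *v x) \<bullet> y = x \<bullet> (A *v y)"
  by (simp add: dot_lmul_matrix)

text \<open>The Rayleigh quotient attains its maximum on the unit sphere of \<open>S\<close>, and it does so at an eigenvector.\<close>

lemma symmetric_eigenvector_in_subspace:
  fixes A :: "real^'n^'n"
  assumes sym: "transpose A = A" and S: "subspace S" "S \<noteq> {0}"
    and inv: "\<And>x. x \<in> S \<Longrightarrow> A *v x \<in> S"
  obtains v \<mu> where "v \<in> S" "norm v = 1" "A *v v = \<mu> *\<^sub>R v"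
proof -
  have "compact (sphere 0 1 \<inter> S)"
    using S(1) by (simp add: closed_subspace compact_Int_closed)
  moreover have "sphere 0 1 \<inter> S \<noteq> {}"
  proof -
    obtain x where x: "x \<in> S" "x \<noteq> 0" using S subspace_0 by blast
    then have "(1 / norm x) *\<^sub>R x \<in> sphere 0 1 \<inter> S"
      using S(1) by (simp add: subspace_scale)
    then show ?thesis by blast
  qed
  moreover have "continuous_on (sphere 0 1 \<inter> S) (\<lambda>x. x \<bullet> (A *v x))"
    by (intro continuous_intros linear_continuous_on_compose[OF continuous_on_id]) auto
  ultimately obtain v where "v \<in> sphere 0 1 \<inter> S"
    and max: "\<forall>x\<in>sphere 0 1 \<inter> S. x \<bullet> (A *v x) \<le> v \<bullet> (A *v v)"
    using continuous_attains_sup[of "sphere 0 1 \<inter> S" "\<lambda>x. x \<bullet> (A *v x)"] by blast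
  then have v: "v \<in> S" "norm v = 1" by simp_all
  define \<mu> where "\<mu> = v \<bullet> (A *v v)"
  have bound: "x \<bullet> (A *v x) \<le> \<mu> * (x \<bullet> x)" if "x \<in> S" for x
  proof (cases "x = 0")
    case False
    have "(1 / norm x) *\<^sub>R x \<bullet> (A *v ((1 / norm x) *\<^sub>R x)) \<le> \<mu>"
      unfolding \<mu>_def using that False S(1) by (intro bspec[OF max]) (simp add: subspace_scale)
    then have "(x \<bullet> (A *v x)) / (norm x)\<^sup>2 \<le> \<mu>"
      by (simp add: matrix_vector_mult_scaleR power2_eq_square)
    then show ?thesis
      using False by (simp add: divide_le_eq dot_square_norm)
  qed simp
  define z where "z = A *v v - \<mu> *\<^sub>R v"
  have zS: "z \<in> S" unfolding z_def using v inv S(1) by (simp add: subspace_diff subspace_scale)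
  have vv: "v \<bullet> v = 1" using v(2) by (simp add: dot_square_norm)
  \<comment> \<open>The first variation of the Rayleigh quotient at its maximum \<open>v\<close> vanishes in the direction
    \<open>z\<close>, the residual of the eigenvalue equation.\<close>
  have var: "2 * t * (z \<bullet> z) \<le> t\<^sup>2 * (\<mu> * (z \<bullet> z) - z \<bullet> (A *v z))" for t
  proof -
    have "v + t *\<^sub>R z \<in> S" using v(1) zS S(1) by (simp add: subspace_add subspace_scale)
    from bound[OF this] have "v \<bullet> (A *v v) + t * (v \<bullet> (A *v z)) + t * (z \<bullet> (A *v v)) + t\<^sup>2 * (z \<bullet> (A *v z))
        \<le> \<mu> * (1 + 2 * t * (v \<bullet> z) + t\<^sup>2 * (z \<bullet> z))"
      by (simp add: algebra_simps inner_add_left inner_add_right matrix_vector_right_distrib vv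
          matrix_vector_mult_scaleR inner_commute power2_eq_square)
    moreover have "v \<bullet> (A *v z) = z \<bullet> (A *v v)"
      using symmetric_inner[OF sym, of v z] by (simp add: inner_commute)
    moreover have "z \<bullet> (A *v v) = z \<bullet> z + \<mu> * (v \<bullet> z)"
      by (simp add: z_def inner_diff_right inner_diff_left algebra_simps inner_commute)
    ultimately show ?thesis by (simp add: \<mu>_def[symmetric] algebra_simps)
  qed
  have "z \<bullet> z \<le> 0"
  proof (rule ccontr)
    define c where "c = \<mu> * (z \<bullet> z) - z \<bullet> (A *v z)"
    assume "\<not> z \<bullet> z \<le> 0"
    then have pos: "z \<bullet> z > 0" by linarith
    define t where "t = (z \<bullet> z) / (\<bar>c\<bar> + 1)"
    have t: "t > 0" using pos by (simp add: t_def)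
    have "2 * t * (z \<bullet> z) \<le> t\<^sup>2 * c" using var c_def by simp
    then have "2 * (z \<bullet> z) \<le> t * c" using t by (simp add: power2_eq_square)
    also have "\<dots> \<le> t * (\<bar>c\<bar> + 1)" using t by (intro mult_left_mono) auto
    also have "\<dots> = z \<bullet> z" by (simp add: t_def)
    finally show False using pos by simp
  qed
  then have "z = 0" by (metis inner_gt_zero_iff not_le)
  then show ?thesis using that v by (simp add: z_def)
qed

text \<open>Splitting off one eigenvector leaves its orthogonal complement in \<open>S\<close>, which is again invariant; hence
  the formulation for invariant subspaces.\<close>

lemma symmetric_orthonormal_eigenbasis_of_subspace:
  fixes A :: "real^'n^'n"
  assumes sym: "transpose A = A"
  shows "subspace S \<Longrightarrow> (\<And>x. x \<in> S \<Longrightarrow> A *v x \<in> S) \<Longrightarrow>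
    \<exists>B\<subseteq>S. pairwise orthogonal B \<and> (\<forall>b\<in>B. norm b = 1 \<and> (\<exists>\<mu>. A *v b = \<mu> *\<^sub>R b)) \<and> span B = S"
proof (induction "dim S" arbitrary: S)
  case 0
  then have "S = {0}" using dim_eq_0 subspace_0 by (metis subset_singletonD empty_iff)
  then show ?case by (intro exI[of _ "{}"]) auto
next
  case (Suc d)
  then have "S \<noteq> {0}" by auto
  with Suc sym obtain v \<mu> where v: "v \<in> S" "norm v = 1" "A *v v = \<mu> *\<^sub>R v"
    by (metis symmetric_eigenvector_in_subspace)
  define S' where "S' = {y \<in> S. v \<bullet> y = 0}"
  have sub': "subspace S'"
    using Suc.prems(1) unfolding S'_def subspace_def by (auto simp: inner_add_right)
  have vv: "v \<bullet> v = 1" using v(2) by (simp add: dot_square_norm)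
  have "dim {y \<in> S. \<forall>x\<in>span {v}. orthogonal x y} + dim (span {v}) = dim S"
    using Suc.prems(1) v(1)
    by (intro dim_subspace_orthogonal_to_vectors) (auto simp: span_minimal)
  moreover have "{y \<in> S. \<forall>x\<in>span {v}. orthogonal x y} = S'"
    by (auto simp: S'_def span_singleton orthogonal_def)
  moreover have "dim (span {v}) = 1" using v(2) by (auto simp: dim_insert)
  ultimately have d: "d = dim S'" using Suc.hyps(2) by simp
  have inv': "A *v x \<in> S'" if "x \<in> S'" for x
    using that Suc.prems(2) symmetric_inner[OF sym, of v x] v(3) by (simp add: S'_def)
  obtain B where B: "B \<subseteq> S'" "pairwise orthogonal B"
    "\<forall>b\<in>B. norm b = 1 \<and> (\<exists>\<mu>. A *v b = \<mu> *\<^sub>R b)" "span B = S'"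
    using Suc.hyps(1)[OF d sub' inv'] by blast
  have "span (insert v B) = S"
  proof
    show "span (insert v B) \<subseteq> S"
      using v B(1) Suc.prems(1) by (intro span_minimal) (auto simp: S'_def)
    show "S \<subseteq> span (insert v B)"
    proof
      fix x assume "x \<in> S"
      then have "x - (v \<bullet> x) *\<^sub>R v \<in> S'"
        using v(1) Suc.prems(1) vv
        by (simp add: S'_def subspace_diff subspace_scale inner_diff_right)
      then have "x - (v \<bullet> x) *\<^sub>R v \<in> span (insert v B)"
        using B(4) span_mono[of B "insert v B"] by auto
      moreover have "(v \<bullet> x) *\<^sub>R v \<in> span (insert v B)"
        by (intro span_mul span_base) simp
      ultimately show "x \<in> span (insert v B)"
        using span_add by fastforce
    qed
  qed
  moreover have "pairwise orthogonal (insert v B)"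
    using B(1,2) by (intro pairwise_orthogonal_insert) (auto simp: S'_def orthogonal_def)
  ultimately show ?case
    using v B by (intro exI[of _ "insert v B"]) (auto simp: S'_def)
qed

definition orthonormal_eigenbasis :: "real^'n^'n \<Rightarrow> (real^'n) set \<Rightarrow> (real^'n \<Rightarrow> real) \<Rightarrow> bool" where
  "orthonormal_eigenbasis A B e \<longleftrightarrow> pairwise orthogonal B \<and> (\<forall>b\<in>B. norm b = 1) \<and> span B = UNIV \<and>
     independent B \<and> (\<forall>b\<in>B. A *v b = e b *\<^sub>R b)"

lemma orthonormal_eigenbasis_exists:
  fixes A :: "real^'n^'n"
  assumes "transpose A = A"
  obtains B e where "orthonormal_eigenbasis A B e"
proof -
  obtain B where B: "pairwise orthogonal B" "span B = UNIV"
    "\<forall>b\<in>B. norm b = 1 \<and> (\<exists>\<mu>. A *v b = \<mu> *\<^sub>R b)"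
    using symmetric_orthonormal_eigenbasis_of_subspace[OF assms, of UNIV] by auto
  then have "independent B"
    by (intro pairwise_orthogonal_independent) auto
  moreover have "\<exists>e. \<forall>b\<in>B. A *v b = e b *\<^sub>R b" using B(3) by (intro bchoice) blast
  ultimately show ?thesis using B that unfolding orthonormal_eigenbasis_def by blast
qed

context
  fixes A :: "real^'n^'n" and B e
  assumes B: "orthonormal_eigenbasis A B e"
begin

lemma eigenbasis_facts:
  shows "finite B" "independent B" "card B = CARD('n)" "span B = UNIV"
    and "\<And>b. b \<in> B \<Longrightarrow> A *v b = e b *\<^sub>R b" "\<And>b. b \<in> B \<Longrightarrow> b \<noteq> 0"
proof -
  show fin: "finite B" "independent B" "span B = UNIV"
    using B independent_bound unfolding orthonormal_eigenbasis_def by blast+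
  show "card B = CARD('n)"
    using dim_eq_card[of B UNIV] fin by (simp add: dim_UNIV)
  show "\<And>b. b \<in> B \<Longrightarrow> A *v b = e b *\<^sub>R b" "\<And>b. b \<in> B \<Longrightarrow> b \<noteq> 0"
    using B unfolding orthonormal_eigenbasis_def by auto
qed

lemma eigenbasis_expand: "x = (\<Sum>b\<in>B. (x \<bullet> b) *\<^sub>R b)"
  using B eigenbasis_facts unfolding orthonormal_eigenbasis_def
  by (intro orthonormal_basis_expand[symmetric]) auto

lemma eigenbasis_mult: "A *v x = (\<Sum>b\<in>B. (e b * (x \<bullet> b)) *\<^sub>R b)"
proof -
  have "A *v x = A *v (\<Sum>b\<in>B. (x \<bullet> b) *\<^sub>R b)" using eigenbasis_expand by simp
  also have "\<dots> = (\<Sum>b\<in>B. (x \<bullet> b) *\<^sub>R (A *v b))"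
    by (simp add: linear_sum[OF matrix_vector_mul_linear] matrix_vector_mult_scaleR)
  also have "\<dots> = (\<Sum>b\<in>B. (e b * (x \<bullet> b)) *\<^sub>R b)"
    using eigenbasis_facts(5) by (intro sum.cong) (auto simp: mult.commute)
  finally show ?thesis .
qed

lemma eigenbasis_form: "x \<bullet> (A *v x) = (\<Sum>b\<in>B. e b * (x \<bullet> b)\<^sup>2)"
  by (subst eigenbasis_mult) (simp add: inner_sum_right power2_eq_square mult.assoc)

lemma eigenbasis_span_coord:
  assumes "C \<subseteq> B" "x \<in> span C" "b \<in> B" "b \<notin> C"
  shows "x \<bullet> b = 0"
proof -
  have "orthogonal b x"
    using assms B unfolding orthonormal_eigenbasis_def pairwise_def
    by (intro orthogonal_to_span[of x C]) (auto, metis subsetD)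
  then show ?thesis by (simp add: orthogonal_def inner_commute)
qed

lemma eigenbasis_in_span:
  assumes "C \<subseteq> B" "\<And>b. b \<in> B \<Longrightarrow> b \<notin> C \<Longrightarrow> x \<bullet> b = 0"
  shows "x \<in> span C"
proof -
  have "x = (\<Sum>b\<in>C. (x \<bullet> b) *\<^sub>R b)"
    using assms eigenbasis_facts(1) sum.mono_neutral_right[of B C "\<lambda>b. (x \<bullet> b) *\<^sub>R b"] eigenbasis_expand[of x]
    by auto
  also have "\<dots> \<in> span C" by (intro span_sum span_mul span_base)
  finally show ?thesis .
qed

lemma eigenbasis_dim_span: "C \<subseteq> B \<Longrightarrow> dim (span C) = card C"
  using eigenbasis_facts(2) independent_mono dim_span_eq_card_independent by blast

lemma eigenspace_eq_span: "{v. A *v v = \<mu> *\<^sub>R v} = span {b \<in> B. e b = \<mu>}"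
proof
  show "{v. A *v v = \<mu> *\<^sub>R v} \<subseteq> span {b \<in> B. e b = \<mu>}"
  proof clarify
    fix v assume v: "A *v v = \<mu> *\<^sub>R v"
    have "v \<bullet> b = 0" if b: "b \<in> B" "e b \<noteq> \<mu>" for b
    proof -
      have "e b * (v \<bullet> b) = (\<Sum>c\<in>B. (e c * (v \<bullet> c)) * (if c = b then 1 else 0))"
        using b eigenbasis_facts(1) by (subst sum.remove[of _ b]) auto
      also have "\<dots> = (\<Sum>c\<in>B. (e c * (v \<bullet> c)) * (c \<bullet> b))"
        using B b unfolding orthonormal_eigenbasis_def
        by (intro sum.cong) (auto simp: pairwise_def orthogonal_def dot_square_norm)
      also have "\<dots> = (A *v v) \<bullet> b"
        by (subst eigenbasis_mult) (simp add: inner_sum_left)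
      also have "\<dots> = \<mu> * (v \<bullet> b)" using v by simp
      finally show ?thesis using b by simp
    qed
    then show "v \<in> span {b \<in> B. e b = \<mu>}" by (intro eigenbasis_in_span) auto
  qed
  have "subspace {v. A *v v = \<mu> *\<^sub>R v}"
    unfolding subspace_def
    by (auto simp: matrix_vector_right_distrib scaleR_add_right matrix_vector_mult_scaleR mult.commute)
  then show "span {b \<in> B. e b = \<mu>} \<subseteq> {v. A *v v = \<mu> *\<^sub>R v}"
    using eigenbasis_facts(5) by (intro span_minimal) auto
qed

text \<open>The eigenspaces are spanned by the basis vectors that they contain, so the geometric multiplicities of
  the negative eigenvalues add up to the number of basis vectors with negative eigenvalue.\<close>

lemma neg_index_eq_card: "neg_index A = card {b \<in> B. e b < 0}"
proof -
  let ?C = "{b \<in> B. e b < 0}"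
  have dims: "dim {v. A *v v = \<mu> *\<^sub>R v} = card {b \<in> B. e b = \<mu>}" for \<mu>
    using eigenspace_eq_span eigenbasis_dim_span[of "{b \<in> B. e b = \<mu>}"] by auto
  have img: "{\<mu>. \<mu> < 0 \<and> (\<exists>v. v \<noteq> 0 \<and> A *v v = \<mu> *\<^sub>R v)} = e ` ?C"
  proof (intro equalityI subsetI)
    fix \<mu> assume "\<mu> \<in> {\<mu>. \<mu> < 0 \<and> (\<exists>v. v \<noteq> 0 \<and> A *v v = \<mu> *\<^sub>R v)}"
    then obtain v where v: "\<mu> < 0" "v \<noteq> 0" "A *v v = \<mu> *\<^sub>R v" by blast
    then have "v \<in> span {b \<in> B. e b = \<mu>}" using eigenspace_eq_span by blast
    then have "{b \<in> B. e b = \<mu>} \<noteq> {}" using v(2) by (metis singletonD span_empty)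
    then show "\<mu> \<in> e ` ?C" using v(1) by auto
  qed (use eigenbasis_facts(5,6) in auto)
  have "card ?C = (\<Sum>\<mu>\<in>e ` ?C. card {b \<in> ?C. e b = \<mu>})"
    using sum.image_gen[of ?C "\<lambda>_. 1::nat" e] eigenbasis_facts(1) by simp
  also have "\<dots> = (\<Sum>\<mu>\<in>e ` ?C. card {b \<in> B. e b = \<mu>})"
    by (intro sum.cong arg_cong[where f = card]) auto
  also have "\<dots> = neg_index A" unfolding neg_index_def img dims ..
  finally show ?thesis ..
qed

end

lemma orthonormal_eigenbasis_uminus:
  assumes "orthonormal_eigenbasis A B e"
  shows "orthonormal_eigenbasis (- A) B (\<lambda>b. - e b)"
proof -
  have "- A *v x = - (A *v x)" for x
    by (metis add_eq_0_iff matrix_vector_mult_add_rdistrib matrix_vector_mult_0 add.right_inverse)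
  then show ?thesis using assms unfolding orthonormal_eigenbasis_def by auto
qed

text \<open>On \<open>P\<close>, the span of the eigenvectors with nonnegative eigenvalue, an isotropic vector lies in
  the kernel. This sharpens nonnegativity just enough to count isotropic directions.\<close>

lemma neg_index_decomposition:
  fixes A :: "real^'n^'n"
  assumes "transpose A = A"
  obtains N P where "subspace N" "subspace P" "dim N = neg_index A" "dim P + neg_index A = CARD('n)"
    "\<And>x. x \<in> N \<Longrightarrow> x \<noteq> 0 \<Longrightarrow> x \<bullet> (A *v x) < 0"
    "\<And>x. x \<in> P \<Longrightarrow> 0 \<le> x \<bullet> (A *v x)"
    "\<And>x. x \<in> P \<Longrightarrow> x \<bullet> (A *v x) = 0 \<Longrightarrow> A *v x = 0"
proof -
  obtain B e where B: "orthonormal_eigenbasis A B e"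
    using orthonormal_eigenbasis_exists[OF assms] .
  note facts = eigenbasis_facts[OF B]
  let ?N = "{b \<in> B. e b < 0}" and ?P = "{b \<in> B. 0 \<le> e b}"
  have coordN: "x \<bullet> b = 0" if "x \<in> span ?N" "b \<in> B" "0 \<le> e b" for x b
    using that eigenbasis_span_coord[OF B, of ?N] by auto
  have coordP: "x \<bullet> b = 0" if "x \<in> span ?P" "b \<in> B" "e b < 0" for x b
    using that eigenbasis_span_coord[OF B, of ?P] by auto
  have "card B = card ?P + card ?N"
    using facts(1) by (subst card_Un_disjoint[symmetric]) (auto intro: arg_cong[where f = card])
  then have dims: "dim (span ?N) = neg_index A" "dim (span ?P) + neg_index A = CARD('n)"
    using eigenbasis_dim_span[OF B, of ?N] eigenbasis_dim_span[OF B, of ?P] neg_index_eq_card[OF B] facts(3)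
    by auto
  have neg: "x \<bullet> (A *v x) < 0" if x: "x \<in> span ?N" "x \<noteq> 0" for x
  proof -
    have le: "e b * (x \<bullet> b)\<^sup>2 \<le> 0" if "b \<in> B" for b
      using coordN[OF x(1) that] by (cases "0 \<le> e b") (auto intro: mult_nonpos_nonneg)
    have "x \<in> span {}" if "\<forall>b\<in>B. x \<bullet> b = 0"
      using that eigenbasis_in_span[OF B, of "{}" x] by simp
    then obtain b where b: "b \<in> B" "x \<bullet> b \<noteq> 0" using x(2) by auto
    then have "e b < 0" using coordN[OF x(1) b(1)] by (meson not_le)
    then have "e b * (x \<bullet> b)\<^sup>2 < 0" using b by (simp add: mult_neg_pos)
    then have "(\<Sum>b\<in>B. - (e b * (x \<bullet> b)\<^sup>2)) > 0"
      using b(1) le facts(1) by (intro sum_pos2[of B b]) auto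
    then show ?thesis by (simp add: eigenbasis_form[OF B] sum_negf)
  qed
  have termP: "0 \<le> e b * (x \<bullet> b)\<^sup>2" if "x \<in> span ?P" "b \<in> B" for x b
    using coordP[OF that] by (cases "0 \<le> e b") auto
  have nonneg: "0 \<le> x \<bullet> (A *v x)" if "x \<in> span ?P" for x
    using termP[OF that] by (auto simp: eigenbasis_form[OF B] intro: sum_nonneg)
  have ker: "A *v x = 0" if x: "x \<in> span ?P" "x \<bullet> (A *v x) = 0" for x
  proof -
    have "e b * (x \<bullet> b)\<^sup>2 = 0" if "b \<in> B" for b
      using x termP[OF x(1)] facts(1) that sum_nonneg_eq_0_iff[of B "\<lambda>b. e b * (x \<bullet> b)\<^sup>2"]
      by (simp add: eigenbasis_form[OF B])
    then have "(e b * (x \<bullet> b)) *\<^sub>R b = 0" if "b \<in> B" for b using that by fastforce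
    then show ?thesis by (subst eigenbasis_mult[OF B]) (rule sum.neutral, blast)
  qed
  show ?thesis
    by (rule that[of "span ?N" "span ?P"]) (use dims neg nonneg ker in auto)
qed

lemma rank_nullity:
  fixes A :: "real^'n^'m"
  shows "rank A + dim {x. A *v x = 0} = CARD('n)"
proof -
  let ?R = "range ((*v) (transpose A))"
  have "dim {y \<in> UNIV. \<forall>x\<in>?R. orthogonal x y} + dim ?R = dim (UNIV :: (real^'n) set)"
    by (intro dim_subspace_orthogonal_to_vectors subspace_UNIV) (auto intro: linear_subspace_image simp del: transpose_matrix_vector)
  moreover have "{y \<in> UNIV. \<forall>x\<in>?R. orthogonal x y} = {x. A *v x = 0}"
  proof -
    have "A *v y = 0" if "\<forall>x. (transpose A *v x) \<bullet> y = 0" for y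
      using that transpose_inner[of A "A *v y" y] by simp
    moreover have "(transpose A *v x) \<bullet> y = 0" if "A *v y = 0" for x y
      using that transpose_inner[of A x y] by simp
    ultimately show ?thesis by (auto simp: orthogonal_def simp del: transpose_matrix_vector)
  qed
  ultimately show ?thesis
    using rank_dim_range[of "transpose A"] rank_transpose[of A]
    by (simp del: transpose_matrix_vector)
qed

lemma rank_eq_neg_index_add:
  fixes A :: "real^'n^'n"
  assumes "transpose A = A"
  shows "rank A = neg_index A + neg_index (- A)"
proof -
  obtain B e where B: "orthonormal_eigenbasis A B e"
    using orthonormal_eigenbasis_exists[OF assms] .
  note facts = eigenbasis_facts[OF B]
  have "dim {x. A *v x = 0 *\<^sub>R x} = card {b \<in> B. e b = 0}"
    using eigenspace_eq_span[OF B, of 0] eigenbasis_dim_span[OF B, of "{b \<in> B. e b = 0}"] by simp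
  then have ker: "dim {x. A *v x = 0} = card {b \<in> B. e b = 0}" by simp
  have "B = {b \<in> B. e b < 0} \<union> {b \<in> B. 0 < e b} \<union> {b \<in> B. e b = 0}" by force
  then have "card B = card ({b \<in> B. e b < 0} \<union> {b \<in> B. 0 < e b} \<union> {b \<in> B. e b = 0})" by simp
  also have "\<dots> = card ({b \<in> B. e b < 0} \<union> {b \<in> B. 0 < e b}) + card {b \<in> B. e b = 0}"
    using facts(1) by (intro card_Un_disjoint) auto
  also have "card ({b \<in> B. e b < 0} \<union> {b \<in> B. 0 < e b}) = card {b \<in> B. e b < 0} + card {b \<in> B. 0 < e b}"
    using facts(1) by (intro card_Un_disjoint) auto
  finally have "card B = card {b \<in> B. e b < 0} + card {b \<in> B. 0 < e b} + card {b \<in> B. e b = 0}" .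
  moreover have "neg_index A = card {b \<in> B. e b < 0}" "neg_index (- A) = card {b \<in> B. 0 < e b}"
    using neg_index_eq_card[OF B] neg_index_eq_card[OF orthonormal_eigenbasis_uminus[OF B]] by auto
  ultimately show ?thesis using ker rank_nullity[of A] facts(3) by simp
qed

lemma dim_add_le_if_Int_trivial:
  fixes S T :: "'a::euclidean_space set"
  assumes "subspace S" "subspace T" "\<And>x. x \<in> S \<Longrightarrow> x \<in> T \<Longrightarrow> x = 0"
  shows "dim S + dim T \<le> DIM('a)"
proof -
  have "S \<inter> T = {0}" using assms subspace_0 by blast
  then have "dim {x + y |x y. x \<in> S \<and> y \<in> T} = dim S + dim T"
    using dim_sums_Int[OF assms(1,2)] by simp
  then show ?thesis using dim_subset_UNIV[of "{x + y |x y. x \<in> S \<and> y \<in> T}"] by linarith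
qed

text \<open>A negative definite subspace meets the nonnegative subspace of the decomposition only in \<open>0\<close>.\<close>

lemma dim_le_neg_index:
  fixes A :: "real^'n^'n"
  assumes "transpose A = A" "subspace S" "\<And>x. x \<in> S \<Longrightarrow> x \<noteq> 0 \<Longrightarrow> x \<bullet> (A *v x) < 0"
  shows "dim S \<le> neg_index A"
proof -
  obtain P where P: "subspace P" "dim P + neg_index A = CARD('n)" "\<And>x. x \<in> P \<Longrightarrow> 0 \<le> x \<bullet> (A *v x)"
    using neg_index_decomposition[OF assms(1)] by metis
  have "x = 0" if "x \<in> S" "x \<in> P" for x
    using assms(3)[OF that(1)] P(3)[OF that(2)] by (meson not_le)
  then have "dim S + dim P \<le> DIM(real^'n)"
    by (intro dim_add_le_if_Int_trivial assms(2) P(1))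
  then show ?thesis using P(2) by simp
qed

lemma neg_index_antimono:
  fixes A C :: "real^'n^'n"
  assumes "transpose A = A" "transpose C = C" "\<And>x. x \<bullet> (A *v x) \<le> x \<bullet> (C *v x)"
  shows "neg_index C \<le> neg_index A"
proof -
  obtain N where "subspace N" "dim N = neg_index C" "\<And>x. x \<in> N \<Longrightarrow> x \<noteq> 0 \<Longrightarrow> x \<bullet> (C *v x) < 0"
    using neg_index_decomposition[OF assms(2)] by metis
  then show ?thesis
    using dim_le_neg_index[OF assms(1), of N] order_le_less_trans[OF assms(3)] by simp
qed

section \<open>The Moore-Penrose inverse\<close>

lemma symmetricI:
  fixes A :: "real^'n^'n"
  assumes "\<And>x y. x \<bullet> (A *v y) = (A *v x) \<bullet> y"
  shows "transpose A = A"
proof -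
  have "transpose A *v x = A *v x" for x
  proof -
    have "\<forall>y. (transpose A *v x) \<bullet> y = (A *v x) \<bullet> y"
      by (simp add: transpose_inner assms del: transpose_matrix_vector)
    then show ?thesis by (metis vector_eq_rdot)
  qed
  then show ?thesis by (simp add: matrix_eq del: transpose_matrix_vector)
qed

lemma orthogonal_projection_exists:
  fixes S :: "(real^'n) set"
  assumes "subspace S"
  obtains p :: "real^'n^'n" where "transpose p = p" "\<And>x. p *v x \<in> S" "\<And>x. x \<in> S \<Longrightarrow> p *v x = x"
proof -
  obtain B where B: "B \<subseteq> S" "pairwise orthogonal B" "\<And>x. x \<in> B \<Longrightarrow> norm x = 1"
    "independent B" "card B = dim S" "span B = S"
    using orthonormal_basis_subspace[OF assms] by metis
  have fin: "finite B" using B(4) independent_bound by blast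
  define f where "f x = (\<Sum>b\<in>B. (x \<bullet> b) *\<^sub>R b)" for x
  have lin: "linear f"
    unfolding f_def by (intro linearI) (simp_all add: inner_add_left scaleR_add_left sum.distrib scaleR_sum_right)
  have f: "matrix f *v x = f x" for x using lin by (simp add: matrix_works)
  have "x \<bullet> f y = f x \<bullet> y" for x y
    by (simp add: f_def inner_sum_right inner_sum_left inner_commute mult.commute)
  then have "transpose (matrix f) = matrix f" by (intro symmetricI) (simp add: f)
  moreover have "matrix f *v x \<in> S" for x
    unfolding f f_def using B(1) assms by (intro subspace_sum) (auto intro: subspace_scale)
  moreover have "matrix f *v x = x" if "x \<in> S" for x
    unfolding f f_def using B fin that by (intro orthonormal_basis_expand) auto
  ultimately show ?thesis using that by blast
qed

lemma penrose_inverse_unique: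
  fixes A :: "real^'a^'b"
  assumes G: "A ** G ** A = A" "G ** A ** G = G"
      "transpose (A ** G) = A ** G" "transpose (G ** A) = G ** A"
    and H: "A ** H ** A = A" "H ** A ** H = H"
      "transpose (A ** H) = A ** H" "transpose (H ** A) = H ** A"
  shows "G = H"
proof -
  have "A ** G = (A ** H) ** (A ** G)" using H(1) by (simp add: matrix_mul_assoc)
  also have "\<dots> = transpose ((A ** G) ** (A ** H))" using G(3) H(3) by (simp add: matrix_transpose_mul)
  also have "(A ** G) ** (A ** H) = A ** H" using G(1) by (simp add: matrix_mul_assoc)
  finally have 1: "A ** G = A ** H" using H(3) by simp
  have "G ** A = (G ** A) ** (H ** A)" using H(1) by (simp add: matrix_mul_assoc[symmetric])
  also have "\<dots> = transpose ((H ** A) ** (G ** A))" using G(4) H(4) by (simp add: matrix_transpose_mul)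
  also have "(H ** A) ** (G ** A) = H ** A" using G(1) by (simp add: matrix_mul_assoc[symmetric])
  finally have 2: "G ** A = H ** A" using H(4) by simp
  have "G = (G ** A) ** G" using G(2) by simp
  also have "\<dots> = H ** (A ** G)" by (simp add: 2 matrix_mul_assoc)
  also have "\<dots> = H" using H(2) by (simp add: 1 matrix_mul_assoc)
  finally show ?thesis .
qed

text \<open>Any right inverse \<open>g\<close> of \<open>A\<close> on its range becomes the Moore-Penrose inverse when it is preceded by the
  orthogonal projection \<open>r\<close> onto the range of \<open>A\<close> and followed by the orthogonal projection \<open>p\<close> along the
  kernel of \<open>A\<close>.\<close>

lemma penrose_inverse_exists:
  fixes A :: "real^'a^'b"
  shows "\<exists>G. A ** G ** A = A \<and> G ** A ** G = G \<and>
    transpose (A ** G) = A ** G \<and> transpose (G ** A) = G ** A"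
proof -
  have "subspace {x. A *v x = 0}"
    unfolding subspace_def by (auto simp: matrix_vector_right_distrib matrix_vector_mult_scaleR)
  then obtain q where q: "transpose q = q" "\<And>x. A *v (q *v x) = 0" "\<And>x. A *v x = 0 \<Longrightarrow> q *v x = x"
    using orthogonal_projection_exists[of "{x. A *v x = 0}"] by auto
  have "subspace (range ((*v) A))" by (intro linear_subspace_image) auto
  then obtain r where r: "transpose r = r" "\<And>x. r *v x \<in> range ((*v) A)" "\<And>x. r *v (A *v x) = A *v x"
    using orthogonal_projection_exists[of "range ((*v) A)"] by (metis rangeI)
  obtain g where g: "linear g" "\<And>y. y \<in> range ((*v) A) \<Longrightarrow> A *v (g y) = y"
    using linear_exists_right_inverse_on[of "(*v) A" UNIV] by auto
  define p where "p = mat 1 - q"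
  define G where "G = p ** matrix g ** r"
  have p: "p *v x = x - q *v x" for x by (simp add: p_def matrix_vector_mult_diff_rdistrib)
  have Ap: "A *v (p *v x) = A *v x" for x by (simp add: p matrix_vector_mult_diff_distrib q(2))
  have Gx: "G *v x = p *v (g (r *v x))" for x
    using g(1) by (simp add: G_def matrix_vector_mul_assoc[symmetric] matrix_works)
  have AG: "A ** G = r"
    by (simp add: matrix_eq matrix_vector_mul_assoc[symmetric] Gx Ap g(2) r(2))
  have GA: "G ** A = p"
  proof -
    have "G *v (A *v x) = p *v x" for x
    proof -
      have "A *v (g (A *v x) - x) = 0" by (simp add: matrix_vector_mult_diff_distrib g(2))
      from q(3)[OF this] have "p *v (g (A *v x) - x) = 0" by (simp add: p)
      then show ?thesis by (simp add: Gx r(3) matrix_vector_mult_diff_distrib)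
    qed
    then show ?thesis by (simp add: matrix_eq matrix_vector_mul_assoc[symmetric])
  qed
  have "A ** G ** A = A" unfolding AG by (simp add: matrix_eq matrix_vector_mul_assoc[symmetric] r(3))
  moreover have "G ** A ** G = G"
  proof -
    have "q *v (p *v x) = 0" for x by (simp add: p matrix_vector_mult_diff_distrib q)
    then have "p *v (p *v x) = p *v x" for x by (metis p diff_zero)
    then show ?thesis unfolding GA by (simp add: matrix_eq matrix_vector_mul_assoc[symmetric] Gx)
  qed
  moreover have "transpose (mat 1 - q) = mat 1 - q"
    using q(1) by (simp add: transpose_def vec_eq_iff mat_def) 
  ultimately show ?thesis using AG GA r(1) p_def by auto
qed

lemma pinv_penrose:
  fixes A :: "real^'a^'b"
  shows "A ** pinv A ** A = A" "pinv A ** A ** pinv A = pinv A"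
    "transpose (A ** pinv A) = A ** pinv A" "transpose (pinv A ** A) = pinv A ** A"
proof -
  have "\<exists>!G. A ** G ** A = A \<and> G ** A ** G = G \<and>
    transpose (A ** G) = A ** G \<and> transpose (G ** A) = G ** A"
    by (rule ex_ex1I[OF penrose_inverse_exists]) (blast intro: penrose_inverse_unique)
  from theI'[OF this] show "A ** pinv A ** A = A" "pinv A ** A ** pinv A = pinv A"
    "transpose (A ** pinv A) = A ** pinv A" "transpose (pinv A ** A) = pinv A ** A"
    unfolding pinv_def by blast+
qed

section \<open>The multiplicity of focal points as a triple index\<close>

lemma dim_Times:
  fixes S :: "'a::euclidean_space set" and T :: "'b::euclidean_space set"
  assumes "subspace S" "subspace T"
  shows "dim (S \<times> T) = dim S + dim T"
proof -
  let ?S = "(\<lambda>x. (x, 0::'b)) ` S" and ?T = "(\<lambda>y. (0::'a, y)) ` T"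
  have lin: "linear (\<lambda>x. (x::'a, 0::'b))" "linear (\<lambda>y. (0::'a, y::'b))"
    by (auto intro!: linearI)
  have "dim {x + y |x y. x \<in> ?S \<and> y \<in> ?T} + dim (?S \<inter> ?T) = dim ?S + dim ?T"
    using assms lin by (intro dim_sums_Int linear_subspace_image)
  moreover have "{x + y |x y. x \<in> ?S \<and> y \<in> ?T} = S \<times> T" by force
  moreover have "?S \<inter> ?T = {0}"
    using subspace_0[OF assms(1)] subspace_0[OF assms(2)] by (auto simp: zero_prod_def)
  moreover have "dim ?S = dim S" "dim ?T = dim T"
    using lin by (auto intro!: dim_image_eq simp: inj_on_def)
  ultimately show ?thesis by simp
qed

lemma dim_image_injective_linear:
  fixes f :: "'a::euclidean_space \<Rightarrow> 'b::euclidean_space"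
  assumes "linear f" "subspace S" "\<And>x. x \<in> S \<Longrightarrow> f x = 0 \<Longrightarrow> x = 0"
  shows "dim (f ` S) = dim S"
proof -
  have "inj_on f S" using assms linear_inj_on_iff_eq_0 by blast
  moreover have "span S = S" using assms(2) by (simp add: span_eq_iff)
  ultimately show ?thesis using assms(1) by (metis dim_image_eq)
qed

lemma dim_Int_ge:
  fixes S T :: "'a::euclidean_space set"
  assumes "subspace S" "subspace T"
  shows "dim S + dim T \<le> dim (S \<inter> T) + DIM('a)"
  using dim_sums_Int[OF assms] dim_subset_UNIV[of "{x + y |x y. x \<in> S \<and> y \<in> T}"] by linarith

text \<open>Both sides are the negative index of one quadratic form on \<open>\<real>\<^sup>n \<times> \<real>\<^sup>n\<close>,
  \<open>h(q, p) = q \<bullet> Q\<^sub>1 q + 2 q \<bullet> Q\<^sub>2 p + p \<bullet> Q\<^sub>2 p = q \<bullet> (Q\<^sub>1 - Q\<^sub>2) q + (q + p) \<bullet> Q\<^sub>2 (q + p)\<close>.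
  The second expression splits \<open>h\<close> orthogonally and gives the right-hand side. For the left-hand side,
  complete the square with respect to \<open>Q\<^sub>1\<close>: this is possible for \<open>p = D c\<close> with \<open>c\<close> in the kernel \<open>K\<close> of
  \<open>M\<close>, since then \<open>Q\<^sub>2 p = Q\<^sub>1 (d c)\<close>, and the remainder is the form of \<open>P\<close>. Each direction in the
  range of \<open>M\<close>, which lies in the kernel of \<open>Q\<^sub>1\<close> and pairs nontrivially with the rest of the
  \<open>p\<close>-space, contributes one hyperbolic plane and thus one negative square.

  Instead of diagonalizing \<open>h\<close>, the proof intersects a subspace from one description on which \<open>h\<close> is
  nonpositive with a subspace from the other on which \<open>h\<close> is nonnegative, in both ways, and compares
  dimensions.\<close>

lemma focal_multiplicity_eq_triple_index:
  fixes X1 U1 B D Q1 Q2 :: "real^'n^'n"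
  assumes inv: "invertible U1" "invertible D"
    and sym: "transpose Q1 = Q1" "transpose Q2 = Q2"
    and X1: "X1 = Q1 ** U1" and B: "B = Q2 ** D" and X: "X = transpose D ** (Q1 - Q2) ** U1"
    and M: "M = (mat 1 - X1 ** pinv X1) ** B" and T: "T = mat 1 - pinv M ** M"
    and P: "P = T ** X ** pinv X1 ** B ** T"
  shows "rank M + neg_index P + neg_index Q1 = neg_index Q2 + neg_index (Q1 - Q2)"
proof -
  let ?E = "X1 ** pinv X1"
  define R where "R = Q1 - Q2"
  define K where "K = {c. M *v c = 0}"
  define d where "d c = U1 *v (pinv X1 *v (B *v c))" for c
  have Bc: "B *v c = Q2 *v (D *v c)" for c by (simp add: B matrix_vector_mul_assoc)
  have X1c: "X1 *v c = Q1 *v (U1 *v c)" for c by (simp add: X1 matrix_vector_mul_assoc)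
  have lind: "d (x + y) = d x + d y" "d (r *\<^sub>R x) = r *\<^sub>R d x" "d 0 = 0" for x y r
    by (simp_all add: d_def matrix_vector_right_distrib matrix_vector_mult_scaleR)
  have Mc: "M *v c = B *v c - Q1 *v d c" for c
    by (simp add: M d_def X1c[symmetric] matrix_vector_mul_assoc[symmetric] matrix_vector_mult_diff_rdistrib)
  have Kd: "Q1 *v d c = B *v c" if "c \<in> K" for c using that Mc by (simp add: K_def)
  have subK: "subspace K"
    unfolding K_def subspace_def by (auto simp: matrix_vector_right_distrib matrix_vector_mult_scaleR)
  have dimK: "rank M + dim K = CARD('n)" unfolding K_def by (rule rank_nullity)
  have TK: "T *v c \<in> K" for c
  proof -
    have "M ** T = 0" unfolding T
      using pinv_penrose(1)[of M] by (simp add: matrix_eq matrix_vector_mul_assoc[symmetric]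
          matrix_vector_mult_diff_rdistrib matrix_vector_mult_diff_distrib)
    then show ?thesis by (simp add: K_def matrix_vector_mul_assoc)
  qed
  have Tid: "T *v c = c" if "c \<in> K" for c
    using that by (simp add: T K_def matrix_vector_mult_diff_rdistrib matrix_vector_mul_assoc[symmetric])
  have symT: "transpose T = T"
  proof -
    have "transpose (mat 1 - pinv M ** M) = mat 1 - transpose (pinv M ** M)"
      by (simp add: transpose_def vec_eq_iff mat_def)
    then show ?thesis using pinv_penrose(4)[of M] by (simp add: T)
  qed
  \<comment> \<open>\<open>?E\<close> is the orthogonal projection onto the range of \<open>X1\<close>, which is the range of \<open>Q1\<close>.\<close>
  have symE: "x \<bullet> (?E *v y) = (?E *v x) \<bullet> y" for x y
    by (rule symmetric_inner[OF pinv_penrose(3)])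
  have EQ1: "?E *v (Q1 *v y) = Q1 *v y" for y
  proof -
    obtain z where "y = U1 *v z"
      using inv(1) by (metis invertible_def matrix_vector_mul_assoc matrix_vector_mul_lid)
    moreover have "?E *v (X1 *v z) = X1 *v z"
      using pinv_penrose(1)[of X1] by (simp only: matrix_vector_mul_assoc)
    ultimately show ?thesis by (simp only: X1c)
  qed
  have EM: "?E *v (M *v c) = 0" for c
    using pinv_penrose(1)[of X1]
    by (simp add: M matrix_vector_mul_assoc[symmetric] matrix_vector_mult_diff_rdistrib
        matrix_vector_mult_diff_distrib) (simp add: matrix_vector_mul_assoc matrix_mul_assoc)
  have Q1M: "Q1 *v (M *v c) = 0" for c
  proof -
    have "y \<bullet> (Q1 *v (M *v c)) = 0" for y
      using symmetric_inner[OF sym(1), of y "M *v c"] symE[of "Q1 *v y" "M *v c"] EQ1[of y] EM[of c] by simp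
    then show ?thesis by (metis inner_eq_zero_iff)
  qed
  have isoM: "e = 0" if e: "e \<in> range ((*v) M)" "Q2 *v e = 0" for e
  proof -
    obtain c where c: "e = M *v c" using e(1) by auto
    have "e \<bullet> (Q1 *v d c) = 0"
      using symmetric_inner[OF sym(1), of e "d c"] Q1M c by simp
    then have "e \<bullet> e = e \<bullet> (B *v c)" by (subst (2) c) (simp add: Mc inner_diff_right)
    also have "\<dots> = 0" using symmetric_inner[OF sym(2), of e "D *v c"] e(2) by (simp add: Bc)
    finally show ?thesis by simp
  qed
  have form: "c \<bullet> (P *v c') = (D *v c) \<bullet> (B *v c') - (Q1 *v d c) \<bullet> d c'" if "c \<in> K" "c' \<in> K" for c c'
  proof -
    have "c \<bullet> (P *v c') = c \<bullet> (T *v (X *v (pinv X1 *v (B *v (T *v c')))))"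
      by (simp add: P matrix_vector_mul_assoc matrix_mul_assoc)
    also have "\<dots> = c \<bullet> (X *v (pinv X1 *v (B *v c')))"
      using symmetric_inner[OF symT] that Tid by simp
    also have "\<dots> = c \<bullet> (transpose D *v (R *v d c'))"
      unfolding d_def X R_def
      by (simp add: matrix_vector_mul_assoc[symmetric] del: transpose_matrix_vector)
    also have "\<dots> = (D *v c) \<bullet> (R *v d c')"
      using transpose_inner[of D "R *v d c'" c] by (metis inner_commute)
    also have "\<dots> = (D *v c) \<bullet> (B *v c') - (Q2 *v (D *v c)) \<bullet> d c'"
      using symmetric_inner[OF sym(2)] Kd[OF that(2)]
      by (simp add: R_def matrix_vector_mult_diff_rdistrib inner_diff_right)
    finally show ?thesis using Kd[OF that(1)] by (simp add: Bc)
  qed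
  have symP: "transpose P = P"
  proof (rule symmetricI)
    fix x y
    have TPT: "P *v z = T *v (P *v (T *v z))" for z
    proof -
      have TT: "T *v (T *v z) = T *v z" for z using Tid TK by blast
      show ?thesis by (simp add: P matrix_vector_mul_assoc[symmetric] TT)
    qed
    have "(T *v x) \<bullet> (P *v (T *v y)) = (T *v y) \<bullet> (P *v (T *v x))"
    proof -
      have "(D *v (T *v x)) \<bullet> (B *v (T *v y)) = (D *v (T *v y)) \<bullet> (B *v (T *v x))"
        unfolding Bc symmetric_inner[OF sym(2), of "D *v (T *v x)"] by (rule inner_commute)
      moreover have "(Q1 *v d (T *v x)) \<bullet> d (T *v y) = (Q1 *v d (T *v y)) \<bullet> d (T *v x)"
        using symmetric_inner[OF sym(1), of "d (T *v x)" "d (T *v y)"]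
        by (simp add: inner_commute[of "d (T *v x)"])
      ultimately show ?thesis unfolding form[OF TK TK] by linarith
    qed
    moreover have "x \<bullet> (P *v y) = (T *v x) \<bullet> (P *v (T *v y))" for x y
      by (subst TPT) (rule symmetric_inner[OF symT])
    ultimately show "x \<bullet> (P *v y) = (P *v x) \<bullet> y" by (metis inner_commute)
  qed
  \<comment> \<open>\<open>h1\<close> and \<open>h2\<close> are the two ways to split \<open>h\<close>.\<close>
  define h where "h q p = q \<bullet> (Q1 *v q) + 2 * (q \<bullet> (Q2 *v p)) + p \<bullet> (Q2 *v p)" for q p
  have h1: "h q p = q \<bullet> (R *v q) + (q + p) \<bullet> (Q2 *v (q + p))" for q p
    using symmetric_inner[OF sym(2), of q p]
    by (simp add: h_def R_def matrix_vector_mult_diff_rdistrib inner_diff_right inner_add_left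
        inner_add_right matrix_vector_right_distrib inner_commute)
  have h2: "h (q - d c + e) (D *v c) = q \<bullet> (Q1 *v q) + c \<bullet> (P *v c)"
    if c: "c \<in> K" and e: "Q1 *v e = 0" for q c e
  proof -
    have e': "e \<bullet> (Q1 *v z) = 0" for z using symmetric_inner[OF sym(1), of e z] e by simp
    have dq: "d c \<bullet> (Q1 *v q) = q \<bullet> (Q1 *v d c)"
      using symmetric_inner[OF sym(1), of q "d c"] by (simp add: inner_commute)
    show ?thesis
      unfolding h_def form[OF c c] Bc[symmetric] Kd[OF c, symmetric]
      by (simp add: matrix_vector_right_distrib matrix_vector_mult_diff_distrib e e' dq inner_add_left
          inner_add_right inner_diff_left inner_diff_right inner_commute[of "Q1 *v d c" "d c"])
  qed
  have Dinj: "c = 0" if "D *v c = 0" for c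
    using inv(2) that by (metis invertible_def matrix_left_invertible_ker)
  have symR: "transpose R = R"
    using symmetric_inner[OF sym(1)] symmetric_inner[OF sym(2)]
    by (intro symmetricI) (simp add: R_def matrix_vector_mult_diff_rdistrib inner_diff_right inner_diff_left)
  obtain N1 P1 where N1: "subspace N1" "subspace P1" "dim N1 = neg_index Q1" "dim P1 + neg_index Q1 = CARD('n)"
    "\<And>x. x \<in> N1 \<Longrightarrow> x \<noteq> 0 \<Longrightarrow> x \<bullet> (Q1 *v x) < 0" "\<And>x. x \<in> P1 \<Longrightarrow> 0 \<le> x \<bullet> (Q1 *v x)"
    using neg_index_decomposition[OF sym(1)] by metis
  obtain N2 P2 where N2: "subspace N2" "subspace P2" "dim N2 = neg_index Q2" "dim P2 + neg_index Q2 = CARD('n)"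
    "\<And>x. x \<in> N2 \<Longrightarrow> x \<noteq> 0 \<Longrightarrow> x \<bullet> (Q2 *v x) < 0" "\<And>x. x \<in> P2 \<Longrightarrow> 0 \<le> x \<bullet> (Q2 *v x)"
    "\<And>x. x \<in> P2 \<Longrightarrow> x \<bullet> (Q2 *v x) = 0 \<Longrightarrow> Q2 *v x = 0"
    using neg_index_decomposition[OF sym(2)] by metis
  obtain NR PR where NR: "subspace NR" "subspace PR" "dim NR = neg_index R" "dim PR + neg_index R = CARD('n)"
    "\<And>x. x \<in> NR \<Longrightarrow> x \<noteq> 0 \<Longrightarrow> x \<bullet> (R *v x) < 0" "\<And>x. x \<in> PR \<Longrightarrow> 0 \<le> x \<bullet> (R *v x)"
    using neg_index_decomposition[OF symR] by metis
  obtain NP PP where NP: "subspace NP" "subspace PP" "dim NP = neg_index P" "dim PP + neg_index P = CARD('n)"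
    "\<And>x. x \<in> NP \<Longrightarrow> x \<noteq> 0 \<Longrightarrow> x \<bullet> (P *v x) < 0" "\<And>x. x \<in> PP \<Longrightarrow> 0 \<le> x \<bullet> (P *v x)"
    using neg_index_decomposition[OF symP] by metis
  have PTT: "c \<bullet> (P *v c) = (T *v c) \<bullet> (P *v (T *v c))" for c
  proof -
    have "P *v c = T *v (P *v (T *v c))"
      using Tid[OF TK] by (simp add: P matrix_vector_mul_assoc[symmetric])
    then show ?thesis using symmetric_inner[OF symT] by metis
  qed
  \<comment> \<open>Since \<open>P = T P T\<close>, a negative definite subspace of \<open>P\<close> can be moved into \<open>K\<close> by the projection \<open>T\<close>.\<close>
  define NK where "NK = (*v) T ` NP"
  have NK: "subspace NK" "dim NK = neg_index P" "NK \<subseteq> K" "\<And>c. c \<in> NK \<Longrightarrow> c \<noteq> 0 \<Longrightarrow> c \<bullet> (P *v c) < 0"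
  proof -
    show "subspace NK" unfolding NK_def by (intro linear_subspace_image NP(1)) auto
    show "NK \<subseteq> K" unfolding NK_def using TK by auto
    have "c = 0" if "c \<in> NP" "T *v c = 0" for c
      using NP(5)[OF that(1)] PTT[of c] that(2) by fastforce
    then show "dim NK = neg_index P"
      unfolding NK_def NP(3)[symmetric] by (intro dim_image_injective_linear NP(1)) auto
    show "c \<bullet> (P *v c) < 0" if "c \<in> NK" "c \<noteq> 0" for c
      using that NP(5) PTT unfolding NK_def by (metis (no_types, lifting) imageE matrix_vector_mult_0_right)
  qed
  define shift where "shift z = (case z of (q, r) \<Rightarrow> (q, r - q))" for z :: "(real^'n) \<times> (real^'n)"
  have shift: "linear shift" "shift z = 0 \<Longrightarrow> z = 0" for z
    by (auto simp: shift_def zero_prod_def algebra_simps split: prod.splits intro!: linearI)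
  define emb where "emb z = (case z of (q, c, e) \<Rightarrow> (q - d c + e, D *v c))" for z :: "(real^'n) \<times> (real^'n) \<times> (real^'n)"
  have lin_emb: "linear emb"
    by (auto simp: emb_def lind matrix_vector_right_distrib matrix_vector_mult_scaleR algebra_simps
        split: prod.splits intro!: linearI)
  have le: "neg_index Q1 + neg_index P + rank M \<le> neg_index R + neg_index Q2"
  proof -
    let ?S = "emb ` (N1 \<times> NK \<times> range ((*v) M))" and ?T = "shift ` (PR \<times> P2)"
    have subM: "subspace (range ((*v) M))" by (intro linear_subspace_image) auto
    have subT: "subspace ?T" using NR N2 shift(1) by (intro linear_subspace_image subspace_Times)
    have subS: "subspace ?S" by (intro linear_subspace_image[OF lin_emb] subspace_Times N1 NK subM)
    have "emb z = 0 \<Longrightarrow> z = 0" if zS: "z \<in> N1 \<times> NK \<times> range ((*v) M)" for z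
    proof -
      obtain q c e where z: "z = (q, c, e)" "q \<in> N1" "e \<in> range ((*v) M)" using zS by auto
      assume "emb z = 0"
      then have "D *v c = 0" "q - d c + e = 0" by (simp_all add: emb_def z zero_prod_def)
      moreover from this have c: "c = 0" using Dinj by blast
      ultimately have qe: "q + e = 0" by (simp add: lind)
      have "Q1 *v (q + e) = 0" by (simp add: qe)
      then have "Q1 *v q = 0" using z(3) Q1M by (auto simp: matrix_vector_right_distrib)
      then have "q = 0" using N1(5)[OF z(2)] by fastforce
      then show "z = 0" using qe c z(1) by (simp add: zero_prod_def)
    qed
    then have "dim ?S = dim N1 + (dim NK + rank M)"
      using dim_image_injective_linear[OF lin_emb] N1(1) NK(1) subM
      by (simp add: dim_Times subspace_Times rank_dim_range)
    moreover have "dim ?T = dim PR + dim P2"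
      using dim_image_injective_linear[OF shift(1)] NR N2 shift(2) by (simp add: dim_Times subspace_Times)
    moreover have "z = 0" if zST: "z \<in> ?S" "z \<in> ?T" for z
    proof -
      obtain q c e where z: "z = (q - d c + e, D *v c)" "q \<in> N1" "c \<in> NK" "e \<in> range ((*v) M)"
        using zST(1) by (auto simp: emb_def)
      obtain q' r where z': "z = (q', r - q')" "q' \<in> PR" "r \<in> P2" using zST(2) by (auto simp: shift_def)
      have q1: "q \<bullet> (Q1 *v q) \<le> 0" using N1(5)[OF z(2)] by (cases "q = 0") auto
      have c1: "c \<bullet> (P *v c) \<le> 0" using NK(4)[OF z(3)] by (cases "c = 0") auto
      have "h (q - d c + e) (D *v c) = h q' (r - q')" using z(1) z'(1) by (metis prod.inject)
      then have eq: "q \<bullet> (Q1 *v q) + c \<bullet> (P *v c) = q' \<bullet> (R *v q') + r \<bullet> (Q2 *v r)"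
        using h2[of c e q] z NK(3) Q1M h1[of q' "r - q'"] by auto
      note pos = NR(6)[OF z'(2)] N2(6)[OF z'(3)]
      \<comment> \<open>On the intersection \<open>h\<close> vanishes. What is left is a vector of the isotropic space, the range of
        \<open>M\<close>, and it is annihilated by \<open>Q2\<close> because it lies in \<open>P2\<close>.\<close>
      have "q \<bullet> (Q1 *v q) = 0" "c \<bullet> (P *v c) = 0" using eq pos q1 c1 by linarith+
      then have q0: "q = 0" and c0: "c = 0" using N1(5)[OF z(2)] NK(4)[OF z(3)] by force+
      then have "r = q'" "q' = e" using z(1) z'(1) by (simp_all add: lind)
      moreover have "r \<bullet> (Q2 *v r) = 0" using eq pos q0 c0 by simp
      ultimately have "Q2 *v e = 0" using N2(7)[OF z'(3)] by simp
      then have "e = 0" using isoM z(4) by blast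
      then show ?thesis using z(1) q0 c0 by (simp add: lind zero_prod_def)
    qed
    ultimately have "dim N1 + (dim NK + rank M) + (dim PR + dim P2) \<le> DIM((real^'n) \<times> (real^'n))"
      using dim_add_le_if_Int_trivial[OF subS subT] by metis
    then show ?thesis using N1(3) NK(2) NR(4) N2(4) by simp
  qed
  have ge: "neg_index R + neg_index Q2 \<le> neg_index Q1 + neg_index P + rank M"
  proof -
    define PK where "PK = PP \<inter> K"
    let ?S = "emb ` (P1 \<times> PK \<times> {0})" and ?T = "shift ` (NR \<times> N2)"
    have PK: "subspace PK" "CARD('n) \<le> dim PK + neg_index P + rank M"
      using dim_Int_ge[OF NP(2) subK] NP(4) dimK subspace_inter[OF NP(2) subK] by (auto simp: PK_def)
    have subT: "subspace ?T" using NR N2 shift(1) by (intro linear_subspace_image subspace_Times)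
    have subS: "subspace ?S"
      using N1 PK lin_emb by (intro linear_subspace_image subspace_Times) auto
    have "emb z = 0 \<Longrightarrow> z = 0" if "z \<in> P1 \<times> PK \<times> {0}" for z
    proof -
      assume "emb z = 0"
      moreover from this have "fst (snd z) = 0"
        using Dinj by (simp add: emb_def zero_prod_def split: prod.splits)
      ultimately show "z = 0" using that by (auto simp: emb_def zero_prod_def lind)
    qed
    then have "dim ?S = dim P1 + dim PK"
      using dim_image_injective_linear[OF lin_emb, of "P1 \<times> PK \<times> {0}"] N1(2) PK(1)
      by (simp add: dim_Times subspace_Times)
    moreover have "dim ?T = dim NR + dim N2"
      using dim_image_injective_linear[OF shift(1)] NR N2 shift(2) by (simp add: dim_Times subspace_Times)
    moreover have "z = 0" if zST: "z \<in> ?S" "z \<in> ?T" for z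
    proof -
      obtain q c where z: "z = (q - d c + 0, D *v c)" "q \<in> P1" "c \<in> PP" "c \<in> K"
        using zST(1) by (auto simp: emb_def PK_def)
      obtain q' r where z': "z = (q', r - q')" "q' \<in> NR" "r \<in> N2" using zST(2) by (auto simp: shift_def)
      have q1: "q' \<bullet> (R *v q') \<le> 0" using NR(5)[OF z'(2)] by (cases "q' = 0") auto
      have r1: "r \<bullet> (Q2 *v r) \<le> 0" using N2(5)[OF z'(3)] by (cases "r = 0") auto
      have "h (q - d c + 0) (D *v c) = h q' (r - q')" using z(1) z'(1) by (metis prod.inject)
      then have eq: "q \<bullet> (Q1 *v q) + c \<bullet> (P *v c) = q' \<bullet> (R *v q') + r \<bullet> (Q2 *v r)"
        using h2[of c 0 q] z h1[of q' "r - q'"] by auto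
      note pos = N1(6)[OF z(2)] NP(6)[OF z(3)]
      have "q' \<bullet> (R *v q') = 0" "r \<bullet> (Q2 *v r) = 0" using eq pos q1 r1 by linarith+
      then have "q' = 0" "r = 0" using NR(5)[OF z'(2)] N2(5)[OF z'(3)] by force+
      then show ?thesis using z'(1) by (simp add: zero_prod_def)
    qed
    ultimately have "dim P1 + dim PK + (dim NR + dim N2) \<le> DIM((real^'n) \<times> (real^'n))"
      using dim_add_le_if_Int_trivial[OF subS subT] by metis
    then show ?thesis using N1(4) PK(2) NR(3) N2(3) by simp
  qed
  show ?thesis using le ge by (simp add: R_def)
qed

section \<open>Matrix-valued functions of a real parameter\<close>

lemma uminus_matrix_vector_mult: "- A *v x = - (A *v x)" for A :: "real^'n^'m"
  by (simp add: vec_eq_iff matrix_vector_mult_def sum_negf)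

lemma bounded_bilinear_matrix_vector_mult:
  "bounded_bilinear (\<lambda>(A::real^'n^'m) x. A *v x)"
  unfolding bilinear_conv_bounded_bilinear[symmetric] bilinear_def
  by (auto intro!: linearI simp: matrix_vector_mult_add_rdistrib scaleR_matrix_vector_assoc)

lemma bounded_bilinear_matrix_matrix_mult:
  "bounded_bilinear (\<lambda>(A::real^'n^'m) (B::real^'p^'n). A ** B)"
proof -
  have "(A + C) ** B = A ** B + C ** B" "A ** (B + D) = A ** B + A ** D"
    "(r *\<^sub>R A) ** B = r *\<^sub>R (A ** B)" "A ** (r *\<^sub>R B) = r *\<^sub>R (A ** B)"
    for A C :: "real^'n^'m" and B D :: "real^'p^'n" and r
    by (simp_all add: matrix_matrix_mult_def vec_eq_iff sum.distrib algebra_simps sum_distrib_left)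
  then show ?thesis
    unfolding bilinear_conv_bounded_bilinear[symmetric] bilinear_def by (auto intro!: linearI)
qed

lemmas tendsto_matrix_mult = bounded_bilinear.tendsto[OF bounded_bilinear_matrix_matrix_mult]
lemmas continuous_on_matrix_mult = bounded_bilinear.continuous_on[OF bounded_bilinear_matrix_matrix_mult]
lemmas has_vector_derivative_matrix_mult =
  bounded_bilinear.has_vector_derivative[OF bounded_bilinear_matrix_matrix_mult]

lemma bounded_linear_matrix_vector_left: "bounded_linear (\<lambda>A::real^'n^'m. A *v x)"
  by (rule bounded_bilinear.bounded_linear_left[OF bounded_bilinear_matrix_vector_mult])

lemma matrix_inv_inverse:
  fixes A :: "real^'n^'n"
  assumes "invertible A"
  shows "A ** matrix_inv A = mat 1" "matrix_inv A ** A = mat 1"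
proof -
  have "A ** matrix_inv A = mat 1 \<and> matrix_inv A ** A = mat 1"
    using assms unfolding invertible_def matrix_inv_def by (rule someI_ex)
  then show "A ** matrix_inv A = mat 1" "matrix_inv A ** A = mat 1" by auto
qed

lemma matrix_inv_vector:
  fixes A :: "real^'n^'n"
  assumes "invertible A"
  shows "A *v (matrix_inv A *v x) = x" "matrix_inv A *v (A *v x) = x"
  using matrix_inv_inverse[OF assms] by (simp_all add: matrix_vector_mul_assoc)

lemma tendsto_det:
  fixes V :: "'a \<Rightarrow> real^'n^'n"
  assumes "(V \<longlongrightarrow> A) F"
  shows "((\<lambda>s. det (V s)) \<longlongrightarrow> det A) F"
  unfolding det_def by (intro tendsto_intros tendsto_vec_nth assms)

lemma eventually_invertible:
  fixes V :: "'a \<Rightarrow> real^'n^'n"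
  assumes "(V \<longlongrightarrow> A) F" "invertible A"
  shows "\<forall>\<^sub>F s in F. invertible (V s)"
  using tendsto_imp_eventually_ne[OF tendsto_det[OF assms(1)]] assms(2) by (simp add: invertible_det_nz)

text \<open>By Cramer's rule the entries of the inverse are quotients of determinants.\<close>

lemma tendsto_matrix_inv:
  fixes V :: "'a \<Rightarrow> real^'n^'n"
  assumes V: "(V \<longlongrightarrow> A) F" and A: "invertible A"
  shows "((\<lambda>s. matrix_inv (V s)) \<longlongrightarrow> matrix_inv A) F"
proof -
  define c where "c M i j = det (\<chi> p q. if q = i then axis j 1 $ p else M $ p $ q) / det M" for M :: "real^'n^'n" and i j
  have c: "matrix_inv M $ i $ j = c M i j" if M: "invertible M" for M i j
  proof -
    have "matrix_inv M *v axis j 1 = (\<chi> k. det (\<chi> p q. if q = k then axis j 1 $ p else M $ p $ q) / det M)"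
      using cramer[of M "matrix_inv M *v axis j 1" "axis j 1"] M
      by (simp add: matrix_inv_vector invertible_det_nz)
    moreover have "(matrix_inv M *v axis j 1) $ i = matrix_inv M $ i $ j"
      by (simp add: matrix_vector_mult_basis column_def)
    ultimately show ?thesis by (simp add: c_def)
  qed
  have "((\<lambda>s. c (V s) i j) \<longlongrightarrow> c A i j) F" for i j
    unfolding c_def using A
    by (intro tendsto_divide tendsto_det tendsto_vec_lambda)
       (auto simp: invertible_det_nz intro!: tendsto_intros tendsto_vec_nth V)
  then have "((\<lambda>s. matrix_inv (V s) $ i $ j) \<longlongrightarrow> matrix_inv A $ i $ j) F" for i j
    unfolding c[OF A]
    by (rule Lim_transform_eventually) (use eventually_invertible[OF V A] in \<open>auto elim: eventually_mono simp: c\<close>)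
  then show ?thesis by (intro vec_tendstoI)
qed

lemma continuous_on_matrix_inv:
  fixes V :: "'a::topological_space \<Rightarrow> real^'n^'n"
  assumes "continuous_on S V" "\<And>t. t \<in> S \<Longrightarrow> invertible (V t)"
  shows "continuous_on S (\<lambda>t. matrix_inv (V t))"
  using assms tendsto_matrix_inv unfolding continuous_on_def by blast

text \<open>The difference quotient of the inverse factors through that of the matrix itself, so the derivative
  is easiest to find in this form.\<close>

lemma has_vector_derivative_iff_quotient:
  fixes f :: "real \<Rightarrow> 'a::real_normed_vector"
  shows "(f has_vector_derivative D) (at t) \<longleftrightarrow> ((\<lambda>s. (1 / (s - t)) *\<^sub>R (f s - f t)) \<longlongrightarrow> D) (at t)"
proof -
  have "norm (f s - f t - (s - t) *\<^sub>R D) / norm (s - t) = norm ((1 / (s - t)) *\<^sub>R (f s - f t) - D)" if "s \<noteq> t" for s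
  proof -
    have "(1 / (s - t)) *\<^sub>R (f s - f t) - D = (1 / (s - t)) *\<^sub>R (f s - f t - (s - t) *\<^sub>R D)"
      using that by (simp add: scaleR_diff_right)
    then show ?thesis by (simp add: divide_inverse mult.commute)
  qed
  then have "((\<lambda>s. norm (f s - f t - (s - t) *\<^sub>R D) / norm (s - t)) \<longlongrightarrow> 0) (at t)
     \<longleftrightarrow> ((\<lambda>s. norm ((1 / (s - t)) *\<^sub>R (f s - f t) - D)) \<longlongrightarrow> 0) (at t)"
    by (intro tendsto_cong) (auto simp: eventually_at_filter)
  then show ?thesis
    unfolding has_vector_derivative_def has_derivative_iff_norm
    by (simp add: tendsto_norm_zero_iff LIM_zero_iff bounded_linear_scaleR_left)
qed

lemma has_vector_derivative_matrix_inv: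
  fixes V :: "real \<Rightarrow> real^'n^'n"
  assumes V: "(V has_vector_derivative V') (at t)" and inv: "invertible (V t)"
  shows "((\<lambda>s. matrix_inv (V s)) has_vector_derivative - (matrix_inv (V t) ** V' ** matrix_inv (V t))) (at t)"
proof -
  have lim: "(V \<longlongrightarrow> V t) (at t)"
    using has_vector_derivative_continuous[OF V] by (simp add: continuous_at)
  have q: "((\<lambda>s. (1 / (s - t)) *\<^sub>R (V s - V t)) \<longlongrightarrow> V') (at t)"
    using V by (simp add: has_vector_derivative_iff_quotient)
  have "((\<lambda>s. - (matrix_inv (V s) ** ((1 / (s - t)) *\<^sub>R (V s - V t)) ** matrix_inv (V t))) \<longlongrightarrow>
      - (matrix_inv (V t) ** V' ** matrix_inv (V t))) (at t)"
    by (intro tendsto_minus tendsto_matrix_mult tendsto_matrix_inv lim inv q tendsto_const)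
  then show ?thesis unfolding has_vector_derivative_iff_quotient
  proof (rule Lim_transform_eventually)
    show "\<forall>\<^sub>F s in at t. - (matrix_inv (V s) ** ((1 / (s - t)) *\<^sub>R (V s - V t)) ** matrix_inv (V t))
        = (1 / (s - t)) *\<^sub>R (matrix_inv (V s) - matrix_inv (V t))"
      using eventually_invertible[OF lim inv]
    proof (rule eventually_mono)
      fix s assume s: "invertible (V s)"
      have "(- (matrix_inv (V s) ** (r *\<^sub>R (V s - V t)) ** matrix_inv (V t))) *v x
        = (r *\<^sub>R (matrix_inv (V s) - matrix_inv (V t))) *v x" for r x
        using matrix_inv_vector[OF s] matrix_inv_vector[OF inv]
        by (simp add: matrix_vector_mul_assoc[symmetric] matrix_vector_mult_diff_rdistrib matrix_vector_mult_scaleR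
            matrix_vector_mult_diff_distrib scaleR_matrix_vector_assoc[symmetric] scaleR_diff_right
            uminus_matrix_vector_mult)
      then show "- (matrix_inv (V s) ** ((1 / (s - t)) *\<^sub>R (V s - V t)) ** matrix_inv (V t))
        = (1 / (s - t)) *\<^sub>R (matrix_inv (V s) - matrix_inv (V t))"
        by (simp add: matrix_eq)
    qed
  qed
qed

text \<open>The fundamental theorem of calculus tolerates finitely many points without a derivative if the
  function is continuous.\<close>

lemma nondecreasing_if_derivative_nonneg_except_finite:
  fixes f :: "real \<Rightarrow> real"
  assumes "a \<le> b" "continuous_on {a..b} f" "finite E"
    and "\<And>t. t \<in> {a<..<b} - E \<Longrightarrow> \<exists>D\<ge>0. (f has_vector_derivative D) (at t)"
  shows "f a \<le> f b"
proof -
  obtain g where g: "\<And>t. t \<in> {a<..<b} - E \<Longrightarrow> g t \<ge> 0 \<and> (f has_vector_derivative g t) (at t)"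
    using assms(4) by metis
  define D where "D t = (if t \<in> {a<..<b} - E then g t else 0)" for t
  have "(D has_integral (f b - f a)) {a..b}"
    using assms(1-3) g by (intro fundamental_theorem_of_calculus_interior_strong[of E]) (auto simp: D_def)
  then have "0 \<le> f b - f a"
    by (rule has_integral_nonneg) (use g in \<open>auto simp: D_def\<close>)
  then show ?thesis by simp
qed

section \<open>Rank jumps of nondecreasing symmetric matrices\<close>

text \<open>By compactness of the unit sphere, a negative definite form on a subspace stays negative definite
  under small perturbations.\<close>

lemma neg_index_lower_semicontinuous:
  fixes Q :: "'a \<Rightarrow> real^'n^'n"
  assumes lim: "(Q \<longlongrightarrow> A) F" and sym: "transpose A = A" "\<forall>\<^sub>F t in F. transpose (Q t) = Q t"
  shows "\<forall>\<^sub>F t in F. neg_index A \<le> neg_index (Q t)"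
proof -
  obtain N where N: "subspace N" "dim N = neg_index A" "\<And>x. x \<in> N \<Longrightarrow> x \<noteq> 0 \<Longrightarrow> x \<bullet> (A *v x) < 0"
    using neg_index_decomposition[OF sym(1)] by metis
  obtain c where c: "c > 0" "\<And>x. x \<in> N \<Longrightarrow> x \<bullet> (A *v x) \<le> - c * (norm x)\<^sup>2"
  proof (cases "N = {0}")
    case True then show ?thesis using that[of 1] by simp
  next
    case False
    then obtain y where y: "y \<in> N" "y \<noteq> 0" using N(1) subspace_0 by blast
    have "(1 / norm y) *\<^sub>R y \<in> sphere 0 1 \<inter> N" using y N(1) by (simp add: subspace_scale)
    then have "sphere 0 1 \<inter> N \<noteq> {}" by blast
    moreover have "compact (sphere 0 1 \<inter> N)"
      using N(1) by (simp add: closed_subspace compact_Int_closed)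
    moreover have "continuous_on (sphere 0 1 \<inter> N) (\<lambda>x. x \<bullet> (A *v x))"
      by (intro continuous_intros linear_continuous_on_compose[OF continuous_on_id]) auto
    ultimately obtain v where v: "v \<in> sphere 0 1 \<inter> N"
      and max: "\<forall>x\<in>sphere 0 1 \<inter> N. x \<bullet> (A *v x) \<le> v \<bullet> (A *v v)"
      using continuous_attains_sup[of "sphere 0 1 \<inter> N" "\<lambda>x. x \<bullet> (A *v x)"] by blast
    define c where "c = - (v \<bullet> (A *v v))"
    have "v \<noteq> 0" using v by auto
    then have "c > 0" using N(3)[of v] v by (simp add: c_def)
    moreover have "x \<bullet> (A *v x) \<le> - c * (norm x)\<^sup>2" if x: "x \<in> N" for x
    proof (cases "x = 0")
      case False
      have "(1 / norm x) *\<^sub>R x \<in> sphere 0 1 \<inter> N" using x False N(1) by (simp add: subspace_scale)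
      from bspec[OF max this] have "(x \<bullet> (A *v x)) / (norm x)\<^sup>2 \<le> - c"
        by (simp add: c_def matrix_vector_mult_scaleR power2_eq_square)
      then show ?thesis using False by (simp add: divide_le_eq)
    qed simp
    ultimately show ?thesis using that by blast
  qed
  obtain K where K: "K > 0" "\<And>(M::real^'n^'n) x. norm (M *v x) \<le> norm M * norm x * K"
    using bounded_bilinear.pos_bounded[OF bounded_bilinear_matrix_vector_mult] by metis
  have "\<forall>\<^sub>F t in F. dist (Q t) A < c / K" using tendstoD[OF lim] c(1) K(1) by simp
  then show ?thesis using sym(2)
  proof eventually_elim
    case (elim t)
    have "x \<bullet> (Q t *v x) < 0" if x: "x \<in> N" "x \<noteq> 0" for x
    proof -
      have "x \<bullet> ((Q t - A) *v x) \<le> norm x * norm ((Q t - A) *v x)" by (rule norm_cauchy_schwarz)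
      also have "\<dots> \<le> norm x * (norm (Q t - A) * norm x * K)" by (intro mult_left_mono K(2)) auto
      also have "\<dots> = (norm (Q t - A) * K) * (norm x)\<^sup>2" by (simp add: power2_eq_square)
      also have "\<dots> < c * (norm x)\<^sup>2"
        using elim(1) K(1) x(2) by (intro mult_strict_right_mono) (auto simp: dist_norm less_divide_eq)
      finally show ?thesis
        using c(2)[OF x(1)] by (simp add: matrix_vector_mult_diff_rdistrib inner_diff_right)
    qed
    then show ?case using dim_le_neg_index[OF elim(2) N(1)] N(2) by simp
  qed
qed

lemma eventually_const_at_left_if_antimono:
  fixes f :: "real \<Rightarrow> nat"
  assumes "a < t0" "\<And>s t. a < s \<Longrightarrow> s \<le> t \<Longrightarrow> t < t0 \<Longrightarrow> f t \<le> f s"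
  shows "\<exists>m. \<forall>\<^sub>F t in at_left t0. f t = m"
proof -
  have "\<exists>s. a < s \<and> s < t0" using assms(1) dense by blast
  then obtain s where s: "a < s" "s < t0" and min: "\<And>t. a < t \<and> t < t0 \<Longrightarrow> f s \<le> f t"
    using ex_has_least_nat[of "\<lambda>t. a < t \<and> t < t0" _ f] by auto
  have "f t = f s" if "s < t" "t < t0" for t
    using assms(2)[of s t] min[of t] s that by fastforce
  then show ?thesis using s(2) eventually_at_left_field by blast
qed

lemma eventually_const_at_right_if_mono:
  fixes f :: "real \<Rightarrow> nat"
  assumes "t0 < b" "\<And>s t. t0 < s \<Longrightarrow> s \<le> t \<Longrightarrow> t < b \<Longrightarrow> f s \<le> f t"
  shows "\<exists>m. \<forall>\<^sub>F t in at_right t0. f t = m"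
proof -
  have "\<exists>s. t0 < s \<and> s < b" using assms(1) dense by blast
  then obtain s where s: "t0 < s" "s < b" and min: "\<And>t. t0 < t \<and> t < b \<Longrightarrow> f s \<le> f t"
    using ex_has_least_nat[of "\<lambda>t. t0 < t \<and> t < b" _ f] by auto
  have "f t = f s" if "t0 < t" "t < s" for t
    using assms(2)[of t s] min[of t] s that by fastforce
  then show ?thesis using s(1) eventually_at_right_field by blast
qed

text \<open>Monotonicity makes \<open>neg_index (Q t)\<close> nonincreasing and \<open>neg_index (- Q t)\<close>, the number of positive
  eigenvalues, nondecreasing; semicontinuity bounds both from below near \<open>t0\<close>. So the latter is constant
  up to \<open>t0\<close> from the left and the former from \<open>t0\<close> on to the right. The other count is monotone with
  values in \<open>\<nat>\<close> and therefore eventually constant on either side, but possibly different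
  from its value at \<open>t0\<close>.\<close>

lemma nondecreasing_symmetric_rank_jump:
  fixes Q :: "real \<Rightarrow> real^'n^'n"
  assumes I: "a < t0" "t0 < b" and cont: "(Q \<longlongrightarrow> Q t0) (at t0)"
    and sym: "\<And>t. a < t \<Longrightarrow> t < b \<Longrightarrow> transpose (Q t) = Q t"
    and mono: "\<And>s t x. a < s \<Longrightarrow> s \<le> t \<Longrightarrow> t < b \<Longrightarrow> x \<bullet> (Q s *v x) \<le> x \<bullet> (Q t *v x)"
  shows "\<exists>r m. (\<forall>\<^sub>F t in at_left t0. rank (Q t) = r \<and> neg_index (Q t) = m) \<and>
      r + neg_index (Q t0) = rank (Q t0) + m \<and> neg_index (Q t0) \<le> m"
    and "\<exists>r. \<forall>\<^sub>F t in at_right t0. rank (Q t) = r \<and> neg_index (Q t) = neg_index (Q t0)"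
proof -
  have symm: "transpose (- Q t) = - Q t" if "a < t" "t < b" for t
    using sym[OF that] by (simp add: transpose_def vec_eq_iff)
  have neg_mono: "neg_index (Q t) \<le> neg_index (Q s)" if "a < s" "s \<le> t" "t < b" for s t
    using that sym mono by (intro neg_index_antimono) auto
  have pos_mono: "neg_index (- Q s) \<le> neg_index (- Q t)" if "a < s" "s \<le> t" "t < b" for s t
    using that symm mono by (intro neg_index_antimono) (auto simp: uminus_matrix_vector_mult)
  have near: "\<forall>\<^sub>F t in at t0 within S. a < t \<and> t < b" for S
    using I by (intro eventually_at_topological[THEN iffD2] exI[of _ "{a<..<b}"]) auto
  have lim: "(Q \<longlongrightarrow> Q t0) (at t0 within S)" for S
    using cont by (rule tendsto_within_subset) simp
  have sc: "\<forall>\<^sub>F t in at t0 within S. neg_index (Q t0) \<le> neg_index (Q t)" for S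
    by (intro neg_index_lower_semicontinuous lim sym I eventually_mono[OF near]) auto
  have sc': "\<forall>\<^sub>F t in at t0 within S. neg_index (- Q t0) \<le> neg_index (- Q t)" for S
    by (intro neg_index_lower_semicontinuous tendsto_minus lim symm I eventually_mono[OF near]) auto
  obtain m where m: "\<forall>\<^sub>F t in at_left t0. neg_index (Q t) = m"
    using eventually_const_at_left_if_antimono[OF I(1), of "\<lambda>t. neg_index (Q t)"] neg_mono I by (metis less_trans)
  have L: "\<forall>\<^sub>F t in at_left t0. a < t \<and> t < b \<and> t < t0"
    using near[of "{..<t0}"] eventually_at_left_field[of _ t0] by (auto simp: eventually_at_filter elim: eventually_mono)
  have R: "\<forall>\<^sub>F t in at_right t0. a < t \<and> t < b \<and> t0 < t"
    using near[of "{t0<..}"] by (auto simp: eventually_at_filter elim: eventually_mono)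
  have left: "\<forall>\<^sub>F t in at_left t0. rank (Q t) = m + neg_index (- Q t0) \<and> neg_index (Q t) = m \<and> neg_index (Q t0) \<le> m"
    using m sc[of "{..<t0}"] sc'[of "{..<t0}"] L
  proof eventually_elim
    case (elim t)
    then have "neg_index (- Q t) = neg_index (- Q t0)" using pos_mono[of t t0] I by simp
    then show ?case using elim rank_eq_neg_index_add[OF sym[of t]] by simp
  qed
  have "neg_index (Q t0) \<le> m"
    using eventually_happens[OF left] trivial_limit_at_left_real by blast
  moreover have "rank (Q t0) = neg_index (Q t0) + neg_index (- Q t0)"
    by (rule rank_eq_neg_index_add[OF sym[OF I]])
  ultimately show "\<exists>r m. (\<forall>\<^sub>F t in at_left t0. rank (Q t) = r \<and> neg_index (Q t) = m) \<and>
      r + neg_index (Q t0) = rank (Q t0) + m \<and> neg_index (Q t0) \<le> m"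
    by (intro exI[of _ "m + neg_index (- Q t0)"] exI[of _ m] conjI eventually_mono[OF left]) simp_all
  obtain p where p: "\<forall>\<^sub>F t in at_right t0. neg_index (- Q t) = p"
    using eventually_const_at_right_if_mono[OF I(2), of "\<lambda>t. neg_index (- Q t)"] pos_mono order_less_trans[OF I(1)] by blast
  have "\<forall>\<^sub>F t in at_right t0. rank (Q t) = neg_index (Q t0) + p \<and> neg_index (Q t) = neg_index (Q t0)"
    using p sc[of "{t0<..}"] R
  proof eventually_elim
    case (elim t)
    then have "neg_index (Q t) = neg_index (Q t0)" using neg_mono[of t0 t] I by simp
    then show ?case using elim rank_eq_neg_index_add[OF sym[of t]] by simp
  qed
  then show "\<exists>r. \<forall>\<^sub>F t in at_right t0. rank (Q t) = r \<and> neg_index (Q t) = neg_index (Q t0)" by blast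
qed

lemma rank_mult_invertible_right:
  fixes A V :: "real^'n^'n"
  assumes "invertible V"
  shows "rank (A ** V) = rank A"
proof (rule antisym)
  have "A = A ** V ** matrix_inv V"
    using matrix_inv_inverse[OF assms] by (simp add: matrix_mul_assoc[symmetric])
  then show "rank A \<le> rank (A ** V)" by (metis rank_mul_le_left)
qed (rule rank_mul_le_left)

lemma neg_index_congruence:
  fixes A G :: "real^'n^'n"
  assumes sym: "transpose A = A" and G: "invertible G"
  shows "neg_index (transpose G ** A ** G) = neg_index A"
proof -
  have form: "x \<bullet> ((transpose H ** C ** H) *v x) = (H *v x) \<bullet> (C *v (H *v x))" for H C :: "real^'n^'n" and x
    using transpose_inner[of H "C *v (H *v x)" x]
    by (simp add: matrix_vector_mul_assoc[symmetric] inner_commute del: transpose_matrix_vector)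
  have le: "neg_index C \<le> neg_index (transpose H ** C ** H)"
    if C: "transpose C = C" and H: "invertible H" for C H :: "real^'n^'n"
  proof -
    obtain N where N: "subspace N" "dim N = neg_index C" "\<And>x. x \<in> N \<Longrightarrow> x \<noteq> 0 \<Longrightarrow> x \<bullet> (C *v x) < 0"
      using neg_index_decomposition[OF C] by metis
    let ?S = "(*v) (matrix_inv H) ` N"
    have "subspace ?S" by (intro linear_subspace_image N(1)) auto
    moreover have "transpose (transpose H ** C ** H) = transpose H ** C ** H"
      by (simp add: matrix_transpose_mul C matrix_mul_assoc)
    moreover have "x \<bullet> ((transpose H ** C ** H) *v x) < 0" if "x \<in> ?S" "x \<noteq> 0" for x
      using that N(3) matrix_inv_vector(1)[OF H] by (auto simp: form) (metis matrix_vector_mult_0_right)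
    ultimately have "dim ?S \<le> neg_index (transpose H ** C ** H)"
      by (intro dim_le_neg_index)
    moreover have "x = 0" if "matrix_inv H *v x = 0" for x
      using matrix_inv_vector(1)[OF H, of x] that by simp
    then have "dim ?S = dim N"
      by (intro dim_image_injective_linear N(1)) auto
    ultimately show ?thesis using N(2) by simp
  qed
  have inv: "invertible (matrix_inv G)"
    unfolding invertible_def using matrix_inv_inverse[OF G] by blast
  have "transpose (matrix_inv G) ** (transpose G ** A ** G) ** matrix_inv G
      = transpose (G ** matrix_inv G) ** A ** (G ** matrix_inv G)"
    by (simp add: matrix_transpose_mul matrix_mul_assoc)
  then have "transpose (matrix_inv G) ** (transpose G ** A ** G) ** matrix_inv G = A"
    by (simp add: matrix_inv_inverse[OF G])
  moreover have "transpose (transpose G ** A ** G) = transpose G ** A ** G"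
    by (simp add: matrix_transpose_mul sym matrix_mul_assoc)
  ultimately show ?thesis using le[OF sym G] le[OF _ inv, of "transpose G ** A ** G"] by simp
qed

text \<open>The columns of \<open>(X, V)\<close> span a Lagrangian subspace that is the graph \<open>{(Q u, u)}\<close>. For \<open>x = V w\<close> the
  derivative of \<open>x \<bullet> Q x\<close> with fixed \<open>x\<close> is \<open>V w \<bullet> X' w - X w \<bullet> V' w\<close>, so that the hypothesis
  \<open>nonneg\<close> makes \<open>Q\<close> nondecreasing.\<close>

lemma quotient_rank_jump:
  fixes X V X' V' :: "real \<Rightarrow> real^'n^'n"
  assumes I: "a < t0" "t0 < b"
    and cont: "continuous_on {a<..<b} X" "continuous_on {a<..<b} V"
    and inv: "\<And>t. a < t \<Longrightarrow> t < b \<Longrightarrow> invertible (V t)"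
    and lagr: "\<And>t x y. a < t \<Longrightarrow> t < b \<Longrightarrow> (V t *v x) \<bullet> (X t *v y) = (X t *v x) \<bullet> (V t *v y)"
    and E: "\<And>r s. finite (E \<inter> {r..s})"
    and deriv: "\<And>t. a < t \<Longrightarrow> t < b \<Longrightarrow> t \<notin> E \<Longrightarrow> (X has_vector_derivative X' t) (at t)"
      "\<And>t. a < t \<Longrightarrow> t < b \<Longrightarrow> t \<notin> E \<Longrightarrow> (V has_vector_derivative V' t) (at t)"
    and nonneg: "\<And>t w. a < t \<Longrightarrow> t < b \<Longrightarrow> t \<notin> E \<Longrightarrow>
      0 \<le> (V t *v w) \<bullet> (X' t *v w) - (X t *v w) \<bullet> (V' t *v w)"
  defines "Q \<equiv> \<lambda>t. X t ** matrix_inv (V t)"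
  shows "\<And>t. a < t \<Longrightarrow> t < b \<Longrightarrow> transpose (Q t) = Q t"
    and "\<exists>r m. (\<forall>\<^sub>F t in at_left t0. rank (X t) = r \<and> neg_index (Q t) = m) \<and>
      r + neg_index (Q t0) = rank (X t0) + m \<and> neg_index (Q t0) \<le> m"
    and "\<exists>r. \<forall>\<^sub>F t in at_right t0. rank (X t) = r \<and> neg_index (Q t) = neg_index (Q t0)"
proof -
  have QV: "Q t *v (V t *v x) = X t *v x" if "a < t" "t < b" for t x
    using matrix_inv_vector[OF inv[OF that]] by (simp add: Q_def matrix_vector_mul_assoc[symmetric])
  show sym: "transpose (Q t) = Q t" if t: "a < t" "t < b" for t
  proof (rule symmetricI)
    fix x y
    obtain p q where "x = V t *v p" "y = V t *v q"
      using matrix_inv_vector(1)[OF inv[OF t]] by metis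
    then show "x \<bullet> (Q t *v y) = (Q t *v x) \<bullet> y" using QV[OF t] lagr[OF t, of p q] by simp
  qed
  have rank: "rank (Q t) = rank (X t)" if t: "a < t" "t < b" for t
  proof -
    have "X t = Q t ** V t"
      using matrix_inv_inverse(2)[OF inv[OF t]] by (simp add: Q_def matrix_mul_assoc[symmetric])
    then show ?thesis using rank_mult_invertible_right[OF inv[OF t]] by metis
  qed
  have contQ: "continuous_on {a<..<b} Q"
    unfolding Q_def using cont inv by (intro continuous_on_matrix_mult continuous_on_matrix_inv) auto
  then have limQ: "(Q \<longlongrightarrow> Q t0) (at t0)"
    using I by (simp add: continuous_on_eq_continuous_at isCont_def)
  have mono: "x \<bullet> (Q s *v x) \<le> x \<bullet> (Q t *v x)" if st: "a < s" "s \<le> t" "t < b" for s t x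
  proof (rule nondecreasing_if_derivative_nonneg_except_finite[where E = "E \<inter> {s..t}" and f = "\<lambda>u. x \<bullet> (Q u *v x)"])
    have bl: "bounded_linear (\<lambda>A. x \<bullet> (A *v x))"
      by (rule bounded_linear_compose[OF bounded_linear_inner_right bounded_linear_matrix_vector_left])
    show "continuous_on {s..t} (\<lambda>u. x \<bullet> (Q u *v x))"
      using st by (intro bounded_linear.continuous_on[OF bl] continuous_on_subset[OF contQ]) auto
    show "\<exists>D\<ge>0. ((\<lambda>u. x \<bullet> (Q u *v x)) has_vector_derivative D) (at u)" if "u \<in> {s<..<t} - E \<inter> {s..t}" for u
    proof -
      have u: "a < u" "u < b" "u \<notin> E" using that st by auto
      define Q' where "Q' = X u ** (- (matrix_inv (V u) ** V' u ** matrix_inv (V u))) + X' u ** matrix_inv (V u)"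
      have "(Q has_vector_derivative Q') (at u)"
        unfolding Q_def Q'_def using u inv deriv
        by (intro has_vector_derivative_matrix_mult has_vector_derivative_matrix_inv)
      then have "((\<lambda>u. x \<bullet> (Q u *v x)) has_vector_derivative x \<bullet> (Q' *v x)) (at u)"
        by (rule bounded_linear.has_vector_derivative[OF bl])
      moreover have "0 \<le> x \<bullet> (Q' *v x)"
      proof -
        define w where "w = matrix_inv (V u) *v x"
        have x: "V u *v w = x" unfolding w_def by (rule matrix_inv_vector(1)[OF inv[OF u(1,2)]])
        have "Q' *v x = X' u *v w - Q u *v (V' u *v w)"
          by (simp add: Q'_def Q_def w_def matrix_vector_mult_add_rdistrib matrix_vector_mul_assoc[symmetric]
              uminus_matrix_vector_mult vec.neg)
        then have "x \<bullet> (Q' *v x) = (V u *v w) \<bullet> (X' u *v w) - (X u *v w) \<bullet> (V' u *v w)"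
          using symmetric_inner[OF sym[OF u(1,2)], of x "V' u *v w"] QV[OF u(1,2), of w] x
          by (simp add: inner_diff_right)
        then show ?thesis using nonneg[OF u] by simp
      qed
      ultimately show ?thesis by blast
    qed
  qed (use st E in auto)
  have near: "\<forall>\<^sub>F t in at t0 within S. a < t \<and> t < b" for S
    using I by (intro eventually_at_topological[THEN iffD2] exI[of _ "{a<..<b}"]) auto
  obtain r m where rm: "\<forall>\<^sub>F t in at_left t0. rank (Q t) = r \<and> neg_index (Q t) = m"
    "r + neg_index (Q t0) = rank (Q t0) + m" "neg_index (Q t0) \<le> m"
    using nondecreasing_symmetric_rank_jump(1)[OF I limQ sym mono] by blast
  have "\<forall>\<^sub>F t in at_left t0. rank (X t) = r \<and> neg_index (Q t) = m"
    using rm(1) near[of "{..<t0}"] by eventually_elim (use rank in auto)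
  then show "\<exists>r m. (\<forall>\<^sub>F t in at_left t0. rank (X t) = r \<and> neg_index (Q t) = m) \<and>
      r + neg_index (Q t0) = rank (X t0) + m \<and> neg_index (Q t0) \<le> m"
    using rm(2,3) unfolding rank[OF I] by blast
  obtain r where "\<forall>\<^sub>F t in at_right t0. rank (Q t) = r \<and> neg_index (Q t) = neg_index (Q t0)"
    using nondecreasing_symmetric_rank_jump(2)[OF I limQ sym mono] by blast
  then have "\<forall>\<^sub>F t in at_right t0. rank (X t) = r \<and> neg_index (Q t) = neg_index (Q t0)"
    using near[of "{t0<..}"] by eventually_elim (use rank in auto)
  then show "\<exists>r. \<forall>\<^sub>F t in at_right t0. rank (X t) = r \<and> neg_index (Q t) = neg_index (Q t0)" by blast
qed

section \<open>Block structure and the symplectic form\<close>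

definition upper_left :: "real^('n::finite + 'n)^('n + 'n) \<Rightarrow> real^'n^'n" where
  "upper_left W = (\<chi> i j. W $ Inl i $ Inl j)"

definition lower_left :: "real^('n::finite + 'n)^('n + 'n) \<Rightarrow> real^'n^'n" where
  "lower_left W = (\<chi> i j. W $ Inr i $ Inl j)"

definition lower_right :: "real^('n::finite + 'n)^('n + 'n) \<Rightarrow> real^'n^'n" where
  "lower_right W = (\<chi> i j. W $ Inr i $ Inr j)"

definition join :: "real^'n \<Rightarrow> real^'n \<Rightarrow> real^('n::finite + 'n)" where
  "join x u = (\<chi> i. case i of Inl p \<Rightarrow> x $ p | Inr p \<Rightarrow> u $ p)"

lemma sum_UNIV_sum_type:
  "(\<Sum>i\<in>(UNIV :: ('a::finite + 'b::finite) set). f i) = (\<Sum>i\<in>UNIV. f (Inl i)) + (\<Sum>i\<in>UNIV. f (Inr i))"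
  using sum.Plus[of "UNIV :: 'a set" "UNIV :: 'b set" f] by simp

lemma join_cases: obtains x u where "z = join x u"
proof
  show "z = join (\<chi> i. z $ Inl i) (\<chi> i. z $ Inr i)"
    by (simp add: join_def vec_eq_iff split: sum.split)
qed

lemma join_eq_iff [simp]: "join x u = join y v \<longleftrightarrow> x = y \<and> u = v"
  by (auto simp: join_def vec_eq_iff split: sum.split)

lemma join_diff: "join x u - join y v = join (x - y) (u - v)"
  and join_0: "join 0 0 = 0"
  by (auto simp: join_def vec_eq_iff split: sum.split)

lemma inner_join: "join x u \<bullet> join y v = x \<bullet> y + u \<bullet> v"
  by (simp add: inner_vec_def join_def sum_UNIV_sum_type)

lemma mult_join: "W *v join x u =
  join (upper_left W *v x + upper_right W *v u) (lower_left W *v x + lower_right W *v u)"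
  by (simp add: vec_eq_iff join_def matrix_vector_mult_def sum_UNIV_sum_type upper_left_def
      upper_right_def lower_left_def lower_right_def split: sum.split)

lemma upper_right_mult: "upper_right (W ** P) = upper_left W ** upper_right P + upper_right W ** lower_right P"
  and lower_right_mult: "lower_right (W ** P) = lower_left W ** upper_right P + lower_right W ** lower_right P"
  by (simp_all add: upper_right_def upper_left_def lower_right_def lower_left_def matrix_matrix_mult_def
      vec_eq_iff sum_UNIV_sum_type)

lemma bounded_linear_upper_right: "bounded_linear upper_right"
  and bounded_linear_lower_right: "bounded_linear lower_right"
  unfolding linear_conv_bounded_linear[symmetric]
  by (auto intro!: linearI simp: upper_right_def lower_right_def vec_eq_iff)

text \<open>In the coordinates of \<open>join\<close> this is \<open>\<omega>((x, u), (y, v)) = u \<bullet> y - x \<bullet> v\<close>. The sign is chosen such that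
  \<open>\<Psi>(S) \<ge> 0\<close> becomes \<open>\<omega>(S x, S' x) \<ge> 0\<close>.\<close>

definition omega :: "real^('n::finite + 'n) \<Rightarrow> real^('n + 'n) \<Rightarrow> real" where
  "omega y z = y \<bullet> (transpose JJ *v z)"

lemma transpose_JJ_join: "transpose JJ *v join x u = join (- u) x"
proof -
  have "(transpose JJ *v join x u) $ Inl i = - u $ i" "(transpose JJ *v join x u) $ Inr i = x $ i" for i
    unfolding matrix_vector_mult_def transpose_def JJ_def block_matrix_def join_def mat_def
    by (simp_all add: sum_UNIV_sum_type if_distrib[where f = "\<lambda>c. c * _"] if_distrib[where f = uminus]
        sum.delta' cong: if_cong)
  then show ?thesis
    by (simp add: vec_eq_iff join_def split: sum.split del: transpose_matrix_vector)
qed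

lemma omega_join [simp]: "omega (join x u) (join y v) = u \<bullet> y - x \<bullet> v"
  by (simp add: omega_def transpose_JJ_join inner_join del: transpose_matrix_vector)

lemma omega_add_right: "omega z (x + y) = omega z x + omega z y"
  and omega_diff_left: "omega (x - y) z = omega x z - omega y z"
  by (simp_all add: omega_def inner_add_left inner_diff_left inner_add_right matrix_vector_right_distrib
      del: transpose_matrix_vector)

lemma symplectic_iff_omega: "symplectic W \<longleftrightarrow> (\<forall>y z. omega (W *v y) (W *v z) = omega y z)"
proof -
  have om: "omega (W *v y) (W *v z) = y \<bullet> ((transpose W ** transpose JJ ** W) *v z)" for y z
    using transpose_inner[of W "transpose JJ *v (W *v z)" y]
    by (simp add: omega_def matrix_vector_mul_assoc[symmetric] inner_commute del: transpose_matrix_vector)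
  have "symplectic W \<longleftrightarrow> transpose (transpose W ** JJ ** W) = transpose JJ"
    unfolding symplectic_def by simp
  also have "\<dots> \<longleftrightarrow> transpose W ** transpose JJ ** W = transpose JJ"
    by (simp add: matrix_transpose_mul matrix_mul_assoc)
  also have "\<dots> \<longleftrightarrow> (\<forall>z y. y \<bullet> ((transpose W ** transpose JJ ** W) *v z) = y \<bullet> (transpose JJ *v z))"
    by (simp only: matrix_eq vector_eq_ldot)
  also have "\<dots> \<longleftrightarrow> (\<forall>y z. omega (W *v y) (W *v z) = omega y z)"
    unfolding om unfolding omega_def by blast
  finally show ?thesis .
qed

lemma symplectic_omega: "symplectic W \<Longrightarrow> omega (W *v y) (W *v z) = omega y z"
  by (simp add: symplectic_iff_omega)

lemma symplectic_mult: "symplectic W \<Longrightarrow> symplectic P \<Longrightarrow> symplectic (W ** P)"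
  by (simp add: symplectic_iff_omega matrix_vector_mul_assoc[symmetric])

lemma symplectic_invertible:
  assumes "symplectic W"
  shows "invertible W"
proof -
  have "x = 0" if "W *v x = 0" for x
  proof -
    have "omega y x = 0" for y
      using symplectic_omega[OF assms, of y x] that by (simp add: omega_def)
    moreover obtain p q where x: "x = join p q" by (rule join_cases)
    \<comment> \<open>These two test vectors pair with \<open>(p, q)\<close> to \<open>- (p \<bullet> p + q \<bullet> q)\<close> and \<open>p \<bullet> p + q \<bullet> q\<close>.\<close>
    ultimately have "omega (join q (- p)) x = 0" "omega (join (- q) p) x = 0" by auto
    then have "p \<bullet> p + q \<bullet> q = 0" by (simp add: x)
    then have "p = 0 \<and> q = 0"
      by (metis add_nonneg_eq_0_iff inner_eq_zero_iff inner_ge_zero)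
    then show ?thesis by (simp add: x join_0)
  qed
  then show ?thesis
    by (metis invertible_left_inverse matrix_left_invertible_ker)
qed

lemma symplectic_inverse:
  assumes "symplectic W"
  shows "symplectic (matrix_inv W)"
  unfolding symplectic_iff_omega
  using symplectic_omega[OF assms] matrix_inv_vector(1)[OF symplectic_invertible[OF assms]] by metis

lemma symplectic_mat_1: "symplectic (mat 1)"
  by (simp add: symplectic_iff_omega)

text \<open>If \<open>D v = \<tau> B v\<close> and \<open>D w = \<sigma> B w\<close> with \<open>\<tau> \<noteq> \<sigma>\<close>, symmetry of \<open>B\<^sup>T D\<close> makes \<open>B v\<close> and \<open>B w\<close>
  orthogonal, as for eigenvectors of a symmetric matrix. So the exceptional \<open>\<tau>\<close> give rise to linearly
  independent vectors.\<close>

lemma finite_non_transversal_shears: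
  fixes W :: "real^('n::finite + 'n)^('n + 'n)"
  assumes W: "symplectic W"
  shows "finite {\<tau>. \<not> invertible (lower_right W - \<tau> *\<^sub>R upper_right W)}" (is "finite ?T")
proof -
  let ?B = "upper_right W" and ?D = "lower_right W"
  have "\<exists>v. v \<noteq> 0 \<and> ?D *v v = \<tau> *\<^sub>R (?B *v v)" if "\<tau> \<in> ?T" for \<tau>
  proof -
    have "\<not> (\<forall>v. (?D - \<tau> *\<^sub>R ?B) *v v = 0 \<longrightarrow> v = 0)"
      using that by (metis (mono_tags, lifting) invertible_left_inverse matrix_left_invertible_ker mem_Collect_eq)
    then show ?thesis by (auto simp: matrix_vector_mult_diff_rdistrib scaleR_matrix_vector_assoc[symmetric])
  qed
  then obtain v where v: "\<And>\<tau>. \<tau> \<in> ?T \<Longrightarrow> v \<tau> \<noteq> 0 \<and> ?D *v v \<tau> = \<tau> *\<^sub>R (?B *v v \<tau>)" by metis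
  have nz: "?B *v v \<tau> \<noteq> 0" if "\<tau> \<in> ?T" for \<tau>
  proof
    assume "?B *v v \<tau> = 0"
    then have "W *v join 0 (v \<tau>) = 0" using v[OF that] by (simp add: mult_join join_0)
    then have "join 0 (v \<tau>) = 0"
      using matrix_inv_vector(2)[OF symplectic_invertible[OF W]] by (metis matrix_vector_mult_0_right)
    then show False using v[OF that] by (metis join_0 join_eq_iff)
  qed
  have orth: "(?B *v v \<sigma>) \<bullet> (?B *v v \<tau>) = 0" if "\<sigma> \<in> ?T" "\<tau> \<in> ?T" "\<sigma> \<noteq> \<tau>" for \<sigma> \<tau>
  proof -
    have "(?D *v v \<sigma>) \<bullet> (?B *v v \<tau>) = (?B *v v \<sigma>) \<bullet> (?D *v v \<tau>)"
      using symplectic_omega[OF W, of "join 0 (v \<sigma>)" "join 0 (v \<tau>)"] by (simp add: mult_join)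
    then have "(\<sigma> - \<tau>) * ((?B *v v \<sigma>) \<bullet> (?B *v v \<tau>)) = 0"
      using v[OF that(1)] v[OF that(2)] by (simp add: left_diff_distrib)
    then show ?thesis using that(3) by simp
  qed
  have "inj_on (\<lambda>\<tau>. ?B *v v \<tau>) ?T"
    using orth nz by (intro inj_onI) (metis inner_eq_zero_iff)
  moreover have "independent ((\<lambda>\<tau>. ?B *v v \<tau>) ` ?T)"
  proof (rule pairwise_orthogonal_independent)
    show "pairwise orthogonal ((\<lambda>\<tau>. ?B *v v \<tau>) ` ?T)"
      unfolding pairwise_def orthogonal_def using orth by blast
    show "0 \<notin> (\<lambda>\<tau>. ?B *v v \<tau>) ` ?T" using nz by fastforce
  qed
  ultimately show ?thesis using independent_bound finite_imageD by blast
qed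

section \<open>Monotone symplectic paths\<close>

text \<open>The condition \<open>\<Psi> \<ge> 0\<close> away from a locally finite set, with the derivative of the path tested on the
  vectors \<open>P t *v x\<close> instead of being multiplied by the inverse. In this form it passes directly to
  products.\<close>

definition monotone_symplectic_path :: "(real \<Rightarrow> real^('n::finite + 'n)^('n + 'n)) \<Rightarrow> bool" where
  "monotone_symplectic_path P \<longleftrightarrow> (\<forall>t. symplectic (P t)) \<and> continuous_on UNIV P \<and>
     (\<exists>E P'. (\<forall>r s. finite (E \<inter> {r..s})) \<and>
        (\<forall>t. t \<notin> E \<longrightarrow> (P has_vector_derivative P' t) (at t) \<and> (\<forall>x. 0 \<le> omega (P t *v x) (P' t *v x))))"

lemma monotone_symplectic_path_const:
  assumes "symplectic C"
  shows "monotone_symplectic_path (\<lambda>t. C)"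
  unfolding monotone_symplectic_path_def using assms
  by (intro conjI exI[of _ "{}"] exI[of _ "\<lambda>_. 0"]) (auto simp: omega_def)

lemma monotone_symplectic_path_mult:
  assumes "monotone_symplectic_path W" "monotone_symplectic_path P"
  shows "monotone_symplectic_path (\<lambda>t. W t ** P t)"
proof -
  obtain E W' where W: "\<And>t. symplectic (W t)" "continuous_on UNIV W" "\<And>r s. finite (E \<inter> {r..s})"
    "\<And>t. t \<notin> E \<Longrightarrow> (W has_vector_derivative W' t) (at t)"
    "\<And>t x. t \<notin> E \<Longrightarrow> 0 \<le> omega (W t *v x) (W' t *v x)"
    using assms(1) unfolding monotone_symplectic_path_def by blast
  obtain F P' where P: "\<And>t. symplectic (P t)" "continuous_on UNIV P" "\<And>r s. finite (F \<inter> {r..s})"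
    "\<And>t. t \<notin> F \<Longrightarrow> (P has_vector_derivative P' t) (at t)"
    "\<And>t x. t \<notin> F \<Longrightarrow> 0 \<le> omega (P t *v x) (P' t *v x)"
    using assms(2) unfolding monotone_symplectic_path_def by blast
  have "0 \<le> omega ((W t ** P t) *v x) ((W t ** P' t + W' t ** P t) *v x)" if "t \<notin> E \<union> F" for t x
    using W(5)[of t "P t *v x"] P(5)[of t x] that
    by (simp add: matrix_vector_mul_assoc[symmetric] matrix_vector_mult_add_rdistrib omega_add_right
        symplectic_omega[OF W(1)])
  then show ?thesis
    unfolding monotone_symplectic_path_def
    using W P
    by (intro conjI exI[of _ "E \<union> F"] exI[of _ "\<lambda>t. W t ** P' t + W' t ** P t"])
       (auto simp: Int_Un_distrib2 intro!: symplectic_mult continuous_on_matrix_mult has_vector_derivative_matrix_mult)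
qed

lemma monotone_symplectic_pathE:
  assumes "monotone_symplectic_path P"
  obtains E P' where "\<And>t. symplectic (P t)" "continuous_on UNIV P" "\<And>r s. finite (E \<inter> {r..s})"
    "\<And>t. t \<notin> E \<Longrightarrow> (P has_vector_derivative P' t) (at t)"
    "\<And>t x. t \<notin> E \<Longrightarrow> 0 \<le> omega (P t *v x) (P' t *v x)"
  using assms unfolding monotone_symplectic_path_def by blast

lemma symplectic_lagrangian:
  assumes "symplectic P"
  shows "(lower_right P *v x) \<bullet> (upper_right P *v y) = (upper_right P *v x) \<bullet> (lower_right P *v y)"
  using symplectic_omega[OF assms, of "join 0 x" "join 0 y"] by (simp add: mult_join)

lemma continuous_on_blocks:
  assumes "continuous_on S P"
  shows "continuous_on S (\<lambda>t. upper_right (P t))" "continuous_on S (\<lambda>t. lower_right (P t))"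
  using assms bounded_linear.continuous_on bounded_linear_upper_right bounded_linear_lower_right by blast+

lemma invertible_near:
  fixes V :: "real \<Rightarrow> real^'n^'n"
  assumes "continuous_on UNIV V" "invertible (V t0)"
  obtains d where "d > 0" "\<And>t. \<bar>t - t0\<bar> < d \<Longrightarrow> invertible (V t)"
proof -
  have "(V \<longlongrightarrow> V t0) (at t0)" using assms(1) by (simp add: continuous_on_def)
  from eventually_invertible[OF this assms(2)]
  obtain d where "d > 0" "\<And>t. t \<noteq> t0 \<Longrightarrow> dist t t0 < d \<Longrightarrow> invertible (V t)"
    unfolding eventually_at by auto
  then show ?thesis using that[of d] assms(2) by (metis dist_real_def)
qed

lemma path_quotient_rank_jump:
  assumes P: "\<And>t. symplectic (P t)" "continuous_on UNIV P" "\<And>r s. finite (E \<inter> {r..s})"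
    "\<And>t. t \<notin> E \<Longrightarrow> (P has_vector_derivative P' t) (at t)"
    "\<And>t x. t \<notin> E \<Longrightarrow> 0 \<le> omega (P t *v x) (P' t *v x)"
    and I: "a < t0" "t0 < b" and inv: "\<And>t. a < t \<Longrightarrow> t < b \<Longrightarrow> invertible (lower_right (P t))"
  defines "Q \<equiv> \<lambda>t. upper_right (P t) ** matrix_inv (lower_right (P t))"
  shows "\<And>t. a < t \<Longrightarrow> t < b \<Longrightarrow> transpose (Q t) = Q t"
    and "\<exists>r m. (\<forall>\<^sub>F t in at_left t0. rank (upper_right (P t)) = r \<and> neg_index (Q t) = m) \<and>
      r + neg_index (Q t0) = rank (upper_right (P t0)) + m \<and> neg_index (Q t0) \<le> m"
    and "\<exists>r. \<forall>\<^sub>F t in at_right t0. rank (upper_right (P t)) = r \<and> neg_index (Q t) = neg_index (Q t0)"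
proof -
  have lagr: "(lower_right (P t) *v x) \<bullet> (upper_right (P t) *v y) = (upper_right (P t) *v x) \<bullet> (lower_right (P t) *v y)" for t x y
    by (rule symplectic_lagrangian[OF P(1)])
  have d: "((\<lambda>t. upper_right (P t)) has_vector_derivative upper_right (P' t)) (at t)"
    "((\<lambda>t. lower_right (P t)) has_vector_derivative lower_right (P' t)) (at t)" if "t \<notin> E" for t
    using bounded_linear.has_vector_derivative[OF bounded_linear_upper_right P(4)[OF that]]
      bounded_linear.has_vector_derivative[OF bounded_linear_lower_right P(4)[OF that]] by auto
  have nonneg: "0 \<le> (lower_right (P t) *v w) \<bullet> (upper_right (P' t) *v w) - (upper_right (P t) *v w) \<bullet> (lower_right (P' t) *v w)"
    if "t \<notin> E" for t w
    using P(5)[OF that, of "join 0 w"] by (simp add: mult_join)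
  have c: "continuous_on {a<..<b} (\<lambda>t. upper_right (P t))" "continuous_on {a<..<b} (\<lambda>t. lower_right (P t))"
    using continuous_on_blocks[OF P(2)] continuous_on_subset by blast+
  note * = quotient_rank_jump[where X = "\<lambda>t. upper_right (P t)" and V = "\<lambda>t. lower_right (P t)"
      and X' = "\<lambda>t. upper_right (P' t)" and V' = "\<lambda>t. lower_right (P' t)" and E = E,
      OF I c inv lagr P(3) d nonneg]
  show "\<And>t. a < t \<Longrightarrow> t < b \<Longrightarrow> transpose (Q t) = Q t" unfolding Q_def by (rule *(1))
  show "\<exists>r m. (\<forall>\<^sub>F t in at_left t0. rank (upper_right (P t)) = r \<and> neg_index (Q t) = m) \<and>
      r + neg_index (Q t0) = rank (upper_right (P t0)) + m \<and> neg_index (Q t0) \<le> m"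
    unfolding Q_def by (rule *(2))
  show "\<exists>r. \<forall>\<^sub>F t in at_right t0. rank (upper_right (P t)) = r \<and> neg_index (Q t) = neg_index (Q t0)"
    unfolding Q_def by (rule *(3))
qed

section \<open>The jump of the multiplicity in one step\<close>

definition step_multiplicity :: "real^'n^'n \<Rightarrow> real^'n^'n \<Rightarrow> real^'n^'n \<Rightarrow> nat" where
  "step_multiplicity X X1 B =
    (let M = (mat 1 - X1 ** pinv X1) ** B; T = mat 1 - pinv M ** M
     in rank M + neg_index (T ** X ** pinv X1 ** B ** T))"

text \<open>The triple index needs the negative index of \<open>Q1 - Q2\<close>. A difference of nondecreasing matrices need not
  be monotone, but the congruent matrix \<open>Q3 = D\<^sup>T (Q1 - Q2) D\<close> is: it equals \<open>X V\<^sup>-\<^sup>1\<close> for \<open>V = D\<^sup>-\<^sup>1 U\<^sub>1\<close>, and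
  \<open>(X, V)\<close> is the Lagrangian path of \<open>P\<close> seen from the moving complement \<open>W\<^sup>-\<^sup>1 {u = 0}\<close>. Both motions
  contribute with the same sign.\<close>

lemma step_multiplicity_jump_in_chart:
  fixes W P :: "real \<Rightarrow> real^('n::finite + 'n)^('n + 'n)"
  assumes W: "monotone_symplectic_path W" and P: "monotone_symplectic_path P"
    and inv: "invertible (lower_right (W t0))" "invertible (lower_right (W t0 ** P t0))"
  defines "f \<equiv> \<lambda>t. step_multiplicity (upper_right (P t)) (upper_right (W t ** P t)) (upper_right (W t))"
  shows "\<exists>m r r1 r2. (\<forall>\<^sub>F t in at_left t0. f t = m \<and> rank (upper_right (P t)) = r \<and>
        rank (upper_right (W t ** P t)) = r1 \<and> rank (upper_right (W t)) = r2) \<and>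
      int (f t0) - int m = (int r1 - int (rank (upper_right (W t0 ** P t0))))
        - (int r - int (rank (upper_right (P t0)))) - (int r2 - int (rank (upper_right (W t0))))"
    and "\<forall>\<^sub>F t in at_right t0. f t = f t0"
proof -
  obtain E W' where W: "\<And>t. symplectic (W t)" "continuous_on UNIV W" "\<And>r s. finite (E \<inter> {r..s})"
    "\<And>t. t \<notin> E \<Longrightarrow> (W has_vector_derivative W' t) (at t)"
    "\<And>t x. t \<notin> E \<Longrightarrow> 0 \<le> omega (W t *v x) (W' t *v x)"
    using W by (rule monotone_symplectic_pathE) blast
  obtain F P' where P: "\<And>t. symplectic (P t)" "continuous_on UNIV P" "\<And>r s. finite (F \<inter> {r..s})"
    "\<And>t. t \<notin> F \<Longrightarrow> (P has_vector_derivative P' t) (at t)"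
    "\<And>t x. t \<notin> F \<Longrightarrow> 0 \<le> omega (P t *v x) (P' t *v x)"
    using P by (rule monotone_symplectic_pathE) blast
  define Y where "Y t = W t ** P t" for t
  define Y' where "Y' t = W t ** P' t + W' t ** P t" for t
  have Y'x: "Y' t *v x = W t *v (P' t *v x) + W' t *v (P t *v x)" for t x
    by (simp add: Y'_def matrix_vector_mult_add_rdistrib matrix_vector_mul_assoc)
  have Yx: "Y t *v x = W t *v (P t *v x)" for t x by (simp add: Y_def matrix_vector_mul_assoc)
  have Y: "\<And>t. symplectic (Y t)" "continuous_on UNIV Y" "\<And>r s. finite ((E \<union> F) \<inter> {r..s})"
    "\<And>t. t \<notin> E \<union> F \<Longrightarrow> (Y has_vector_derivative Y' t) (at t)"
    "\<And>t x. t \<notin> E \<union> F \<Longrightarrow> 0 \<le> omega (Y t *v x) (Y' t *v x)"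
    using W P unfolding Y'x Yx
    by (auto simp: Y_def[abs_def] Y'_def Int_Un_distrib2 omega_add_right symplectic_omega
        intro!: symplectic_mult continuous_on_matrix_mult has_vector_derivative_matrix_mult add_nonneg_nonneg)
  define X where "X t = upper_right (P t)" for t
  define B where "B t = upper_right (W t)" for t
  define D where "D t = lower_right (W t)" for t
  define X1 where "X1 t = upper_right (Y t)" for t
  define U1 where "U1 t = lower_right (Y t)" for t
  define Q1 where "Q1 t = X1 t ** matrix_inv (U1 t)" for t
  define Q2 where "Q2 t = B t ** matrix_inv (D t)" for t
  define R where "R t = Q1 t - Q2 t" for t
  define V where "V t = matrix_inv (D t) ** U1 t" for t
  have contD: "continuous_on UNIV D" and contU1: "continuous_on UNIV U1" and contX: "continuous_on UNIV X"
    unfolding D_def U1_def X_def using continuous_on_blocks W(2) Y(2) P(2) by blast+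
  obtain d1 where d1: "d1 > 0" "\<And>t. \<bar>t - t0\<bar> < d1 \<Longrightarrow> invertible (D t)"
    using invertible_near[OF contD] inv(1) unfolding D_def by metis
  obtain d2 where d2: "d2 > 0" "\<And>t. \<bar>t - t0\<bar> < d2 \<Longrightarrow> invertible (U1 t)"
    using invertible_near[OF contU1] inv(2) unfolding U1_def Y_def by metis
  define a b where "a = t0 - min d1 d2" and "b = t0 + min d1 d2"
  have I: "a < t0" "t0 < b" using d1(1) d2(1) by (auto simp: a_def b_def)
  have invD: "invertible (D t)" and invU1: "invertible (U1 t)" if "a < t" "t < b" for t
  proof -
    have "\<bar>t - t0\<bar> < d1" "\<bar>t - t0\<bar> < d2" using that by (auto simp: a_def b_def abs_less_iff)
    then show "invertible (D t)" "invertible (U1 t)" using d1(2) d2(2) by blast+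
  qed
  note rule1 = path_quotient_rank_jump[where P = Y and E = "E \<union> F" and P' = Y' and a = a and b = b and ?t0.0 = t0,
      folded X1_def U1_def, folded Q1_def]
  note rule2 = path_quotient_rank_jump[where P = W and E = E and P' = W' and a = a and b = b and ?t0.0 = t0,
      folded B_def D_def, folded Q2_def]
  have jump1: "\<And>t. a < t \<Longrightarrow> t < b \<Longrightarrow> transpose (Q1 t) = Q1 t"
    "\<exists>r m. (\<forall>\<^sub>F t in at_left t0. rank (X1 t) = r \<and> neg_index (Q1 t) = m) \<and>
      r + neg_index (Q1 t0) = rank (X1 t0) + m \<and> neg_index (Q1 t0) \<le> m"
    "\<exists>r. \<forall>\<^sub>F t in at_right t0. rank (X1 t) = r \<and> neg_index (Q1 t) = neg_index (Q1 t0)"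
    by - (rule rule1; (assumption | (rule Y I invU1; assumption)))+
  have jump2: "\<And>t. a < t \<Longrightarrow> t < b \<Longrightarrow> transpose (Q2 t) = Q2 t"
    "\<exists>r m. (\<forall>\<^sub>F t in at_left t0. rank (B t) = r \<and> neg_index (Q2 t) = m) \<and>
      r + neg_index (Q2 t0) = rank (B t0) + m \<and> neg_index (Q2 t0) \<le> m"
    "\<exists>r. \<forall>\<^sub>F t in at_right t0. rank (B t) = r \<and> neg_index (Q2 t) = neg_index (Q2 t0)"
    by - (rule rule2; (assumption | (rule W I invD; assumption)))+
  have R_sym: "transpose (R t) = R t" if "a < t" "t < b" for t
    using jump1(1)[OF that] jump2(1)[OF that] by (simp add: R_def transpose_def vec_eq_iff)
  have X1_eq: "X1 t = Q1 t ** U1 t" and B_eq: "B t = Q2 t ** D t" and DV: "D t ** V t = U1 t"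
    and invV: "invertible (V t)" if t: "a < t" "t < b" for t
  proof -
    show "X1 t = Q1 t ** U1 t" "B t = Q2 t ** D t"
      using matrix_inv_inverse(2)[OF invU1[OF t]] matrix_inv_inverse(2)[OF invD[OF t]]
      by (simp_all add: Q1_def Q2_def matrix_mul_assoc[symmetric])
    show "D t ** V t = U1 t"
      using matrix_inv_inverse(1)[OF invD[OF t]] by (simp add: V_def matrix_mul_assoc)
    have "invertible (matrix_inv (D t))"
      unfolding invertible_def using matrix_inv_inverse[OF invD[OF t]] by blast
    then show "invertible (V t)" unfolding V_def using invU1[OF t] by (rule invertible_mult)
  qed
  have X1_diff: "X1 t *v w - B t *v (V t *v w) = R t *v (U1 t *v w)" if t: "a < t" "t < b" for t w
    by (simp add: X1_eq[OF t] B_eq[OF t] DV[OF t, symmetric] R_def matrix_vector_mul_assoc[symmetric]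
        matrix_vector_mult_diff_rdistrib)
  have X_eq: "X t = transpose (D t) ** R t ** U1 t" if t: "a < t" "t < b" for t
  proof -
    have "u \<bullet> (X t *v w) = u \<bullet> ((transpose (D t) ** R t ** U1 t) *v w)" for u w
    proof -
      have "u \<bullet> (X t *v w) = (D t *v u) \<bullet> (X1 t *v w) - (B t *v u) \<bullet> (U1 t *v w)"
      proof -
        have "W t *v join 0 u = join (B t *v u) (D t *v u)" "Y t *v join 0 w = join (X1 t *v w) (U1 t *v w)"
          by (simp_all add: mult_join B_def D_def X1_def U1_def)
        moreover have "omega (W t *v join 0 u) (Y t *v join 0 w) = omega (join 0 u) (P t *v join 0 w)"
          unfolding Yx by (rule symplectic_omega[OF W(1)])
        moreover have "omega (join 0 u) (P t *v join 0 w) = u \<bullet> (X t *v w)"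
          by (simp add: mult_join X_def)
        ultimately show ?thesis by simp
      qed
      also have "\<dots> = (D t *v u) \<bullet> (X1 t *v w) - (D t *v u) \<bullet> (Q2 t *v (U1 t *v w))"
        using symmetric_inner[OF jump2(1)[OF t], of "D t *v u" "U1 t *v w"]
        by (simp add: B_eq[OF t] matrix_vector_mul_assoc)
      also have "\<dots> = (D t *v u) \<bullet> (R t *v (U1 t *v w))"
        by (simp add: X1_eq[OF t] R_def matrix_vector_mult_diff_rdistrib inner_diff_right
            matrix_vector_mul_assoc[symmetric])
      also have "\<dots> = u \<bullet> (transpose (D t) *v (R t *v (U1 t *v w)))"
        using transpose_inner[of "D t" "R t *v (U1 t *v w)" u] by (metis inner_commute)
      finally show ?thesis by (simp add: matrix_vector_mul_assoc matrix_mul_assoc del: transpose_matrix_vector)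
    qed
    then have "X t *v w = (transpose (D t) ** R t ** U1 t) *v w" for w
      using vector_eq_ldot[of "X t *v w" "(transpose (D t) ** R t ** U1 t) *v w"] by blast
    then show ?thesis unfolding matrix_eq by blast
  qed
  have Xw: "z \<bullet> (X t *v w) = (D t *v z) \<bullet> (R t *v (U1 t *v w))" if t: "a < t" "t < b" for t w z
    using transpose_inner[of "D t" "R t *v (U1 t *v w)" z]
    by (simp add: X_eq[OF t] matrix_vector_mul_assoc[symmetric] inner_commute del: transpose_matrix_vector)
  have DVx: "D t *v (V t *v w) = U1 t *v w" if t: "a < t" "t < b" for t w
    using DV[OF t] by (simp add: matrix_vector_mul_assoc)
  define V' where "V' t = matrix_inv (D t) ** lower_right (Y' t)
     + - (matrix_inv (D t) ** lower_right (W' t) ** matrix_inv (D t)) ** U1 t" for t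
  have lagr: "(V t *v x) \<bullet> (X t *v y) = (X t *v x) \<bullet> (V t *v y)" if t: "a < t" "t < b" for t x y
    using Xw[OF t, of "V t *v x" y] Xw[OF t, of "V t *v y" x] symmetric_inner[OF R_sym[OF t], of "U1 t *v x" "U1 t *v y"]
    by (simp add: DVx[OF t] inner_commute)
  have dX: "(X has_vector_derivative upper_right (P' t)) (at t)" if "t \<notin> E \<union> F" for t
    unfolding X_def using bounded_linear.has_vector_derivative[OF bounded_linear_upper_right P(4)] that by blast
  have dV: "(V has_vector_derivative V' t) (at t)" if t: "a < t" "t < b" "t \<notin> E \<union> F" for t
  proof -
    have "(D has_vector_derivative lower_right (W' t)) (at t)" "(U1 has_vector_derivative lower_right (Y' t)) (at t)"
      unfolding D_def U1_def
      using bounded_linear.has_vector_derivative[OF bounded_linear_lower_right] W(4) Y(4) t(3) by blast+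
    then show ?thesis unfolding V_def V'_def
      by (intro has_vector_derivative_matrix_mult has_vector_derivative_matrix_inv invD t)
  qed
  have nonneg: "0 \<le> (V t *v w) \<bullet> (upper_right (P' t) *v w) - (X t *v w) \<bullet> (V' t *v w)"
    if t: "a < t" "t < b" "t \<notin> E \<union> F" for t w
  proof -
    \<comment> \<open>The expression equals \<open>\<omega>(W \<zeta>, W' \<zeta>) + \<omega>(\<eta>, \<eta>')\<close> for \<open>\<zeta> = \<eta> - (0, v)\<close>; the vector \<open>\<zeta>\<close> lies in the
      moving complement, as \<open>W \<zeta> = (z, 0)\<close>.\<close>
    define v where "v = V t *v w"
    define \<eta> where "\<eta> = P t *v join 0 w"
    define \<eta>' where "\<eta>' = P' t *v join 0 w"
    define z where "z = R t *v (U1 t *v w)"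
    obtain p q where pq: "W' t *v (\<eta> - join 0 v) = join p q" by (rule join_cases)
    have DV': "D t *v (V' t *v w) = lower_right (Y' t) *v w - lower_right (W' t) *v v"
      using matrix_inv_vector[OF invD[OF t(1,2)]]
      by (simp add: V'_def v_def V_def matrix_vector_mult_add_rdistrib matrix_vector_mul_assoc[symmetric]
          uminus_matrix_vector_mult matrix_vector_mult_diff_distrib)
    have Wz: "W t *v (\<eta> - join 0 v) = join z 0"
    proof -
      have "W t *v (\<eta> - join 0 v) = Y t *v join 0 w - W t *v join 0 v"
        by (simp add: Yx \<eta>_def matrix_vector_mult_diff_distrib)
      also have "\<dots> = join (X1 t *v w - B t *v v) (U1 t *v w - D t *v v)"
        by (simp add: mult_join join_diff X1_def B_def U1_def D_def)
      finally show ?thesis using X1_diff[OF t(1,2), of w] DVx[OF t(1,2), of w] by (simp add: z_def v_def)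
    qed
    have "(X t *v w) \<bullet> (V' t *v w) = z \<bullet> (D t *v (V' t *v w))"
      using Xw[OF t(1,2), of "V' t *v w" w] by (simp add: z_def inner_commute)
    also have "\<dots> = - omega (join z 0) (Y' t *v join 0 w - W' t *v join 0 v)"
      by (simp add: DV' mult_join join_diff)
    also have "Y' t *v join 0 w - W' t *v join 0 v = W' t *v (\<eta> - join 0 v) + W t *v \<eta>'"
      by (simp add: Y'x \<eta>_def \<eta>'_def matrix_vector_mult_diff_distrib)
    also have "- omega (join z 0) \<dots> = - omega (W t *v (\<eta> - join 0 v)) (W' t *v (\<eta> - join 0 v)) - omega (\<eta> - join 0 v) \<eta>'"
      using symplectic_omega[OF W(1), of t "\<eta> - join 0 v" \<eta>'] by (simp add: Wz omega_add_right)
    also have "omega (\<eta> - join 0 v) \<eta>' = omega \<eta> \<eta>' - v \<bullet> (upper_right (P' t) *v w)"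
      by (simp add: omega_diff_left \<eta>'_def mult_join)
    finally show ?thesis
      using W(5)[of t "\<eta> - join 0 v"] P(5)[of t "join 0 w"] t(3) by (simp add: v_def \<eta>_def \<eta>'_def)
  qed
  have contV: "continuous_on {a<..<b} V"
    unfolding V_def
    using continuous_on_subset[OF contD] continuous_on_subset[OF contU1] invD
    by (intro continuous_on_matrix_mult continuous_on_matrix_inv) auto
  define Q3 where "Q3 t = X t ** matrix_inv (V t)" for t
  note rule3 = quotient_rank_jump[where X = X and V = V and E = "E \<union> F" and V' = V' and X' = "\<lambda>t. upper_right (P' t)"
      and a = a and b = b and ?t0.0 = t0, folded Q3_def]
  have contX': "continuous_on {a<..<b} X" by (rule continuous_on_subset[OF contX]) simp
  have jump3: "\<exists>r m. (\<forall>\<^sub>F t in at_left t0. rank (X t) = r \<and> neg_index (Q3 t) = m) \<and>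
      r + neg_index (Q3 t0) = rank (X t0) + m \<and> neg_index (Q3 t0) \<le> m"
    "\<exists>r. \<forall>\<^sub>F t in at_right t0. rank (X t) = r \<and> neg_index (Q3 t) = neg_index (Q3 t0)"
    by - (rule rule3; (assumption | (rule I contX' contV invV lagr Y(3) dX dV nonneg; assumption)))+
  have f_eq: "f t + neg_index (Q1 t) = neg_index (Q2 t) + neg_index (Q3 t)" if t: "a < t" "t < b" for t
  proof -
    have "X t = (transpose (D t) ** R t ** D t) ** V t"
      by (simp add: X_eq[OF t] DV[OF t, symmetric] matrix_mul_assoc)
    then have "Q3 t = transpose (D t) ** R t ** D t"
      using matrix_inv_inverse(1)[OF invV[OF t]] by (simp add: Q3_def matrix_mul_assoc[symmetric])
    then have "neg_index (Q3 t) = neg_index (R t)" using neg_index_congruence[OF R_sym[OF t] invD[OF t]] by simp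
    then show ?thesis
      using focal_multiplicity_eq_triple_index[OF invU1[OF t] invD[OF t] jump1(1)[OF t] jump2(1)[OF t] X1_eq[OF t] B_eq[OF t]
          X_eq[OF t, unfolded R_def] refl refl refl]
      by (simp add: f_def step_multiplicity_def Let_def X_def X1_def B_def Y_def R_def)
  qed
  have near: "\<forall>\<^sub>F t in at t0 within S. a < t \<and> t < b" for S
    using I by (intro eventually_at_topological[THEN iffD2] exI[of _ "{a<..<b}"]) auto
  obtain r1 m1 where 1: "\<forall>\<^sub>F t in at_left t0. rank (X1 t) = r1 \<and> neg_index (Q1 t) = m1"
    "r1 + neg_index (Q1 t0) = rank (X1 t0) + m1" using jump1(2) by blast
  obtain r2 m2 where 2: "\<forall>\<^sub>F t in at_left t0. rank (B t) = r2 \<and> neg_index (Q2 t) = m2"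
    "r2 + neg_index (Q2 t0) = rank (B t0) + m2" using jump2(2) by blast
  obtain r m3 where 3: "\<forall>\<^sub>F t in at_left t0. rank (X t) = r \<and> neg_index (Q3 t) = m3"
    "r + neg_index (Q3 t0) = rank (X t0) + m3" using jump3(1) by blast
  define m where "m = m2 + m3 - m1"
  have ev: "\<forall>\<^sub>F t in at_left t0. f t + m1 = m2 + m3 \<and> rank (X t) = r \<and> rank (X1 t) = r1 \<and> rank (B t) = r2"
    using 1(1) 2(1) 3(1) near[of "{..<t0}"] by eventually_elim (use f_eq in auto)
  obtain s where "f s + m1 = m2 + m3"
    using eventually_happens[OF ev] trivial_limit_at_left_real by blast
  then have m: "m + m1 = m2 + m3" by (simp add: m_def)
  have "\<forall>\<^sub>F t in at_left t0. f t = m \<and> rank (X t) = r \<and> rank (X1 t) = r1 \<and> rank (B t) = r2"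
    using ev by eventually_elim (use m in auto)
  moreover have "int (f t0) - int m = (int r1 - int (rank (X1 t0))) - (int r - int (rank (X t0))) - (int r2 - int (rank (B t0)))"
    using 1(2) 2(2) 3(2) f_eq[OF I] m by linarith
  ultimately show "\<exists>m r r1 r2. (\<forall>\<^sub>F t in at_left t0. f t = m \<and> rank (upper_right (P t)) = r \<and>
        rank (upper_right (W t ** P t)) = r1 \<and> rank (upper_right (W t)) = r2) \<and>
      int (f t0) - int m = (int r1 - int (rank (upper_right (W t0 ** P t0))))
        - (int r - int (rank (upper_right (P t0)))) - (int r2 - int (rank (upper_right (W t0))))"
    unfolding X_def X1_def B_def Y_def by blast
  obtain s1 where 4: "\<forall>\<^sub>F t in at_right t0. rank (X1 t) = s1 \<and> neg_index (Q1 t) = neg_index (Q1 t0)"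
    using jump1(3) by blast
  obtain s2 where 5: "\<forall>\<^sub>F t in at_right t0. rank (B t) = s2 \<and> neg_index (Q2 t) = neg_index (Q2 t0)"
    using jump2(3) by blast
  obtain s3 where 6: "\<forall>\<^sub>F t in at_right t0. rank (X t) = s3 \<and> neg_index (Q3 t) = neg_index (Q3 t0)"
    using jump3(2) by blast
  show "\<forall>\<^sub>F t in at_right t0. f t = f t0"
    using 4 5 6 near[of "{t0<..}"]
  proof eventually_elim
    case (elim t)
    then show ?case using f_eq[of t] f_eq[OF I] by linarith
  qed
qed

definition shear :: "real \<Rightarrow> real^('n::finite + 'n)^('n + 'n)" where
  "shear \<tau> = block_matrix (mat 1) 0 (- \<tau> *\<^sub>R mat 1) (mat 1)"

lemma shear_blocks: "upper_left (shear \<tau>) = mat 1" "upper_right (shear \<tau>) = 0"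
    "lower_left (shear \<tau>) = - \<tau> *\<^sub>R mat 1" "lower_right (shear \<tau>) = mat 1"
  by (simp_all add: shear_def upper_left_def upper_right_def lower_left_def lower_right_def block_matrix_def vec_eq_iff)

lemma upper_right_shear: "upper_right (shear \<tau> ** W) = upper_right W"
  and lower_right_shear: "lower_right (shear \<tau> ** W) = lower_right W - \<tau> *\<^sub>R upper_right W"
  unfolding upper_right_mult lower_right_mult shear_blocks
  by (simp_all add: matrix_eq matrix_vector_mult_add_rdistrib matrix_vector_mult_diff_rdistrib
      uminus_matrix_vector_mult matrix_vector_mul_assoc[symmetric] scaleR_matrix_vector_assoc[symmetric])

lemma symplectic_shear: "symplectic (shear \<tau>)"
proof -
  have "omega (shear \<tau> *v join x u) (shear \<tau> *v join y v) = omega (join x u) (join y v)" for x u y v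
    by (simp add: mult_join shear_blocks uminus_matrix_vector_mult scaleR_matrix_vector_assoc[symmetric] inner_diff_left inner_diff_right
        inner_add_left inner_add_right)
  then show ?thesis unfolding symplectic_iff_omega by (metis join_cases)
qed

text \<open>A shear makes the lower right block invertible near \<open>t0\<close>. The upper right block then has the rank of
  a nondecreasing symmetric matrix.\<close>

lemma rank_upper_right_one_sided_limits:
  assumes P: "monotone_symplectic_path P"
  shows "\<exists>r. (\<forall>\<^sub>F t in at_left t0. rank (upper_right (P t)) = r) \<and> rank (upper_right (P t0)) \<le> r"
    and "\<exists>r. \<forall>\<^sub>F t in at_right t0. rank (upper_right (P t)) = r"
proof -
  have "finite {\<tau>. \<not> invertible (lower_right (P t0) - \<tau> *\<^sub>R upper_right (P t0))}"
    using P by (intro finite_non_transversal_shears) (simp add: monotone_symplectic_path_def)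
  then obtain \<tau> where \<tau>: "invertible (lower_right (shear \<tau> ** P t0))"
    unfolding lower_right_shear
    by (metis (mono_tags, lifting) UNIV_I ex_new_if_finite infinite_UNIV_char_0 mem_Collect_eq)
  have "monotone_symplectic_path (\<lambda>t. shear \<tau> ** P t)"
    by (intro monotone_symplectic_path_mult monotone_symplectic_path_const symplectic_shear P)
  then obtain E P' where P': "\<And>t. symplectic (shear \<tau> ** P t)" "continuous_on UNIV (\<lambda>t. shear \<tau> ** P t)" "\<And>r s. finite (E \<inter> {r..s})"
    "\<And>t. t \<notin> E \<Longrightarrow> ((\<lambda>t. shear \<tau> ** P t) has_vector_derivative P' t) (at t)"
    "\<And>t x. t \<notin> E \<Longrightarrow> 0 \<le> omega ((shear \<tau> ** P t) *v x) (P' t *v x)"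
    by (rule monotone_symplectic_pathE) blast
  obtain d where d: "d > 0" "\<And>t. \<bar>t - t0\<bar> < d \<Longrightarrow> invertible (lower_right (shear \<tau> ** P t))"
    using invertible_near[OF continuous_on_blocks(2)[OF P'(2)] \<tau>] by metis
  have I: "t0 - d < t0" "t0 < t0 + d" using d(1) by auto
  have inv: "invertible (lower_right (shear \<tau> ** P t))" if "t0 - d < t" "t < t0 + d" for t
    using d(2) that by auto
  show "\<exists>r. (\<forall>\<^sub>F t in at_left t0. rank (upper_right (P t)) = r) \<and> rank (upper_right (P t0)) \<le> r"
  proof -
    obtain r m where rm: "\<forall>\<^sub>F t in at_left t0. rank (upper_right (P t)) = r \<and>
        neg_index (upper_right (P t) ** matrix_inv (lower_right (shear \<tau> ** P t))) = m"
      "r + neg_index (upper_right (P t0) ** matrix_inv (lower_right (shear \<tau> ** P t0))) = rank (upper_right (P t0)) + m"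
      "neg_index (upper_right (P t0) ** matrix_inv (lower_right (shear \<tau> ** P t0))) \<le> m"
      using path_quotient_rank_jump(2)[OF P' I inv, unfolded upper_right_shear] by blast
    then have "rank (upper_right (P t0)) \<le> r" by linarith
    moreover have "\<forall>\<^sub>F t in at_left t0. rank (upper_right (P t)) = r"
      using rm(1) by eventually_elim blast
    ultimately show ?thesis by blast
  qed
  obtain r where "\<forall>\<^sub>F t in at_right t0. rank (upper_right (P t)) = r \<and>
      neg_index (upper_right (P t) ** matrix_inv (lower_right (shear \<tau> ** P t)))
        = neg_index (upper_right (P t0) ** matrix_inv (lower_right (shear \<tau> ** P t0)))"
    using path_quotient_rank_jump(3)[OF P' I inv, unfolded upper_right_shear] by blast
  then have "\<forall>\<^sub>F t in at_right t0. rank (upper_right (P t)) = r" by eventually_elim blast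
  then show "\<exists>r. \<forall>\<^sub>F t in at_right t0. rank (upper_right (P t)) = r" by blast
qed

text \<open>A common shear for \<open>W t0\<close> and \<open>W t0 ** P t0\<close> reduces this to the case of invertible lower right blocks.
  It is applied to \<open>W\<close> only: \<open>P\<close> and the blocks in the definition of the multiplicity stay the same.\<close>

lemma step_multiplicity_jump:
  fixes W P :: "real \<Rightarrow> real^('n::finite + 'n)^('n + 'n)"
  assumes W: "monotone_symplectic_path W" and P: "monotone_symplectic_path P"
  defines "f \<equiv> \<lambda>t. step_multiplicity (upper_right (P t)) (upper_right (W t ** P t)) (upper_right (W t))"
  shows "\<exists>m r r1 r2. (\<forall>\<^sub>F t in at_left t0. f t = m \<and> rank (upper_right (P t)) = r \<and>
        rank (upper_right (W t ** P t)) = r1 \<and> rank (upper_right (W t)) = r2) \<and>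
      int (f t0) - int m = (int r1 - int (rank (upper_right (W t0 ** P t0))))
        - (int r - int (rank (upper_right (P t0)))) - (int r2 - int (rank (upper_right (W t0))))"
    and "\<forall>\<^sub>F t in at_right t0. f t = f t0"
proof -
  have sW: "symplectic (W t0)" "symplectic (W t0 ** P t0)"
    using W P by (auto simp: monotone_symplectic_path_def intro: symplectic_mult)
  have "finite ({\<tau>. \<not> invertible (lower_right (W t0) - \<tau> *\<^sub>R upper_right (W t0))} \<union>
      {\<tau>. \<not> invertible (lower_right (W t0 ** P t0) - \<tau> *\<^sub>R upper_right (W t0 ** P t0))})"
    using finite_non_transversal_shears sW by blast
  then obtain \<tau> where \<tau>: "invertible (lower_right (shear \<tau> ** W t0))" "invertible (lower_right (shear \<tau> ** W t0 ** P t0))"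
    unfolding lower_right_shear matrix_mul_assoc[symmetric]
    by (metis (mono_tags, lifting) UNIV_I UnI1 UnI2 ex_new_if_finite infinite_UNIV_char_0 mem_Collect_eq)
  have LW: "monotone_symplectic_path (\<lambda>t. shear \<tau> ** W t)"
    by (intro monotone_symplectic_path_mult monotone_symplectic_path_const symplectic_shear W)
  have assoc: "shear \<tau> ** W t ** P t = shear \<tau> ** (W t ** P t)" for t by (simp add: matrix_mul_assoc)
  note * = step_multiplicity_jump_in_chart[OF LW P \<tau>, unfolded assoc upper_right_shear, folded f_def]
  show "\<exists>m r r1 r2. (\<forall>\<^sub>F t in at_left t0. f t = m \<and> rank (upper_right (P t)) = r \<and>
        rank (upper_right (W t ** P t)) = r1 \<and> rank (upper_right (W t)) = r2) \<and>
      int (f t0) - int m = (int r1 - int (rank (upper_right (W t0 ** P t0))))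
        - (int r - int (rank (upper_right (P t0)))) - (int r2 - int (rank (upper_right (W t0))))"
    and "\<forall>\<^sub>F t in at_right t0. f t = f t0"
    using * unfolding f_def by blast+
qed

section \<open>Adding up jumps\<close>

lemma rank_left_eqI:
  assumes "\<forall>\<^sub>F s in at_left t. rank (A s) = r"
  shows "rank_left A t = r"
  unfolding rank_left_def
  by (intro tendsto_Lim tendsto_eventually assms) simp

text \<open>If a property holds just to the left of \<open>t\<close>, then it also holds just to the left of every \<open>s\<close> in that
  range. This turns one-sided constancy of a rank at \<open>t\<close> into the absence of rank jumps near \<open>t\<close>.\<close>

lemma eventually_at_left_nested:
  fixes t :: real
  assumes "\<forall>\<^sub>F s in at_left t. P s"
  shows "\<forall>\<^sub>F s in at_left t. P s \<and> (\<forall>\<^sub>F u in at_left s. P u)"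
proof -
  obtain c where c: "c < t" "\<And>s. c < s \<Longrightarrow> s < t \<Longrightarrow> P s"
    using assms unfolding eventually_at_left_field by blast
  have "P s \<and> (\<forall>\<^sub>F u in at_left s. P u)" if "c < s" "s < t" for s
    using c that unfolding eventually_at_left_field by (meson less_trans)
  then show ?thesis using c(1) unfolding eventually_at_left_field by blast
qed

lemma eventually_at_right_nested:
  fixes t :: real
  assumes "\<forall>\<^sub>F s in at_right t. P s"
  shows "\<forall>\<^sub>F s in at_right t. P s \<and> (\<forall>\<^sub>F u in at_left s. P u)"
proof -
  obtain c where c: "t < c" "\<And>s. t < s \<Longrightarrow> s < c \<Longrightarrow> P s"
    using assms unfolding eventually_at_right_field by blast
  have "P s \<and> (\<forall>\<^sub>F u in at_left s. P u)" if "t < s" "s < c" for s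
    using c that unfolding eventually_at_left_field by (meson less_trans)
  then show ?thesis using c(1) unfolding eventually_at_right_field by blast
qed

lemma finite_nonzero_if_locally_zero:
  fixes j :: "real \<Rightarrow> 'a::zero"
  assumes "\<And>t. \<forall>\<^sub>F s in at t. j s = 0"
  shows "finite {t \<in> {a..b}. j t \<noteq> 0}"
proof (rule ccontr)
  let ?T = "{t \<in> {a..b}. j t \<noteq> 0}"
  assume "infinite ?T"
  then obtain x where x: "x islimpt ?T"
    using compact_eq_Bolzano_Weierstrass[of "{a..b}"] by (metis (no_types, lifting) compact_Icc mem_Collect_eq subsetI)
  obtain d where d: "d > 0" "\<And>s. s \<noteq> x \<Longrightarrow> dist s x < d \<Longrightarrow> j s = 0"
    using assms[of x] unfolding eventually_at by auto
  obtain s where "s \<in> ?T" "s \<noteq> x" "dist s x < d" using x d(1) unfolding islimpt_approachable by blast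
  then show False using d(2) by auto
qed

text \<open>The identity is additive over adjacent intervals and holds on short intervals around every point, so
  a bisection argument gives it on \<open>[a, b]\<close>.\<close>

lemma sum_of_jumps:
  fixes f j :: "real \<Rightarrow> int"
  assumes left: "\<And>t. \<forall>\<^sub>F s in at_left t. f s = f t - j t"
    and right: "\<And>t. \<forall>\<^sub>F s in at_right t. f s = f t"
    and zero: "\<And>t. \<forall>\<^sub>F s in at t. j s = 0"
    and ab: "a \<le> b"
  shows "(\<Sum>t | t \<in> {a<..b} \<and> j t \<noteq> 0. j t) = f b - f a"
proof -
  define T where "T a b = {t \<in> {a<..b}. j t \<noteq> 0}" for a b
  have fin: "finite (T a b)" for a b
    unfolding T_def by (rule finite_subset[OF _ finite_nonzero_if_locally_zero[OF zero, of a b]]) auto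
  have "sum j (T a b) = f b - f a"
    using ab
  proof (induction rule: Bolzano)
    case (trans a b c)
    then have "T a c = T a b \<union> T b c" "T a b \<inter> T b c = {}" by (auto simp: T_def)
    then show ?case using trans fin by (simp add: sum.union_disjoint)
  next
    case (local x)
    obtain c where c: "c < x" "\<And>s. c < s \<Longrightarrow> s < x \<Longrightarrow> f s = f x - j x"
      using left[of x] unfolding eventually_at_left_field by blast
    obtain e where e: "x < e" "\<And>s. x < s \<Longrightarrow> s < e \<Longrightarrow> f s = f x"
      using right[of x] unfolding eventually_at_right_field by blast
    obtain d where d: "d > 0" "\<And>s. s \<noteq> x \<Longrightarrow> dist s x < d \<Longrightarrow> j s = 0"
      using zero[of x] unfolding eventually_at by auto
    show ?case
    proof (intro exI[of _ "min d (min (x - c) (e - x))"] conjI allI impI)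
      show "0 < min d (min (x - c) (e - x))" using c e d by simp
      fix a b assume ab: "a \<le> x \<and> x \<le> b \<and> b - a < min d (min (x - c) (e - x))"
      have j0: "j s = 0" if "a < s" "s \<le> b" "s \<noteq> x" for s
        using that ab d(2)[of s] by (auto simp: dist_real_def)
      have fb: "f b = f x" using e(2)[of b] ab by (cases "b = x") auto
      show "sum j (T a b) = f b - f a"
      proof (cases "a = x")
        case True
        then have "T a b = {}" using j0 by (auto simp: T_def)
        then show ?thesis using fb True by simp
      next
        case False
        have "T a b \<subseteq> {x}" using j0 by (auto simp: T_def)
        then have "sum j (T a b) = sum j {x}"
          using False ab by (intro sum.mono_neutral_left) (auto simp: T_def)
        then show ?thesis using c(2)[of a] ab False fb by auto
      qed
    qed
  qed
  then show ?thesis unfolding T_def by simp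
qed

definition rank_jump :: "(real \<Rightarrow> real^'n^'n) \<Rightarrow> real \<Rightarrow> int" where
  "rank_jump A t = int (rank_left A t) - int (rank (A t))"

lemma rank_jump_path:
  assumes P: "monotone_symplectic_path P"
  shows "0 \<le> rank_jump (\<lambda>s. upper_right (P s)) t"
    and "\<forall>\<^sub>F s in at t. rank_jump (\<lambda>s. upper_right (P s)) s = 0"
proof -
  let ?A = "\<lambda>s. upper_right (P s)"
  obtain r where r: "\<forall>\<^sub>F s in at_left t. rank (?A s) = r" "rank (?A t) \<le> r"
    using rank_upper_right_one_sided_limits(1)[OF P] by blast
  show "0 \<le> rank_jump ?A t"
    using r(2) rank_left_eqI[of ?A r, OF r(1)] by (simp add: rank_jump_def)
  obtain q where q: "\<forall>\<^sub>F s in at_right t. rank (?A s) = q"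
    using rank_upper_right_one_sided_limits(2)[OF P] by blast
  have "\<forall>\<^sub>F s in at_left t. rank_jump ?A s = 0"
    using eventually_at_left_nested[OF r(1)]
    by eventually_elim (auto simp: rank_jump_def rank_left_eqI)
  moreover have "\<forall>\<^sub>F s in at_right t. rank_jump ?A s = 0"
    using eventually_at_right_nested[OF q]
    by eventually_elim (auto simp: rank_jump_def rank_left_eqI)
  ultimately show "\<forall>\<^sub>F s in at t. rank_jump ?A s = 0"
    by (simp add: eventually_at_split)
qed

section \<open>The transformed system\<close>

lemma upper_block_principal: "upper_block (A ** block_column 0 (mat 1)) = upper_right A"
  by (simp add: upper_block_def upper_right_def block_column_def matrix_matrix_mult_def vec_eq_iff
      sum_UNIV_sum_type mat_def if_distrib[where f = "\<lambda>c. _ * c"] sum.delta' cong: if_cong)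

lemma m_d_eq_step_multiplicity:
  "m_d W Y k = step_multiplicity (upper_block (Y k)) (upper_block (Y (Suc k))) (upper_right (W k))"
  by (simp add: m_d_def focal_P_def focal_T_def focal_M_def step_multiplicity_def Let_def)

lemma step_multiplicity_zero: "step_multiplicity X X1 0 = 0"
proof -
  have "neg_index (0 :: real^'n^'n) = 0" by (simp add: neg_index_def)
  then show ?thesis by (simp add: step_multiplicity_def Let_def)
qed

text \<open>Away from the exceptional points the one-sided derivatives in \<open>\<Psi>\<close> agree with the derivative.\<close>

lemma C1p_monotone_symplectic_path:
  assumes C1: "C1p S" and symp: "\<And>t. symplectic (S t)" and Psi: "\<And>t. Psi_nonneg S t"
  shows "monotone_symplectic_path S"
proof -
  obtain E S' where S: "continuous_on UNIV S" "\<And>r s. finite (E \<inter> {r..s})"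
    "\<And>t. t \<notin> E \<Longrightarrow> (S has_vector_derivative S' t) (at t)"
    using C1 unfolding C1p_def by blast
  have "0 \<le> omega (S t *v x) (S' t *v x)" if t: "t \<notin> E" for t x
  proof -
    have "(S has_vector_derivative S' t) (at_left t)"
      using S(3)[OF t] by (rule has_vector_derivative_at_within)
    then have "vector_derivative S (at_left t) = S' t"
      by (intro vector_derivative_within) simp_all
    then have "0 \<le> (S t *v x) \<bullet> ((transpose JJ ** S' t ** matrix_inv (S t)) *v (S t *v x))"
      using Psi[of t] unfolding Psi_nonneg_def nonneg_definite_def Psi_def by simp
    then show ?thesis
      using matrix_inv_vector(2)[OF symplectic_invertible[OF symp[of t]], of x]
      by (simp add: omega_def matrix_vector_mul_assoc[symmetric] del: transpose_matrix_vector)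
  qed
  then show ?thesis unfolding monotone_symplectic_path_def using S symp by blast
qed

lemma matrix_inv_mat_1: "matrix_inv (mat 1 :: real^'n^'n) = mat 1"
proof -
  have "invertible (mat 1 :: real^'n^'n)" unfolding invertible_def by (intro exI[of _ "mat 1"]) simp
  from matrix_inv_inverse(1)[OF this] show ?thesis by simp
qed

text \<open>The product of the first \<open>k\<close> coefficients, transformed by \<open>R\<^sub>k\<^sup>-\<^sup>1\<close>, is a monotone symplectic path
  whose last \<open>n\<close> columns are the transformed principal solution, since that solution starts with
  \<open>(0, I)\<close>. Each step contributes the jumps from \<open>step_multiplicity_jump\<close>, and the jumps of the upper blocks
  of the solution telescope.\<close>

lemma transformed_index_change:
  fixes S :: "nat \<Rightarrow> real \<Rightarrow> real^('n::finite + 'n)^('n + 'n)"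
  assumes S: "\<And>k. k \<le> N \<Longrightarrow> monotone_symplectic_path (S k)"
    and R: "\<And>k. k \<le> Suc N \<Longrightarrow> symplectic (R k)" "R (Suc N) = mat 1"
    and Y: "\<And>t. matrix_solution N (\<lambda>k. S k t) (\<lambda>k. Y k t)" "\<And>t. Y 0 t = block_column 0 (mat 1)"
    and ab: "a < b"
  shows "finite (finite_eigenvalues N Y \<inter> {a<..b})"
    and "finite (n_R_support N S R a b)"
    and "int (l_d_transformed N S R Y b) - int (l_d_transformed N S R Y a)
      = fe_count N Y {a<..b} - n_R_sum N S R a b"
    and "0 \<le> fe_mult N Y t"
proof -
  define P where "P k t = matrix_inv (R k) ** rec_nat (mat 1) (\<lambda>k Z. S k t ** Z) k" for k t
  define W where "W k t = transformed R S k t" for k t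
  have PSuc: "P (Suc k) t = W k t ** P k t" if "k \<le> N" for k t
  proof -
    have "P (Suc k) t = matrix_inv (R (Suc k)) ** S k t ** (R k ** matrix_inv (R k)) ** rec_nat (mat 1) (\<lambda>k Z. S k t ** Z) k"
      using matrix_inv_inverse(1)[OF symplectic_invertible[OF R(1)[of k]]] that
      by (simp add: P_def matrix_mul_assoc)
    then show ?thesis by (simp add: P_def W_def transformed_def matrix_mul_assoc)
  qed
  have YP: "matrix_inv (R k) ** Y k t = P k t ** block_column 0 (mat 1)" if "k \<le> Suc N" for k t
  proof -
    have "Y k t = rec_nat (mat 1) (\<lambda>k Z. S k t ** Z) k ** block_column 0 (mat 1)"
      using that
    proof (induction k)
      case (Suc k)
      then show ?case using Y(1)[of t] by (simp add: matrix_solution_def matrix_mul_assoc)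
    qed (simp add: Y(2))
    then show ?thesis by (simp add: P_def matrix_mul_assoc)
  qed
  have W: "monotone_symplectic_path (W k)" if "k \<le> N" for k
    unfolding W_def[abs_def] transformed_def using that
    by (intro monotone_symplectic_path_mult monotone_symplectic_path_const symplectic_inverse R(1) S) auto
  have P: "monotone_symplectic_path (P k)" if "k \<le> Suc N" for k
    using that
  proof (induction k)
    case 0
    have "P 0 = (\<lambda>t. matrix_inv (R 0))" by (simp add: P_def fun_eq_iff)
    then show ?case by (simp add: monotone_symplectic_path_const symplectic_inverse R(1))
  next
    case (Suc k)
    have "P (Suc k) = (\<lambda>t. W k t ** P k t)" using PSuc Suc.prems by (simp add: fun_eq_iff)
    then show ?case using Suc W by (simp add: monotone_symplectic_path_mult)
  qed
  define \<theta> where "\<theta> k = rank_jump (\<lambda>t. upper_right (P k t))" for k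
  define f where "f k t = int (step_multiplicity (upper_right (P k t)) (upper_right (W k t ** P k t)) (upper_right (W k t)))" for k t
  define j where "j k t = \<theta> (Suc k) t - \<theta> k t - vartheta R S k t" for k t
  have vt: "vartheta R S k = rank_jump (\<lambda>t. upper_right (W k t))" for k
    by (simp add: fun_eq_iff vartheta_def rank_jump_def W_def)
  have \<theta>Suc: "\<theta> (Suc k) = rank_jump (\<lambda>t. upper_right (W k t ** P k t))" if "k \<le> N" for k
    unfolding \<theta>_def using PSuc[OF that] by simp
  have left: "\<forall>\<^sub>F s in at_left t. f k s = f k t - j k t" if k: "k \<le> N" for k t
  proof -
    obtain m r r1 r2 where
      ev: "\<forall>\<^sub>F s in at_left t. step_multiplicity (upper_right (P k s)) (upper_right (W k s ** P k s)) (upper_right (W k s)) = m \<and>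
        rank (upper_right (P k s)) = r \<and> rank (upper_right (W k s ** P k s)) = r1 \<and> rank (upper_right (W k s)) = r2"
      and eq: "f k t - int m = (int r1 - int (rank (upper_right (W k t ** P k t))))
        - (int r - int (rank (upper_right (P k t)))) - (int r2 - int (rank (upper_right (W k t))))"
      using step_multiplicity_jump(1)[OF W[OF k] P[OF le_SucI[OF k]], of t] unfolding f_def by blast
    have "rank_left (\<lambda>s. upper_right (P k s)) t = r" "rank_left (\<lambda>s. upper_right (W k s ** P k s)) t = r1"
      "rank_left (\<lambda>s. upper_right (W k s)) t = r2"
      using ev by (auto intro!: rank_left_eqI elim: eventually_mono)
    then have "f k t - int m = j k t"
      unfolding eq j_def \<theta>Suc[OF k] vt by (simp add: \<theta>_def rank_jump_def)
    then show ?thesis using ev by (auto simp: f_def elim!: eventually_mono)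
  qed
  have right: "\<forall>\<^sub>F s in at_right t. f k s = f k t" if k: "k \<le> N" for k t
    using step_multiplicity_jump(2)[OF W[OF k] P[of k], of t] k
    unfolding f_def by (auto elim: eventually_mono)
  have \<theta>0: "\<theta> 0 t = 0" for t
  proof -
    have "rank_left (\<lambda>s. upper_right (P 0 s)) t = rank (upper_right (P 0 t))"
      by (intro rank_left_eqI) (simp add: P_def)
    then show ?thesis by (simp add: \<theta>_def rank_jump_def)
  qed
  have \<theta>N: "\<theta> (Suc N) = fe_mult N Y"
  proof -
    have "upper_right (P (Suc N) t) = upper_block (Y (Suc N) t)" for t
      using YP[of "Suc N" t] upper_block_principal[of "P (Suc N) t"] by (simp add: R(2) matrix_inv_mat_1)
    then show ?thesis by (simp add: fun_eq_iff \<theta>_def rank_jump_def fe_mult_def)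
  qed
  define L where "L t = int (l_d_transformed N S R Y t)" for t
  have L: "L t = (\<Sum>k<Suc N. f k t)" for t
    unfolding L_def l_d_transformed_def l_d_def of_nat_sum m_d_eq_step_multiplicity f_def atLeast0LessThan
    by (intro sum.cong) (auto simp: YP upper_block_principal PSuc W_def[symmetric])
  have J: "fe_mult N Y t - n_R N S R t = (\<Sum>k<Suc N. j k t)" for t
  proof -
    have "(\<Sum>k<Suc N. j k t) = (\<Sum>k<Suc N. \<theta> (Suc k) t - \<theta> k t) - (\<Sum>k<Suc N. vartheta R S k t)"
      unfolding j_def by (rule sum_subtractf)
    also have "(\<Sum>k<Suc N. \<theta> (Suc k) t - \<theta> k t) = \<theta> (Suc N) t - \<theta> 0 t"
      by (rule sum_lessThan_telescope)
    finally show ?thesis by (simp add: \<theta>0 \<theta>N n_R_def lessThan_Suc_atMost atLeast0AtMost)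
  qed
  have feq: "\<forall>\<^sub>F s in at t. fe_mult N Y s = 0" for t
    using rank_jump_path(2)[OF P[of "Suc N"]] \<theta>N by (simp add: \<theta>_def)
  have nR: "\<forall>\<^sub>F s in at t. n_R N S R s = 0" for t
  proof -
    have "\<forall>\<^sub>F s in at t. \<forall>k\<in>{0..N}. vartheta R S k s = 0"
      using rank_jump_path(2)[OF W] by (intro eventually_ball_finite) (auto simp: vt)
    then show ?thesis by eventually_elim (simp add: n_R_def)
  qed
  have nonneg: "0 \<le> fe_mult N Y t" for t
    using rank_jump_path(1)[OF P[of "Suc N"], of t] \<theta>N by (simp add: \<theta>_def)
  then show "0 \<le> fe_mult N Y t" .
  have fe_set: "finite_eigenvalues N Y \<inter> {a<..b} = {t. t \<in> {a<..b} \<and> fe_mult N Y t \<noteq> 0}"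
  proof -
    have "1 \<le> fe_mult N Y t \<longleftrightarrow> fe_mult N Y t \<noteq> 0" for t using nonneg[of t] by linarith
    then show ?thesis by (auto simp: finite_eigenvalues_def)
  qed
  have nR_set: "n_R_support N S R a b = {t. t \<in> {a<..b} \<and> n_R N S R t \<noteq> 0}"
    by (auto simp: n_R_support_def)
  show fin1: "finite (finite_eigenvalues N Y \<inter> {a<..b})"
    unfolding fe_set by (rule finite_subset[OF _ finite_nonzero_if_locally_zero[OF feq, of a b]]) auto
  show fin2: "finite (n_R_support N S R a b)"
    unfolding nR_set by (rule finite_subset[OF _ finite_nonzero_if_locally_zero[OF nR, of a b]]) auto
  define J where "J t = fe_mult N Y t - n_R N S R t" for t
  have "(\<Sum>t | t \<in> {a<..b} \<and> J t \<noteq> 0. J t) = L b - L a"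
  proof (rule sum_of_jumps)
    show "\<forall>\<^sub>F s in at_left t. L s = L t - J t" for t
    proof -
      have "\<forall>\<^sub>F s in at_left t. \<forall>k\<in>{..<Suc N}. f k s = f k t - j k t"
        using left by (intro eventually_ball_finite) auto
      then show ?thesis
        by eventually_elim (simp add: L J J_def sum_subtractf del: sum.lessThan_Suc)
    qed
    show "\<forall>\<^sub>F s in at_right t. L s = L t" for t
    proof -
      have "\<forall>\<^sub>F s in at_right t. \<forall>k\<in>{..<Suc N}. f k s = f k t"
        using right by (intro eventually_ball_finite) auto
      then show ?thesis by eventually_elim (simp add: L del: sum.lessThan_Suc)
    qed
    show "\<forall>\<^sub>F s in at t. J s = 0" for t
      using feq[of t] nR[of t] by eventually_elim (simp add: J_def)
  qed (use ab in simp)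
  moreover have "(\<Sum>t | t \<in> {a<..b} \<and> J t \<noteq> 0. J t) = fe_count N Y {a<..b} - n_R_sum N S R a b"
  proof -
    let ?F = "(finite_eigenvalues N Y \<inter> {a<..b}) \<union> n_R_support N S R a b"
    have "(\<Sum>t | t \<in> {a<..b} \<and> J t \<noteq> 0. J t) = sum J ?F"
      using fin1 fin2 by (intro sum.mono_neutral_left) (auto simp: fe_set nR_set J_def)
    also have "\<dots> = sum (fe_mult N Y) ?F - sum (n_R N S R) ?F"
      by (simp add: J_def sum_subtractf)
    also have "sum (fe_mult N Y) ?F = fe_count N Y {a<..b}"
      unfolding fe_count_def using fin1 fin2 by (intro sum.mono_neutral_right) (auto simp: fe_set nR_set)
    also have "sum (n_R N S R) ?F = n_R_sum N S R a b"
      unfolding n_R_sum_def using fin1 fin2 by (intro sum.mono_neutral_right) (auto simp: fe_set nR_set)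
    finally show ?thesis .
  qed
  ultimately show "int (l_d_transformed N S R Y b) - int (l_d_transformed N S R Y a)
      = fe_count N Y {a<..b} - n_R_sum N S R a b" by (simp add: L_def)
qed

lemma fundamental_matrix_symplectic:
  assumes "\<And>k. k \<le> N \<Longrightarrow> symplectic (S k)" "matrix_solution N S Z" "Z (Suc N) = mat 1" "k \<le> Suc N"
  shows "symplectic (Z k)"
  using assms(4)
proof (induction rule: inc_induct)
  case base
  show ?case by (simp add: assms(3) symplectic_mat_1)
next
  case (step k)
  then have k: "k \<le> N" by simp
  have "matrix_inv (S k) ** Z (Suc k) = matrix_inv (S k) ** S k ** Z k"
    using assms(2) k by (simp add: matrix_solution_def matrix_mul_assoc)
  also have "\<dots> = Z k"
    using matrix_inv_inverse(2)[OF symplectic_invertible[OF assms(1)[OF k]]] by simp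
  finally show ?case
    using symplectic_mult[OF symplectic_inverse[OF assms(1)[OF k]] step.IH] by simp
qed

text \<open>Transforming by a fundamental matrix of the system at \<open>t\<close> itself turns all coefficients into the
  identity, and steps with a vanishing upper right block have no focal points.\<close>

lemma l_d_transformed_fundamental_matrix:
  fixes S :: "nat \<Rightarrow> real \<Rightarrow> real^('n::finite + 'n)^('n + 'n)"
  assumes "\<And>k. k \<le> N \<Longrightarrow> symplectic (S k t)" "matrix_solution N (\<lambda>k. S k t) Z" "Z (Suc N) = mat 1"
  shows "l_d_transformed N S Z Y t = 0"
proof -
  have "upper_right (transformed Z S k t) = 0" if k: "k \<le> N" for k
  proof -
    have "transformed Z S k t = matrix_inv (Z (Suc k)) ** Z (Suc k)"
      using assms(2) k by (simp add: transformed_def matrix_solution_def matrix_mul_assoc[symmetric])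
    also have "\<dots> = mat 1"
      using k fundamental_matrix_symplectic[OF assms, of "Suc k"]
      by (intro matrix_inv_inverse(2) symplectic_invertible) simp
    finally show ?thesis by (simp add: upper_right_def mat_def vec_eq_iff)
  qed
  then show ?thesis
    by (simp add: l_d_transformed_def l_d_def m_d_eq_step_multiplicity step_multiplicity_zero)
qed

text \<open>If no \<open>B\<^sub>k\<close> loses rank up to \<open>t0\<close>, the untransformed system, \<open>R = I\<close>, has \<open>n\<^sub>R = 0\<close> there. So the finite
  eigenvalues in \<open>(s, t0]\<close> are counted by \<open>l\<^sub>d(t0) - l\<^sub>d(s) \<le> l\<^sub>d(t0)\<close>, a bound independent of \<open>s\<close>.\<close>

lemma finite_eigenvalues_finite_below:
  fixes S :: "nat \<Rightarrow> real \<Rightarrow> real^('n::finite + 'n)^('n + 'n)"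
  assumes S: "\<And>k. k \<le> N \<Longrightarrow> monotone_symplectic_path (S k)"
    and Y: "\<And>t. matrix_solution N (\<lambda>k. S k t) (\<lambda>k. Y k t)" "\<And>t. Y 0 t = block_column 0 (mat 1)"
    and const: "\<And>t k. t \<le> t0 \<Longrightarrow> k \<le> N \<Longrightarrow> rank (upper_right (S k t)) = rank_left (\<lambda>\<mu>. upper_right (S k \<mu>)) t"
  shows "finite (finite_eigenvalues N Y \<inter> {..t0})"
proof (rule ccontr)
  let ?FE = "finite_eigenvalues N Y" and ?R = "\<lambda>k::nat. mat 1 :: real^('n + 'n)^('n + 'n)"
  define n where "n = l_d_transformed N S ?R Y t0"
  assume "infinite (?FE \<inter> {..t0})"
  then obtain T where T: "finite T" "card T = Suc n" "T \<subseteq> ?FE \<inter> {..t0}"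
    using infinite_arbitrarily_large by blast
  define s where "s = Min T - 1"
  have ne: "T \<noteq> {}" using T(2) by auto
  have st: "s < t0" using Min_in[OF T(1) ne] T(3) by (auto simp: s_def)
  have "s < x" if "x \<in> T" for x using Min_le[OF T(1) that] by (simp add: s_def)
  then have sub: "T \<subseteq> ?FE \<inter> {s<..t0}" using T(3) by auto
  note idx = transformed_index_change[of N S ?R Y s t0, OF S symplectic_mat_1 refl Y st]
  have "n_R N S ?R t = 0" if "t \<le> t0" for t
    using const that by (simp add: n_R_def vartheta_def transformed_def matrix_inv_mat_1)
  then have "n_R_sum N S ?R s t0 = 0"
    unfolding n_R_sum_def by (intro sum.neutral) (auto simp: n_R_support_def)
  then have "fe_count N Y {s<..t0} \<le> int n" using idx(3) by (simp add: n_def)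
  moreover have "int (card T) \<le> fe_count N Y {s<..t0}"
  proof -
    have "int (card T) = (\<Sum>t\<in>T. 1)" by simp
    also have "\<dots> \<le> sum (fe_mult N Y) T"
      using T(3) by (intro sum_mono) (auto simp: finite_eigenvalues_def)
    also have "\<dots> \<le> fe_count N Y {s<..t0}"
      unfolding fe_count_def using idx(1,4) sub by (intro sum_mono2) auto
    finally show ?thesis .
  qed
  ultimately show False using T(2) by simp
qed

section \<open>Finite eigenvalues of the Dirichlet problem\<close>

theorem theorem3p8:
  fixes N :: nat
    and S :: "nat \<Rightarrow> real \<Rightarrow> real^('n::finite + 'n)^('n + 'n)"
    and Z :: "nat \<Rightarrow> real \<Rightarrow> real^('n + 'n)^('n + 'n)"
    and Y :: "nat \<Rightarrow> real \<Rightarrow> real^'n^('n + 'n)"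
  assumes "\<And>k. k \<le> N \<Longrightarrow> C1p (S k)"
    and "\<And>k t. k \<le> N \<Longrightarrow> symplectic (S k t)"
    and "\<And>k t. k \<le> N \<Longrightarrow> Psi_nonneg (S k) t"
    and "\<And>t. matrix_solution N (\<lambda>k. S k t) (\<lambda>k. Z k t)"
    and "\<And>t. Z (Suc N) t = mat 1"
    and "\<And>t. matrix_solution N (\<lambda>k. S k t) (\<lambda>k. Y k t)"
    and "\<And>t. Y 0 t = block_column 0 (mat 1)"
  shows
    "(\<forall>a b. a < b \<longrightarrow>
        finite (finite_eigenvalues N Y \<inter> {a<..b}) \<and>
        finite (n_R_support N S (\<lambda>k. Z k a) a b) \<and>
        finite (n_R_support N S (\<lambda>k. Z k b) a b) \<and>
        int (l_d_transformed N S (\<lambda>k. Z k a) Y b) + n_R_sum N S (\<lambda>k. Z k a) a b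
          = fe_count N Y {a<..b} \<and>
        - int (l_d_transformed N S (\<lambda>k. Z k b) Y a) + n_R_sum N S (\<lambda>k. Z k b) a b
          = fe_count N Y {a<..b}) \<and>
     ((\<exists>t0. \<forall>t\<le>t0. \<forall>k\<le>N.
          rank (upper_right (S k t)) = rank_left (\<lambda>\<mu>. upper_right (S k \<mu>)) t) \<longrightarrow>
        (finite_eigenvalues N Y \<noteq> {} \<longrightarrow>
           (\<exists>t1\<in>finite_eigenvalues N Y. \<forall>\<nu>\<in>finite_eigenvalues N Y. t1 \<le> \<nu>)) \<and>
        (\<forall>a b. a < b \<longrightarrow> (\<forall>\<nu>\<in>finite_eigenvalues N Y. a < \<nu>) \<longrightarrow>
           finite (finite_eigenvalues N Y \<inter> {..b}) \<and>
           int (l_d_transformed N S (\<lambda>k. Z k a) Y b) + n_R_sum N S (\<lambda>k. Z k a) a b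
             = fe_count N Y {..b} \<and>
           - int (l_d_transformed N S (\<lambda>k. Z k b) Y a) + n_R_sum N S (\<lambda>k. Z k b) a b
             = fe_count N Y {..b}))"
proof -
  let ?FE = "finite_eigenvalues N Y"
  have paths: "monotone_symplectic_path (S k)" if "k \<le> N" for k
    using assms(1-3) that by (intro C1p_monotone_symplectic_path)
  have Zsymp: "symplectic (Z k c)" if "k \<le> Suc N" for k c
    using fundamental_matrix_symplectic[of N "\<lambda>k. S k c" "\<lambda>k. Z k c" k] assms(2,4,5) that by blast
  have Z0: "l_d_transformed N S (\<lambda>k. Z k c) Y c = 0" for c
    using assms(2,4,5) by (intro l_d_transformed_fundamental_matrix)
  note index = transformed_index_change[of N S "\<lambda>k. Z k c" Y a b for a b c, OF paths Zsymp assms(5) assms(6,7)]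
  have first: "finite (?FE \<inter> {a<..b})"
      "finite (n_R_support N S (\<lambda>k. Z k a) a b)" "finite (n_R_support N S (\<lambda>k. Z k b) a b)"
      "int (l_d_transformed N S (\<lambda>k. Z k a) Y b) + n_R_sum N S (\<lambda>k. Z k a) a b = fe_count N Y {a<..b}"
      "- int (l_d_transformed N S (\<lambda>k. Z k b) Y a) + n_R_sum N S (\<lambda>k. Z k b) a b = fe_count N Y {a<..b}"
    if ab: "a < b" for a b
    using index(1,2)[OF _ _ ab] index(3)[OF _ _ ab, of a] index(3)[OF _ _ ab, of b] Z0[of a] Z0[of b] by auto
  have least: "\<exists>t1\<in>?FE. \<forall>\<nu>\<in>?FE. t1 \<le> \<nu>"
    if t0: "\<forall>t\<le>t0. \<forall>k\<le>N. rank (upper_right (S k t)) = rank_left (\<lambda>\<mu>. upper_right (S k \<mu>)) t"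
      and ne: "?FE \<noteq> {}" for t0
  proof -
    obtain \<nu>0 where \<nu>0: "\<nu>0 \<in> ?FE" using ne by blast
    have "finite (?FE \<inter> {..t0})"
      using t0 by (intro finite_eigenvalues_finite_below[OF paths assms(6,7)]) auto
    moreover have "finite (?FE \<inter> {t0<..\<nu>0})"
      using first(1)[of t0 \<nu>0] by (cases "t0 < \<nu>0") auto
    ultimately have "finite ((?FE \<inter> {..t0}) \<union> (?FE \<inter> {t0<..\<nu>0}))" by blast
    then have fin: "finite (?FE \<inter> {..\<nu>0})" by (rule finite_subset[rotated]) auto
    have mem: "Min (?FE \<inter> {..\<nu>0}) \<in> ?FE \<inter> {..\<nu>0}" using fin \<nu>0 by (intro Min_in) auto
    moreover have "Min (?FE \<inter> {..\<nu>0}) \<le> \<nu>" if "\<nu> \<in> ?FE" for \<nu>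
      using that fin mem by (cases "\<nu> \<le> \<nu>0") auto
    ultimately show ?thesis by blast
  qed
  have all: "?FE \<inter> {..b} = ?FE \<inter> {a<..b}" "fe_count N Y {..b} = fe_count N Y {a<..b}"
    if "\<forall>\<nu>\<in>?FE. a < \<nu>" for a b
  proof -
    show "?FE \<inter> {..b} = ?FE \<inter> {a<..b}" using that by auto
    then show "fe_count N Y {..b} = fe_count N Y {a<..b}" by (simp add: fe_count_def)
  qed
  show ?thesis
  proof (intro conjI allI impI)
    fix a b :: real assume "a < b" and "\<forall>\<nu>\<in>?FE. a < \<nu>"
    note c = all[OF this(2), of b] first[OF this(1)]
    show "finite (?FE \<inter> {..b})" using c by simp
    show "int (l_d_transformed N S (\<lambda>k. Z k a) Y b) + n_R_sum N S (\<lambda>k. Z k a) a b = fe_count N Y {..b}"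
      using c by simp
    show "- int (l_d_transformed N S (\<lambda>k. Z k b) Y a) + n_R_sum N S (\<lambda>k. Z k b) a b = fe_count N Y {..b}"
      using c by simp
  next
    assume "\<exists>t0. \<forall>t\<le>t0. \<forall>k\<le>N. rank (upper_right (S k t)) = rank_left (\<lambda>\<mu>. upper_right (S k \<mu>)) t"
      and "?FE \<noteq> {}"
    then show "\<exists>t1\<in>?FE. \<forall>\<nu>\<in>?FE. t1 \<le> \<nu>" using least by blast
  qed (use first in auto)
qed

end
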